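(* Let $r\ge 3$ be a fixed integer and let $F$ be a fixed graph with $r$ vertices. Let $L=\{\ell_1,\dots,\ell_s\}\subseteq\{0,1,\dots,r-1\}$ be a fixed subset of size $s\notin\{1,r\}$ with $\ell_1<\ell_2<\dots<\ell_s$. If $\ell_1,\ell_2,\dots,\ell_s,r$ do not form an arithmetic progression, then $\Psi_r(n,F,L)=o(n^s)$ as $n\to\infty$. Moreover (still assuming that $\ell_1,\dots,\ell_s,r$ do not form an arithmetic progression), if either (1) $r-\ell_s=\ell_s-\ell_{s-1}$, or (2) $r-\ell_s\neq \ell_s-\ell_{s-1}$ and $(\ell_s-\ell_{s-1})\nmid (r-\ell_s)$, then $\Psi_r(n,F,L)=O(n^{s-1})$.
   Context: All graphs are finite and simple. For a graph $G$ and a graph $F$ on $r$ vertices, $N_{ind}(G,F)$ is the number of subsets $S\subseteq V(G)$ such that the induced subgraph $G[S]$ is isomorphic to $F$; such a set $S$ is called an induced copy of $F$. For $L\subseteq\{0,\dots,r-1\}$, the graph $G$ is $(F,L)$-intersecting if for any two distinct $r$-sets $S,S'\subseteq V(G)$ with $G[S]\cong F\cong G[S']$ one has $|S\cap S'|\in L$. Define $$\Psi_r(n,F,L)=\max\{N_{ind}(G,F): G \text{ is an } n\text{-vertex } (F,L)\text{-intersecting graph}\}.$$ Asymptotic notation is for $n\to\infty$ with $r,F,L$ fixed. *)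

theory Defs
  imports Complex_Main "HOL-Library.Landau_Symbols" "Graph_Theory.Graph_Theory"
begin

text \<open>
  A finite simple graph is a \<^locale>\<open>pair_graph\<close>: finite vertex set, and an irreflexive symmetric set of
  ordered pairs in which the two pairs (u, v) and (v, u) together represent one undirected edge.
\<close>

definition induced_copy :: "'a pair_pre_digraph \<Rightarrow> 'b pair_pre_digraph \<Rightarrow> 'a set \<Rightarrow> bool" where
  "induced_copy G F S \<longleftrightarrow>
     S \<subseteq> pverts G \<and> digraph_iso (with_proj G \<restriction> S) (with_proj F)"

definition N_ind :: "'a pair_pre_digraph \<Rightarrow> 'b pair_pre_digraph \<Rightarrow> nat" where
  "N_ind G F = card {S. induced_copy G F S}"

text \<open>An induced copy of \<open>F\<close> automatically has as many vertices as \<open>F\<close>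
  (\<open>card_induced_copy\<close> below), so the number \<open>r\<close> of vertices of \<open>F\<close> is not a separate parameter.\<close>

definition FL_intersecting :: "'b pair_pre_digraph \<Rightarrow> nat set \<Rightarrow> 'a pair_pre_digraph \<Rightarrow> bool" where
  "FL_intersecting F L G \<longleftrightarrow>
     (\<forall>S S'. induced_copy G F S \<and> induced_copy G F S' \<and> S \<noteq> S' \<longrightarrow> card (S \<inter> S') \<in> L)"

text \<open>Every finite graph is isomorphic to one whose vertices are natural numbers, so the type
  \<^typ>\<open>nat\<close> of vertices is no restriction. The maximum is over a finite set
  (\<open>finite_Psi_set\<close>) that is nonempty once \<open>F\<close> has at least two vertices (\<open>Psi_set_nonempty\<close>).\<close>

definition Psi :: "nat \<Rightarrow> 'b pair_pre_digraph \<Rightarrow> nat set \<Rightarrow> nat" where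
  "Psi n F L = Max {N_ind G F |G :: nat pair_pre_digraph.
     pair_graph G \<and> card (pverts G) = n \<and> FL_intersecting F L G}"

definition arithmetic_progression :: "nat list \<Rightarrow> bool" where
  "arithmetic_progression xs \<longleftrightarrow>
     (\<exists>d::int. \<forall>i. Suc i < length xs \<longrightarrow> int (xs ! Suc i) - int (xs ! i) = d)"

lemma induced_copy_iff:
  assumes G: "pair_graph G" and F: "pair_graph F"
  shows "induced_copy G F S \<longleftrightarrow> S \<subseteq> pverts G \<and>
    (\<exists>f. bij_betw f S (pverts F) \<and>
         (\<forall>u\<in>S. \<forall>v\<in>S. (u, v) \<in> parcs G \<longleftrightarrow> (f u, f v) \<in> parcs F))"
    (is "?L \<longleftrightarrow> ?R")
proof
  interpret F: pair_graph F by fact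
  assume ?L
  then obtain h where S: "S \<subseteq> pverts G"
    and iso: "pre_digraph.digraph_isomorphism (with_proj G \<restriction> S) h"
    and eq: "with_proj F = app_iso h (with_proj G \<restriction> S)"
    by (auto simp: induced_copy_def digraph_iso_def)
  let ?A = "{e \<in> parcs G. fst e \<in> S \<and> snd e \<in> S}"
  let ?f = "iso_verts h"
  have V: "pverts F = ?f ` S" and A: "parcs F = iso_arcs h ` ?A"
    and t: "iso_tail h = fst" and hd: "iso_head h = snd"
    using arg_cong[OF eq, of verts] arg_cong[OF eq, of arcs]
      arg_cong[OF eq, of tail] arg_cong[OF eq, of head]
    by (simp_all add: induce_subgraph_def)
  have inj: "inj_on ?f S" and
    ends: "\<And>e. e \<in> ?A \<Longrightarrow> iso_arcs h e = (?f (fst e), ?f (snd e))"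
    using iso by (auto simp: pre_digraph.digraph_isomorphism_def induce_subgraph_def t hd prod_eq_iff)
  have "(u, v) \<in> parcs G \<longleftrightarrow> (?f u, ?f v) \<in> parcs F" if "u \<in> S" "v \<in> S" for u v
  proof
    assume "(u, v) \<in> parcs G"
    then show "(?f u, ?f v) \<in> parcs F"
      using that ends[of "(u, v)"] unfolding A by force
  next
    assume "(?f u, ?f v) \<in> parcs F"
    then obtain e where e: "e \<in> ?A" "iso_arcs h e = (?f u, ?f v)" unfolding A by force
    then have "?f (fst e) = ?f u" "?f (snd e) = ?f v" using ends[OF e(1)] by auto
    then have "fst e = u" "snd e = v" using inj that e(1) by (auto dest: inj_onD)
    then show "(u, v) \<in> parcs G" using e(1) by force
  qed
  then show ?R using S V inj by (auto simp: bij_betw_def)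
next
  interpret G: pair_graph G by fact
  interpret F: pair_graph F by fact
  assume ?R
  then obtain f where S: "S \<subseteq> pverts G" and f: "bij_betw f S (pverts F)"
    and e: "\<And>u v. u \<in> S \<Longrightarrow> v \<in> S \<Longrightarrow> (u, v) \<in> parcs G \<longleftrightarrow> (f u, f v) \<in> parcs F" by blast
  have inj: "inj_on f S" and V: "f ` S = pverts F" using f by (auto simp: bij_betw_def)
  define h where "h = \<lparr>iso_verts = f, iso_arcs = map_prod f f, iso_head = snd, iso_tail = fst\<rparr>"
  let ?A = "{e \<in> parcs G. fst e \<in> S \<and> snd e \<in> S}"
  have "wf_digraph (with_proj G \<restriction> S)"
    by (auto simp: wf_digraph_def induce_subgraph_def)
  moreover have "inj_on (map_prod f f) ?A"
    using inj by (auto simp: inj_on_def)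
  ultimately have iso: "pre_digraph.digraph_isomorphism (with_proj G \<restriction> S) h"
    using inj by (auto simp: pre_digraph.digraph_isomorphism_def induce_subgraph_def h_def)
  have "map_prod f f ` ?A = parcs F"
  proof (intro equalityI subsetI)
    fix p assume "p \<in> map_prod f f ` ?A"
    then show "p \<in> parcs F" using e by force
  next
    fix p assume p: "p \<in> parcs F"
    obtain x y where xy: "p = (x, y)" by (cases p)
    then have "x \<in> f ` S" "y \<in> f ` S"
      using p F.in_arcsD1 F.in_arcsD2 unfolding V by auto
    then obtain u v where "u \<in> S" "v \<in> S" "x = f u" "y = f v" by auto
    then show "p \<in> map_prod f f ` ?A"
      using e[of u v] p xy by (intro image_eqI[of _ _ "(u, v)"]) auto
  qed
  then have "with_proj F = app_iso h (with_proj G \<restriction> S)"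
    using V by (simp add: app_iso_def with_proj_def induce_subgraph_def h_def)
  then show ?L using iso S by (auto simp: induced_copy_def digraph_iso_def)
qed

lemma card_induced_copy:
  assumes "pair_graph G" "pair_graph F" "induced_copy G F S"
  shows "card S = card (pverts F)"
  using assms bij_betw_same_card induced_copy_iff by metis

lemma finite_Psi_set:
  "finite {N_ind G F |G :: nat pair_pre_digraph.
     pair_graph G \<and> card (pverts G) = n \<and> FL_intersecting F L G}"
proof (rule finite_subset)
  show "{N_ind G F |G :: nat pair_pre_digraph.
     pair_graph G \<and> card (pverts G) = n \<and> FL_intersecting F L G} \<subseteq> {..2 ^ n}"
  proof clarsimp
    fix G :: "nat pair_pre_digraph" assume "pair_graph G" "n = card (pverts G)"
    interpret pair_graph G by fact
    have "N_ind G F \<le> card (Pow (pverts G))"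
      unfolding N_ind_def by (rule card_mono) (auto simp: induced_copy_def pair_finite_verts)
    then show "N_ind G F \<le> 2 ^ card (pverts G)"
      by (simp add: card_Pow pair_finite_verts)
  qed
qed simp

lemma Psi_set_nonempty:
  assumes F: "pair_graph F" and card: "card (pverts F) \<ge> 2"
  shows "{N_ind G F |G :: nat pair_pre_digraph.
     pair_graph G \<and> card (pverts G) = n \<and> FL_intersecting F L G} \<noteq> {}"
proof -
  interpret F: pair_graph F by fact
  obtain x y where xy: "x \<in> pverts F" "y \<in> pverts F" "x \<noteq> y"
    using card card_le_Suc0_iff_eq[OF F.pair_finite_verts] by fastforce
  define G :: "nat pair_pre_digraph" where
    "G = \<lparr>pverts = {..<n}, parcs = {(u, v). u < n \<and> v < n \<and> u \<noteq> v \<and> (x, y) \<notin> parcs F}\<rparr>"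
  have "finite (parcs G)"
    by (rule finite_subset[of _ "{..<n} \<times> {..<n}"]) (auto simp: G_def)
  then have G: "pair_graph G"
    by unfold_locales (auto simp: G_def symmetric_def sym_def)
  have "\<not> induced_copy G F S" for S
  proof
    assume copy: "induced_copy G F S"
    obtain f where S: "S \<subseteq> pverts G" and f: "bij_betw f S (pverts F)"
      and e: "\<forall>u\<in>S. \<forall>v\<in>S. (u, v) \<in> parcs G \<longleftrightarrow> (f u, f v) \<in> parcs F"
      using iffD1[OF induced_copy_iff[OF G F] copy] by (elim conjE exE) (rule that)
    obtain u v where uv: "u \<in> S" "v \<in> S" "f u = x" "f v = y"
      using xy unfolding bij_betw_imp_surj_on[OF f, symmetric] by blast
    have "(u, v) \<in> parcs G \<longleftrightarrow> (x, y) \<in> parcs F" using e uv by blast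
    moreover have "u \<noteq> v" "u < n" "v < n" using uv xy(3) S by (auto simp: G_def)
    then have "(u, v) \<in> parcs G \<longleftrightarrow> (x, y) \<notin> parcs F" by (simp add: G_def)
    ultimately show False by blast
  qed
  then have "FL_intersecting F L G" by (simp add: FL_intersecting_def)
  moreover have "card (pverts G) = n" by (simp add: G_def)
  ultimately show ?thesis using G by blast
qed

end

theory Submission
  imports Defs "HOL-Library.FuncSet"
begin

text \<open>
  Colour the vertices of \<open>G\<close> by the vertices of \<open>F\<close> so that a positive proportion of the induced copies
  are coloured by an isomorphism onto \<open>F\<close>, and pass to a homogeneous subfamily in the sense of Furedi:
  the set of colour patterns of pairwise intersections is closed under intersection. If there are more than
  \<open>C n^(s-1)\<close> copies, every set of \<open>s - 1\<close> colours lies in a pattern, so the patterns are the proper flats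
  of a perfect matroid design on \<open>V(F)\<close> whose flats have the sizes \<open>l_1 < ... < l_s < r\<close>. Counting flats
  above a flat of size \<open>l_(s-1)\<close> shows that \<open>d = l_s - l_(s-1)\<close> divides \<open>r - l_s\<close>, and equality
  \<open>r - l_s = d\<close> propagates downwards to an arithmetic progression.

  In the remaining case suppose that there are \<open>\<epsilon> n^s\<close> copies. Fixing \<open>s - 2\<close> vertices leaves a positive
  proportion of \<open>n^2\<close> copies sharing a core of \<open>l_(s-1)\<close> vertices, the rest of each copy being split into
  \<open>m = (r - l_(s-1)) / d \<ge> 3\<close> blocks of size \<open>d\<close>, any two of which determine the copy. With the blocks as
  supervertices this is a linear family of \<open>m\<close>-cliques, so as in the Ruzsa-Szemeredi theorem
  the regularity lemma yields two \<open>m\<close>-cliques sharing \<open>m - 1\<close> supervertices, that is, two induced copies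
  of \<open>F\<close> meeting in \<open>r - d > l_s\<close> vertices.
\<close>

section \<open>The regularity lemma\<close>

text \<open>The perfect matroid design arises without an exchange axiom. Proper flats have only s
  possible sizes, so a chain of flats ending in \<open>V(F)\<close> climbs at most s steps, while
  every s - 1 colours lie in a proper flat; hence a colour added to a flat raises the level by
  exactly one. The covering property itself is a count: if some s - 1 colours lay in no pattern, a
  member of the homogeneous subfamily would be determined by its vertices of these colours, and
  there would be only O(n^(s-1)) copies.

  The obstacle in the o(n^s) bound is that a clique of supervertices need not come from a single
  copy. It still yields an induced copy, because any two of its vertices lie in a common copy that
  is coloured by its own isomorphism. Linearity of the family replaces the usual deletion of edges:
  each bad pair of supervertices spoils at most one clique, so some clique of the family avoids all
  bad pairs, and the cells of that clique contain the two cliques that are wanted.\<close>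

definition cond_avg :: "'a set \<Rightarrow> ('a \<Rightarrow> 'k) \<Rightarrow> ('a \<Rightarrow> real) \<Rightarrow> 'a \<Rightarrow> real" where
  "cond_avg \<Omega> \<kappa> f p = (\<Sum>q | q \<in> \<Omega> \<and> \<kappa> q = \<kappa> p. f q) / card {q \<in> \<Omega>. \<kappa> q = \<kappa> p}"

definition energy :: "'a set \<Rightarrow> ('a \<Rightarrow> 'k) \<Rightarrow> ('a \<Rightarrow> real) \<Rightarrow> real" where
  "energy \<Omega> \<kappa> f = (\<Sum>p\<in>\<Omega>. (cond_avg \<Omega> \<kappa> f p)\<^sup>2)"

lemma cond_avg_cong: "\<kappa> p = \<kappa> q \<Longrightarrow> cond_avg \<Omega> \<kappa> f p = cond_avg \<Omega> \<kappa> f q"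
  by (simp add: cond_avg_def)

text \<open>\<open>cond_avg\<close> is the orthogonal projection onto the functions that are
  constant on the classes of \<open>\<kappa>\<close>, so pairing with such a function
  \<open>g\<close> does not distinguish \<open>f\<close> from its average. After the sums are
  swapped the class size \<open>w\<close> cancels.\<close>

lemma sum_mult_cond_avg:
  assumes "finite \<Omega>" and g: "\<And>p q. p \<in> \<Omega> \<Longrightarrow> q \<in> \<Omega> \<Longrightarrow> \<kappa> p = \<kappa> q \<Longrightarrow> g p = g q"
  shows "(\<Sum>p\<in>\<Omega>. g p * cond_avg \<Omega> \<kappa> f p) = (\<Sum>p\<in>\<Omega>. g p * f p)"
proof -
  define w where "w p = real (card {q \<in> \<Omega>. \<kappa> q = \<kappa> p})" for p
  have "(\<Sum>p\<in>\<Omega>. g p * cond_avg \<Omega> \<kappa> f p)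
      = (\<Sum>p\<in>\<Omega>. \<Sum>q\<in>\<Omega>. if \<kappa> q = \<kappa> p then g p * f q / w p else 0)"
    using assms(1)
    by (intro sum.cong refl)
      (simp add: cond_avg_def w_def sum.inter_filter[symmetric] sum_distrib_left sum_divide_distrib)
  also have "\<dots> = (\<Sum>q\<in>\<Omega>. \<Sum>p\<in>\<Omega>. if \<kappa> q = \<kappa> p then g p * f q / w p else 0)"
    by (rule sum.swap)
  also have "\<dots> = (\<Sum>q\<in>\<Omega>. \<Sum>p\<in>\<Omega>. if \<kappa> p = \<kappa> q then g q * f q / w q else 0)"
    by (intro sum.cong refl) (auto simp: w_def dest: g)
  also have "\<dots> = (\<Sum>q\<in>\<Omega>. w q * (g q * f q / w q))"
    using assms(1) by (simp add: sum.inter_filter[symmetric] w_def)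
  also have "\<dots> = (\<Sum>q\<in>\<Omega>. g q * f q)"
  proof (rule sum.cong)
    fix q assume "q \<in> \<Omega>"
    then have "{p \<in> \<Omega>. \<kappa> p = \<kappa> q} \<noteq> {}" by blast
    then have "w q \<noteq> 0" using assms(1) by (simp add: w_def)
    then show "w q * (g q * f q / w q) = g q * f q" by simp
  qed simp
  finally show ?thesis .
qed

lemma sum_cond_avg_saturated:
  assumes "finite \<Omega>" "R \<subseteq> \<Omega>"
    and "\<And>p q. p \<in> R \<Longrightarrow> q \<in> \<Omega> \<Longrightarrow> \<kappa> p = \<kappa> q \<Longrightarrow> q \<in> R"
  shows "(\<Sum>p\<in>R. cond_avg \<Omega> \<kappa> f p) = (\<Sum>p\<in>R. f p)"
proof -
  have eq: "(\<Sum>p\<in>R. h p) = (\<Sum>p\<in>\<Omega>. of_bool (p \<in> R) * h p)" for h :: "'a \<Rightarrow> real"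
    using assms(1,2) by (intro sum.mono_neutral_cong_left) auto
  have "(\<Sum>p\<in>\<Omega>. of_bool (p \<in> R) * cond_avg \<Omega> \<kappa> f p) = (\<Sum>p\<in>\<Omega>. of_bool (p \<in> R) * f p)"
  proof (rule sum_mult_cond_avg)
    fix p q assume "p \<in> \<Omega>" "q \<in> \<Omega>" "\<kappa> p = \<kappa> q"
    then have "p \<in> R \<longleftrightarrow> q \<in> R" using assms(3)[of p q] assms(3)[of q p] by auto
    then show "of_bool (p \<in> R) = (of_bool (q \<in> R) :: real)" by simp
  qed (rule assms(1))
  then show ?thesis unfolding eq[of f] eq[of "cond_avg \<Omega> \<kappa> f"] .
qed

text \<open>Pythagoras: the coarse average is the projection of the finer one, so the cross term of
  the expanded square equals the coarse energy.\<close>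

lemma energy_refine:
  assumes "finite \<Omega>" and ref: "\<And>p q. p \<in> \<Omega> \<Longrightarrow> q \<in> \<Omega> \<Longrightarrow> \<kappa>' p = \<kappa>' q \<Longrightarrow> \<kappa> p = \<kappa> q"
  shows "(\<Sum>p\<in>\<Omega>. (cond_avg \<Omega> \<kappa>' f p - cond_avg \<Omega> \<kappa> f p)\<^sup>2) = energy \<Omega> \<kappa>' f - energy \<Omega> \<kappa> f"
proof -
  let ?c = "cond_avg \<Omega> \<kappa> f" and ?c' = "cond_avg \<Omega> \<kappa>' f"
  have 1: "(\<Sum>p\<in>\<Omega>. ?c p * ?c' p) = (\<Sum>p\<in>\<Omega>. ?c p * f p)"
    using assms(1) ref by (intro sum_mult_cond_avg cond_avg_cong)
  have 2: "(\<Sum>p\<in>\<Omega>. (?c p)\<^sup>2) = (\<Sum>p\<in>\<Omega>. ?c p * f p)"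
    unfolding power2_eq_square using assms(1) by (intro sum_mult_cond_avg cond_avg_cong)
  have "(\<Sum>p\<in>\<Omega>. (?c' p - ?c p)\<^sup>2)
      = (\<Sum>p\<in>\<Omega>. (?c' p)\<^sup>2) - 2 * (\<Sum>p\<in>\<Omega>. ?c p * ?c' p) + (\<Sum>p\<in>\<Omega>. (?c p)\<^sup>2)"
    by (simp add: power2_diff sum.distrib sum_subtractf sum_distrib_left mult.commute mult.left_commute)
  then show ?thesis unfolding energy_def using 1 2 by linarith
qed

lemma energy_le_card:
  assumes "finite \<Omega>" "\<And>p. p \<in> \<Omega> \<Longrightarrow> 0 \<le> f p \<and> f p \<le> 1"
  shows "energy \<Omega> \<kappa> f \<le> card \<Omega>"
proof -
  have "(cond_avg \<Omega> \<kappa> f p)\<^sup>2 \<le> 1" for p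
  proof -
    have "0 \<le> (\<Sum>q | q \<in> \<Omega> \<and> \<kappa> q = \<kappa> p. f q)" using assms by (auto intro: sum_nonneg)
    moreover have "(\<Sum>q | q \<in> \<Omega> \<and> \<kappa> q = \<kappa> p. f q) \<le> of_nat (card {q \<in> \<Omega>. \<kappa> q = \<kappa> p}) * 1"
      using assms by (intro sum_bounded_above) auto
    ultimately have "0 \<le> cond_avg \<Omega> \<kappa> f p" "cond_avg \<Omega> \<kappa> f p \<le> 1"
      by (auto simp: cond_avg_def divide_simps)
    then show ?thesis by (simp add: power_le_one)
  qed
  then have "energy \<Omega> \<kappa> f \<le> of_nat (card \<Omega>) * 1"
    unfolding energy_def by (intro sum_bounded_above) auto
  then show ?thesis by simp
qed

text \<open>Cauchy-Schwarz on \<open>R\<close>, obtained by summing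
  \<open>(g p - c)\<^sup>2 \<ge> 0\<close>, where \<open>c\<close> is \<delta> or -\<delta> with the
  sign of the sum of \<open>g\<close>.\<close>

lemma sum_squares_ge:
  fixes g :: "'a \<Rightarrow> real" and \<delta> :: real
  assumes "finite R" "0 \<le> \<delta>" "\<delta> * card R \<le> \<bar>\<Sum>p\<in>R. g p\<bar>"
  shows "\<delta>\<^sup>2 * card R \<le> (\<Sum>p\<in>R. (g p)\<^sup>2)"
proof -
  obtain c where c: "c\<^sup>2 = \<delta>\<^sup>2" "\<delta> * card R * \<delta> \<le> c * (\<Sum>p\<in>R. g p)"
  proof (cases "(\<Sum>p\<in>R. g p) \<ge> 0")
    case True
    then show ?thesis using assms that[of \<delta>]
      by (metis abs_of_nonneg mult.commute mult_left_mono)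
  next
    case False
    then have "\<delta> * card R * \<delta> \<le> - \<delta> * (\<Sum>p\<in>R. g p)"
      using assms mult_left_mono[of "\<delta> * card R" "- (\<Sum>p\<in>R. g p)" \<delta>] by (simp add: mult.commute)
    then show ?thesis using that[of "- \<delta>"] by simp
  qed
  have "(\<Sum>p\<in>R. 2 * c * g p - c\<^sup>2) \<le> (\<Sum>p\<in>R. (g p)\<^sup>2)"
  proof (rule sum_mono)
    fix p
    show "2 * c * g p - c\<^sup>2 \<le> (g p)\<^sup>2"
      using zero_le_power2[of "g p - c"] unfolding power2_diff by (simp add: algebra_simps)
  qed
  moreover have "(\<Sum>p\<in>R. 2 * c * g p - c\<^sup>2) = 2 * (c * (\<Sum>p\<in>R. g p)) - \<delta>\<^sup>2 * card R"
    by (simp add: sum_subtractf sum_distrib_left mult.assoc c(1))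
  ultimately show ?thesis using c(2) by (simp add: power2_eq_square mult.commute mult.left_commute)
qed

text \<open>A family \<open>\<S>\<close> of vertex sets encodes the partition into the atoms of the algebra it generates,
  so that enlarging \<open>\<S>\<close> refines the partition.\<close>

definition sig :: "'v set set \<Rightarrow> 'v \<Rightarrow> 'v set set" where
  "sig \<S> x = {S \<in> \<S>. x \<in> S}"

definition cell :: "'v set \<Rightarrow> 'v set set \<Rightarrow> 'v \<Rightarrow> 'v set" where
  "cell V \<S> x = {y \<in> V. sig \<S> y = sig \<S> x}"

definition density :: "('v \<times> 'v) set \<Rightarrow> 'v set \<Rightarrow> 'v set \<Rightarrow> real" where
  "density E A B = card (E \<inter> A \<times> B) / (real (card A) * real (card B))"

text \<open>The deviation of densities is multiplied out by \<open>card X * card Y\<close>, so an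
  empty \<open>X\<close> or \<open>Y\<close> satisfies the inequality trivially.\<close>

definition regular_pair :: "real \<Rightarrow> ('v \<times> 'v) set \<Rightarrow> 'v set \<Rightarrow> 'v set \<Rightarrow> bool" where
  "regular_pair \<delta> E A B \<longleftrightarrow> (\<forall>X Y. X \<subseteq> A \<longrightarrow> Y \<subseteq> B \<longrightarrow> \<delta> * real (card A) \<le> card X \<longrightarrow> \<delta> * real (card B) \<le> card Y \<longrightarrow>
     \<bar>card (E \<inter> X \<times> Y) - density E A B * (card X * card Y)\<bar> \<le> \<delta> * real (card X * card Y))"

definition irregular :: "real \<Rightarrow> 'v set \<Rightarrow> ('v \<times> 'v) set \<Rightarrow> 'v set set \<Rightarrow> ('v \<times> 'v) set" where
  "irregular \<delta> V E \<S> = {(x, y) \<in> V \<times> V. \<not> regular_pair \<delta> E (cell V \<S> x) (cell V \<S> y)}"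

lemma cell_cong: "sig \<S> x = sig \<S> y \<Longrightarrow> cell V \<S> x = cell V \<S> y"
  by (simp add: cell_def)

lemma sig_mono: "\<S> \<subseteq> \<S>' \<Longrightarrow> sig \<S>' x = sig \<S>' y \<Longrightarrow> sig \<S> x = sig \<S> y"
  by (auto simp: sig_def)

lemma finite_cell: "finite V \<Longrightarrow> finite (cell V \<S> x)"
  by (simp add: cell_def)

abbreviation pair_sig :: "'v set set \<Rightarrow> 'v \<times> 'v \<Rightarrow> 'v set set \<times> 'v set set" where
  "pair_sig \<S> \<equiv> map_prod (sig \<S>) (sig \<S>)"

lemma pair_sig_class:
  "{q \<in> V \<times> V. pair_sig \<S> q = pair_sig \<S> (x, y)} = cell V \<S> x \<times> cell V \<S> y"
  by (auto simp: cell_def)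

lemma sum_of_bool_card:
  assumes "finite R" shows "(\<Sum>p\<in>R. of_bool (p \<in> E) :: real) = card (E \<inter> R)"
proof -
  have "(\<Sum>p\<in>R. of_bool (p \<in> E) :: real) = (\<Sum>p\<in>E \<inter> R. 1)"
    using assms by (intro sum.mono_neutral_cong_right) auto
  then show ?thesis by simp
qed

lemma cond_avg_density:
  assumes "finite V"
  shows "cond_avg (V \<times> V) (pair_sig \<S>) (\<lambda>p. of_bool (p \<in> E)) (x, y)
    = density E (cell V \<S> x) (cell V \<S> y)"
  using finite_cell[OF assms, of \<S>]
  unfolding cond_avg_def pair_sig_class density_def
  by (subst sum_of_bool_card) (auto simp: card_cartesian_product)

lemma image_pairE: "k \<in> f ` I \<Longrightarrow> (\<And>x y. (x, y) \<in> I \<Longrightarrow> k = f (x, y) \<Longrightarrow> thesis) \<Longrightarrow> thesis"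
  by fast

text \<open>A witness \<open>X\<close>, \<open>Y\<close> is adjoined for every irregular pair of
  cells A, B. On the rectangle \<open>X \<times> Y\<close> the old average is the constant cell
  density, while the new average sums to the true number of edges; the two therefore differ in
  squared norm by at least \<delta>^2 |X| |Y| \<ge> \<delta>^4 |A| |B|. Summing over all irregular
  pairs gives at least \<delta>^5 |V|^2. At most \<open>4 ^ card \<S>\<close> pairs of signatures
  occur, and each contributes two sets.\<close>

lemma energy_increment:
  fixes \<delta> :: real
  assumes V: "finite V" and S: "finite \<S>" and d: "0 < \<delta>"
    and irr: "card (irregular \<delta> V E \<S>) > \<delta> * (card V)\<^sup>2"
  shows "\<exists>\<S>'. finite \<S>' \<and> card \<S>' \<le> card \<S> + 2 * 4 ^ card \<S> \<and>
    energy (V \<times> V) (pair_sig \<S>') (\<lambda>p. of_bool (p \<in> E))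
      \<ge> energy (V \<times> V) (pair_sig \<S>) (\<lambda>p. of_bool (p \<in> E)) + \<delta> ^ 5 * (card V)\<^sup>2"
proof -
  let ?I = "irregular \<delta> V E \<S>" and ?f = "\<lambda>p. of_bool (p \<in> E) :: real"
  define K where "K = pair_sig \<S> ` ?I"
  have I_sub: "?I \<subseteq> V \<times> V" by (auto simp: irregular_def)
  have finI: "finite ?I" using I_sub V finite_subset by blast
  define \<Phi> where "\<Phi> p Z \<longleftrightarrow> fst Z \<subseteq> cell V \<S> (fst p) \<and> snd Z \<subseteq> cell V \<S> (snd p) \<and>
      \<delta> * card (cell V \<S> (fst p)) \<le> card (fst Z) \<and> \<delta> * card (cell V \<S> (snd p)) \<le> card (snd Z) \<and>
      \<bar>card (E \<inter> fst Z \<times> snd Z)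
          - density E (cell V \<S> (fst p)) (cell V \<S> (snd p)) * (card (fst Z) * card (snd Z))\<bar>
        > \<delta> * (card (fst Z) * card (snd Z))" for p and Z :: "'a set \<times> 'a set"
  \<comment> \<open>One witness serves all vertex pairs with the same signatures; this bounds the
    number of new sets and keeps the rectangles disjoint.\<close>
  have "\<exists>Z. \<forall>p \<in> ?I. pair_sig \<S> p = k \<longrightarrow> \<Phi> p Z" if k: "k \<in> K" for k
  proof -
    obtain x y where p: "(x, y) \<in> ?I" "k = pair_sig \<S> (x, y)"
      using k unfolding K_def by (rule image_pairE)
    then obtain X Y where XY: "X \<subseteq> cell V \<S> x" "Y \<subseteq> cell V \<S> y"
      "\<delta> * card (cell V \<S> x) \<le> card X" "\<delta> * card (cell V \<S> y) \<le> card Y"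
      "\<bar>card (E \<inter> X \<times> Y) - density E (cell V \<S> x) (cell V \<S> y) * (card X * card Y)\<bar>
        > \<delta> * (card X * card Y)"
      by (auto simp: irregular_def regular_pair_def not_le)
    have "cell V \<S> (fst q) = cell V \<S> x \<and> cell V \<S> (snd q) = cell V \<S> y"
      if "pair_sig \<S> q = k" for q
      using that p(2) by (cases q) (auto intro!: cell_cong)
    then show ?thesis using XY by (intro exI[of _ "(X, Y)"]) (simp add: \<Phi>_def)
  qed
  then obtain Z where Z: "\<And>k p. k \<in> K \<Longrightarrow> p \<in> ?I \<Longrightarrow> pair_sig \<S> p = k \<Longrightarrow> \<Phi> p (Z k)"
    by metis
  define X Y where "X k = fst (Z k)" and "Y k = snd (Z k)" for k
  have XY: "X (pair_sig \<S> p) \<subseteq> cell V \<S> (fst p) \<and> Y (pair_sig \<S> p) \<subseteq> cell V \<S> (snd p) \<and>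
      \<delta> * card (cell V \<S> (fst p)) \<le> card (X (pair_sig \<S> p)) \<and>
      \<delta> * card (cell V \<S> (snd p)) \<le> card (Y (pair_sig \<S> p)) \<and>
      \<bar>card (E \<inter> X (pair_sig \<S> p) \<times> Y (pair_sig \<S> p))
         - density E (cell V \<S> (fst p)) (cell V \<S> (snd p))
           * (card (X (pair_sig \<S> p)) * card (Y (pair_sig \<S> p)))\<bar>
       > \<delta> * (card (X (pair_sig \<S> p)) * card (Y (pair_sig \<S> p)))" if "p \<in> ?I" for p
    using Z[of "pair_sig \<S> p" p] that unfolding X_def Y_def \<Phi>_def K_def by blast
  define \<S>' where "\<S>' = \<S> \<union> (X ` K \<union> Y ` K)"
  have "K \<subseteq> Pow \<S> \<times> Pow \<S>" by (auto simp: K_def sig_def)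
  then have "card K \<le> card (Pow \<S> \<times> Pow \<S>)" using S by (intro card_mono) auto
  also have "\<dots> = 4 ^ card \<S>"
    using S by (simp add: card_cartesian_product card_Pow power_mult_distrib[symmetric])
  finally have cK: "card K \<le> 4 ^ card \<S>" .
  have finK: "finite K" using finI by (simp add: K_def)
  have "card \<S>' \<le> card \<S> + (card (X ` K) + card (Y ` K))"
    unfolding \<S>'_def by (meson card_Un_le add_left_mono order_trans)
  also have "\<dots> \<le> card \<S> + 2 * 4 ^ card \<S>"
    using card_image_le[OF finK, of X] card_image_le[OF finK, of Y] cK by linarith
  finally have c': "card \<S>' \<le> card \<S> + 2 * 4 ^ card \<S>" .
  let ?c = "cond_avg (V \<times> V) (pair_sig \<S>) ?f" and ?c' = "cond_avg (V \<times> V) (pair_sig \<S>') ?f"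
  define R where "R k = X k \<times> Y k" for k
  have cell_sub: "R (pair_sig \<S> p) \<subseteq> {q \<in> V \<times> V. pair_sig \<S> q = pair_sig \<S> p}" if "p \<in> ?I" for p
  proof -
    obtain x y where p: "p = (x, y)" by (cases p)
    have "R (pair_sig \<S> p) \<subseteq> cell V \<S> x \<times> cell V \<S> y"
      unfolding R_def using XY[OF that] p by (intro Sigma_mono) simp_all
    then show ?thesis unfolding p pair_sig_class .
  qed
  have R_class: "q \<in> V \<times> V \<and> pair_sig \<S> q = k" if k: "k \<in> K" and q: "q \<in> R k" for k q
  proof -
    obtain p where p: "k = pair_sig \<S> p" "p \<in> ?I" using k unfolding K_def by (rule imageE)
    have "q \<in> {q \<in> V \<times> V. pair_sig \<S> q = pair_sig \<S> p}"
      using cell_sub[OF p(2)] q unfolding p(1) by (rule subsetD)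
    then show ?thesis unfolding p(1) by (rule CollectD)
  qed
  have R_sub: "R k \<subseteq> V \<times> V" if "k \<in> K" for k
    using R_class[OF that] by blast
  have disj: "R k \<inter> R k' = {}" if "k \<in> K" "k' \<in> K" "k \<noteq> k'" for k k'
    using that R_class by blast
  have part: "\<delta> ^ 4 * card {p \<in> ?I. pair_sig \<S> p = k} \<le> (\<Sum>p\<in>R k. (?c' p - ?c p)\<^sup>2)"
    if k: "k \<in> K" for k
  proof -
    obtain x y where p: "(x, y) \<in> ?I" "k = pair_sig \<S> (x, y)"
      using k unfolding K_def by (rule image_pairE)
    let ?A = "cell V \<S> x" and ?B = "cell V \<S> y"
    have XY: "X k \<subseteq> ?A" "Y k \<subseteq> ?B" "\<delta> * card ?A \<le> card (X k)" "\<delta> * card ?B \<le> card (Y k)"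
      "\<delta> * (card (X k) * card (Y k))
        < \<bar>card (E \<inter> X k \<times> Y k) - density E ?A ?B * (card (X k) * card (Y k))\<bar>"
      using XY[OF p(1), folded p(2)] by auto
    have fin: "finite (R k)" using R_sub[OF k] V finite_subset by blast
    have cR: "card (R k) = card (X k) * card (Y k)" by (simp add: R_def card_cartesian_product)
    have "(\<Sum>p\<in>R k. ?c' p) = (\<Sum>p\<in>R k. ?f p)"
    proof (rule sum_cond_avg_saturated)
      fix p q assume "p \<in> R k" "q \<in> V \<times> V" "pair_sig \<S>' p = pair_sig \<S>' q"
      moreover have "X k \<in> \<S>'" "Y k \<in> \<S>'" using k by (auto simp: \<S>'_def)
      ultimately show "q \<in> R k" by (cases p; cases q) (auto simp: R_def sig_def)
    qed (use V R_sub[OF k] in auto)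
    also have "\<dots> = card (E \<inter> X k \<times> Y k)"
      using sum_of_bool_card[OF fin, of E] unfolding R_def .
    finally have s': "(\<Sum>p\<in>R k. ?c' p) = card (E \<inter> X k \<times> Y k)" .
    have "?c q = density E ?A ?B" if "q \<in> R k" for q
    proof -
      have "pair_sig \<S> q = pair_sig \<S> (x, y)" using R_class[OF k that] p(2) by simp
      then show ?thesis by (simp only: cond_avg_cong[of _ q "(x, y)"] cond_avg_density[OF V])
    qed
    then have "(\<Sum>p\<in>R k. ?c p) = density E ?A ?B * (card (X k) * card (Y k))"
      by (simp add: cR)
    then have "\<delta> * card (R k) \<le> \<bar>\<Sum>p\<in>R k. ?c' p - ?c p\<bar>"
      using XY(5) by (simp add: sum_subtractf s' cR)
    then have 1: "\<delta>\<^sup>2 * card (R k) \<le> (\<Sum>p\<in>R k. (?c' p - ?c p)\<^sup>2)"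
      using fin d by (intro sum_squares_ge) auto
    have "{p \<in> ?I. pair_sig \<S> p = k} \<subseteq> ?A \<times> ?B"
      using I_sub pair_sig_class[of V \<S> x y] p(2) by blast
    then have "card {p \<in> ?I. pair_sig \<S> p = k} \<le> card (?A \<times> ?B)"
      by (intro card_mono) (auto intro: finite_cell V)
    then have "\<delta>\<^sup>2 * real (card {p \<in> ?I. pair_sig \<S> p = k}) \<le> \<delta>\<^sup>2 * real (card ?A * card ?B)"
      by (intro mult_left_mono) (auto simp: card_cartesian_product simp del: of_nat_mult)
    also have "\<dots> = (\<delta> * card ?A) * (\<delta> * card ?B)" by (simp add: power2_eq_square)
    also have "\<dots> \<le> real (card (X k)) * real (card (Y k))"
      using XY(3,4) d by (intro mult_mono) auto
    finally have "\<delta>\<^sup>2 * (\<delta>\<^sup>2 * card {p \<in> ?I. pair_sig \<S> p = k}) \<le> \<delta>\<^sup>2 * card (R k)"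
      by (intro mult_left_mono) (simp_all add: cR)
    moreover have "\<delta> ^ 4 * card {p \<in> ?I. pair_sig \<S> p = k}
        = \<delta>\<^sup>2 * (\<delta>\<^sup>2 * card {p \<in> ?I. pair_sig \<S> p = k})"
      by (simp add: power2_eq_square power4_eq_xxxx)
    ultimately show ?thesis using 1 by linarith
  qed
  have "card ?I = (\<Sum>k\<in>K. card {p \<in> ?I. pair_sig \<S> p = k})"
    using finI unfolding K_def
    by (simp only: card_eq_sum sum.image_gen[of _ _ "pair_sig \<S>"])
  then have "\<delta> ^ 4 * card ?I = (\<Sum>k\<in>K. \<delta> ^ 4 * card {p \<in> ?I. pair_sig \<S> p = k})"
    by (simp add: sum_distrib_left)
  also have "\<dots> \<le> (\<Sum>k\<in>K. \<Sum>p\<in>R k. (?c' p - ?c p)\<^sup>2)"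
    using part by (rule sum_mono)
  also have "\<dots> = (\<Sum>p\<in>(\<Union>k\<in>K. R k). (?c' p - ?c p)\<^sup>2)"
  proof (rule sum.UNION_disjoint[symmetric])
    show "\<forall>k\<in>K. finite (R k)"
      using R_sub finite_subset[OF _ finite_cartesian_product[OF V V]] by blast
    show "\<forall>k\<in>K. \<forall>k'\<in>K. k \<noteq> k' \<longrightarrow> R k \<inter> R k' = {}" using disj by blast
  qed (rule finK)
  also have "\<dots> \<le> (\<Sum>p\<in>V \<times> V. (?c' p - ?c p)\<^sup>2)"
  proof (rule sum_mono2)
    show "(\<Union>k\<in>K. R k) \<subseteq> V \<times> V" using R_sub by (rule UN_least)
  qed (use V in simp_all)
  also have "\<dots> = energy (V \<times> V) (pair_sig \<S>') ?f - energy (V \<times> V) (pair_sig \<S>) ?f"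
  proof (rule energy_refine)
    fix p q assume "pair_sig \<S>' p = pair_sig \<S>' q"
    moreover have "\<S> \<subseteq> \<S>'" by (simp add: \<S>'_def)
    ultimately show "pair_sig \<S> p = pair_sig \<S> q"
      by (cases p; cases q) (auto dest: sig_mono)
  qed (use V in auto)
  finally have "\<delta> ^ 4 * card ?I \<le> energy (V \<times> V) (pair_sig \<S>') ?f - energy (V \<times> V) (pair_sig \<S>) ?f" .
  moreover have "\<delta> ^ 4 * (\<delta> * (card V)\<^sup>2) \<le> \<delta> ^ 4 * card ?I"
    using irr d by (intro mult_left_mono) auto
  moreover have "\<delta> ^ 4 * (\<delta> * (card V)\<^sup>2) = \<delta> ^ 5 * (card V)\<^sup>2"
    by (simp add: power_numeral_reduce)
  ultimately have "energy (V \<times> V) (pair_sig \<S>') ?f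
      \<ge> energy (V \<times> V) (pair_sig \<S>) ?f + \<delta> ^ 5 * (card V)\<^sup>2" by linarith
  moreover have "finite \<S>'" using S finK by (simp add: \<S>'_def)
  ultimately show ?thesis using c' by (intro exI[of _ \<S>'] conjI)
qed

text \<open>Refinement starts from the empty family and continues while too many pairs are
  irregular. The energy is at most |V|^2 and each round adds \<delta>^5 |V|^2, so the process stops
  within \<open>i\<close> rounds once \<open>i * \<delta> ^ 5 > 1\<close>. The bound
  \<open>g i\<close> is of tower type and independent of the graph.\<close>

theorem regularity_lemma:
  fixes \<delta> :: real
  assumes d: "0 < \<delta>"
  obtains k :: nat where "\<And>(V :: 'v set) E. finite V \<Longrightarrow>
    \<exists>\<S>. finite \<S> \<and> card \<S> \<le> k \<and> card (irregular \<delta> V E \<S>) \<le> \<delta> * (card V)\<^sup>2"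
proof -
  define g :: "nat \<Rightarrow> nat" where "g i = ((\<lambda>k. k + 2 * 4 ^ k) ^^ i) 0" for i
  have step: "(\<exists>\<S>. finite \<S> \<and> card \<S> \<le> g i \<and> card (irregular \<delta> V E \<S>) \<le> \<delta> * (card V)\<^sup>2) \<or>
    (\<exists>\<S>. finite \<S> \<and> card \<S> \<le> g i \<and>
      energy (V \<times> V) (pair_sig \<S>) (\<lambda>p. of_bool (p \<in> E)) \<ge> i * \<delta> ^ 5 * (card V)\<^sup>2)"
    if V: "finite V" for V :: "'v set" and E i
  proof (induction i)
    case 0
    have "energy (V \<times> V) (pair_sig {}) (\<lambda>p. of_bool (p \<in> E)) \<ge> 0"
      by (simp add: energy_def sum_nonneg)
    then show ?case by (intro disjI2 exI[of _ "{}"]) (simp add: g_def)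
  next
    case (Suc i)
    have mono: "n \<le> g i \<Longrightarrow> n + 2 * 4 ^ n \<le> g (Suc i)" for n
      using power_increasing[of n "g i" "4 :: nat"] unfolding g_def funpow.simps comp_def
        by linarith
    have le: "n \<le> g i \<Longrightarrow> n \<le> g (Suc i)" for n using mono[of n] by simp
    show ?case
    proof (cases "\<exists>\<S>. finite \<S> \<and> card \<S> \<le> g i \<and> card (irregular \<delta> V E \<S>) \<le> \<delta> * (card V)\<^sup>2")
      case True
      then show ?thesis using le by blast
    next
      case False
      then obtain \<S> where S: "finite \<S>" "card \<S> \<le> g i"
        "energy (V \<times> V) (pair_sig \<S>) (\<lambda>p. of_bool (p \<in> E)) \<ge> i * \<delta> ^ 5 * (card V)\<^sup>2"
        using Suc by blast
      moreover from this False have "card (irregular \<delta> V E \<S>) > \<delta> * (card V)\<^sup>2"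
        by (meson not_le)
      ultimately obtain \<S>' where "finite \<S>'" "card \<S>' \<le> card \<S> + 2 * 4 ^ card \<S>"
        "energy (V \<times> V) (pair_sig \<S>') (\<lambda>p. of_bool (p \<in> E))
          \<ge> energy (V \<times> V) (pair_sig \<S>) (\<lambda>p. of_bool (p \<in> E)) + \<delta> ^ 5 * (card V)\<^sup>2"
        using energy_increment[OF V _ d] by blast
      moreover from this S have "card \<S>' \<le> g (Suc i)" using mono[of "card \<S>"] by linarith
      ultimately show ?thesis using S(3)
        by (intro disjI2 exI[of _ \<S>']) (auto simp: algebra_simps)
    qed
  qed
  obtain i :: nat where i: "i * \<delta> ^ 5 > 1" using reals_Archimedean3[of "\<delta> ^ 5"] d by fastforce
  show ?thesis
  proof (rule that[of "g i"])
    fix V :: "'v set" and E assume V: "finite V"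
    show "\<exists>\<S>. finite \<S> \<and> card \<S> \<le> g i \<and> card (irregular \<delta> V E \<S>) \<le> \<delta> * (card V)\<^sup>2"
    proof (cases "V = {}")
      case True
      then show ?thesis by (intro exI[of _ "{}"]) (simp add: irregular_def)
    next
      case False
      have "energy (V \<times> V) (pair_sig \<S>) (\<lambda>p. of_bool (p \<in> E)) < i * \<delta> ^ 5 * (card V)\<^sup>2" for \<S>
      proof -
        have "energy (V \<times> V) (pair_sig \<S>) (\<lambda>p. of_bool (p \<in> E)) \<le> card (V \<times> V)"
          using V by (intro energy_le_card) auto
        also have "\<dots> = real ((card V)\<^sup>2)" by (simp add: card_cartesian_product power2_eq_square)
        also have "\<dots> < i * \<delta> ^ 5 * (card V)\<^sup>2"
          using mult_strict_right_mono[OF i, of "real ((card V)\<^sup>2)"] False V by simp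
        finally show ?thesis .
      qed
      then show ?thesis using step[OF V, of i E] by (meson not_le)
    qed
  qed
qed

section \<open>Linear families of cliques\<close>

definition dense_pair :: "real \<Rightarrow> real \<Rightarrow> ('v \<times> 'v) set \<Rightarrow> 'v set \<Rightarrow> 'v set \<Rightarrow> bool" where
  "dense_pair \<delta> \<rho> E A B \<longleftrightarrow> (\<forall>X Y. X \<subseteq> A \<longrightarrow> Y \<subseteq> B \<longrightarrow> \<delta> * real (card A) \<le> card X \<longrightarrow>
     \<delta> * real (card B) \<le> card Y \<longrightarrow> \<rho> * (real (card X) * real (card Y)) \<le> card (E \<inter> X \<times> Y))"

lemma regular_pair_imp_dense_pair:
  fixes \<delta> \<rho> :: real
  assumes "regular_pair \<delta> E A B" "\<rho> + \<delta> \<le> density E A B"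
  shows "dense_pair \<delta> \<rho> E A B"
  unfolding dense_pair_def
proof (intro allI impI)
  fix X Y assume "X \<subseteq> A" "Y \<subseteq> B" "\<delta> * real (card A) \<le> card X" "\<delta> * real (card B) \<le> card Y"
  then have "\<bar>card (E \<inter> X \<times> Y) - density E A B * (card X * card Y)\<bar> \<le> \<delta> * (card X * card Y)"
    using assms(1) unfolding regular_pair_def by blast
  moreover have "(\<rho> + \<delta>) * (card X * card Y) \<le> density E A B * (card X * card Y)"
    using assms(2) by (intro mult_right_mono) auto
  ultimately show "\<rho> * (real (card X) * real (card Y)) \<le> card (E \<inter> X \<times> Y)"
    by (simp add: algebra_simps)
qed

text \<open>Otherwise the set \<open>X\<close> of low-degree vertices would be large enough for the
  density bound to apply to \<open>X\<close> and \<open>C'\<close>, and summing the degrees over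
  \<open>X\<close> contradicts it.\<close>

lemma few_low_degree_vertices:
  fixes \<delta> \<rho> :: real
  assumes dense: "dense_pair \<delta> \<rho> E A B" and fin: "finite A" "finite B"
    and C: "C \<subseteq> A" "C' \<subseteq> B" "\<delta> * card B \<le> card C'" and pos: "0 < \<delta>" "A \<noteq> {}"
  shows "card {x \<in> C. card (C' \<inter> E `` {x}) < \<rho> * card C'} < \<delta> * card A"
proof (rule ccontr)
  define X where "X = {x \<in> C. card (C' \<inter> E `` {x}) < \<rho> * card C'}"
  assume "\<not> card {x \<in> C. card (C' \<inter> E `` {x}) < \<rho> * card C'} < \<delta> * card A"
  then have X: "\<delta> * card A \<le> card X" by (simp add: X_def)
  moreover have "0 < \<delta> * card A" using pos fin by (simp add: card_gt_0_iff)
  ultimately have "card X > 0" by linarith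
  then have ne: "X \<noteq> {}" "finite X" by (auto simp: card_gt_0_iff)
  have finC': "finite C'" using C fin finite_subset by blast
  have "E \<inter> X \<times> C' = Sigma X (\<lambda>x. C' \<inter> E `` {x})" by auto
  then have "real (card (E \<inter> X \<times> C')) = (\<Sum>x\<in>X. real (card (C' \<inter> E `` {x})))"
    using ne finC' by simp
  also have "\<dots> < (\<Sum>x\<in>X. \<rho> * card C')"
    using ne by (intro sum_strict_mono) (auto simp: X_def)
  also have "\<dots> = \<rho> * (real (card X) * real (card C'))" by simp
  also have "\<dots> \<le> card (E \<inter> X \<times> C')"
  proof (rule dense[unfolded dense_pair_def, rule_format])
    show "X \<subseteq> A" using C(1) by (auto simp: X_def)
  qed (use X C in simp_all)
  finally show False by simp
qed

text \<open>The classes in \<open>I\<close> are filled one at a time. Once x is chosen, every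
  remaining candidate set is cut down to the neighbourhood of x and keeps a fraction \<rho>; \<beta>
  records the share of each class still available. The class \<open>j\<close> is reserved, its
  candidates are only counted. \<open>E\<close> is not assumed symmetric, so adjacency is known only
  in the order of choice, whence the disjunction.\<close>

lemma greedy_embedding:
  fixes A C :: "'i \<Rightarrow> 'v set" and \<beta> \<delta> \<rho> :: real
  assumes "finite I" "j \<notin> I"
    and "\<And>i. i \<in> insert j I \<Longrightarrow> finite (A i) \<and> A i \<noteq> {} \<and> C i \<subseteq> A i \<and> \<beta> * card (A i) \<le> card (C i)"
    and "\<And>i i'. i \<in> insert j I \<Longrightarrow> i' \<in> insert j I \<Longrightarrow> i \<noteq> i' \<Longrightarrow> dense_pair \<delta> \<rho> E (A i) (A i')"
    and "0 < \<delta>" "0 < \<rho>" "\<rho> \<le> 1" "0 < \<beta>" "(card I + 1) * \<delta> \<le> \<beta> * \<rho> ^ card I"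
  shows "\<exists>f. (\<forall>i\<in>I. f i \<in> C i) \<and> (\<forall>i\<in>I. \<forall>i'\<in>I. i \<noteq> i' \<longrightarrow> (f i, f i') \<in> E \<or> (f i', f i) \<in> E) \<and>
    \<beta> * \<rho> ^ card I * card (A j) \<le> card {y \<in> C j. \<forall>i\<in>I. (f i, y) \<in> E}"
  using assms
proof (induction I arbitrary: C \<beta> rule: finite_induct)
  case empty
  then show ?case by simp
next
  case (insert i I)
  let ?J = "insert j I" and ?k = "card I"
  let ?Bad = "\<lambda>i'. {x \<in> C i. card (C i' \<inter> E `` {x}) < \<rho> * card (C i')}"
  have k: "card (insert i I) = Suc ?k" using insert.hyps by simp
  have A: "finite (A i')" "A i' \<noteq> {}" "C i' \<subseteq> A i'" "\<beta> * card (A i') \<le> card (C i')"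
    if "i' \<in> insert i ?J" for i' using insert.prems(2)[of i'] that by auto
  have ineq: "real (?k + 2) * \<delta> \<le> \<beta> * \<rho> ^ Suc ?k" using insert.prems(8) unfolding k by simp
  have "\<rho> ^ Suc ?k \<le> 1" using insert.prems(5,6) by (intro power_le_one) auto
  then have "\<beta> * \<rho> ^ Suc ?k \<le> \<beta>" using insert.prems(7) by simp
  with ineq have le\<beta>: "real (?k + 2) * \<delta> \<le> \<beta>" by linarith
  have "\<delta> \<le> \<beta>"
    using le\<beta> insert.prems(4) mult_right_mono[of 1 "real (?k + 2)" \<delta>] by linarith
  have bad: "card (?Bad i') \<le> \<delta> * card (A i)" if "i' \<in> ?J" for i'
  proof -
    have "i \<noteq> i'" using that insert.hyps insert.prems(1) by auto
    moreover have "\<delta> * card (A i') \<le> card (C i')"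
      using A(4)[of i'] \<open>\<delta> \<le> \<beta>\<close> that mult_right_mono[of \<delta> \<beta> "card (A i')"] by auto
    ultimately show ?thesis
      using that A[of i] A[of i'] insert.prems(3)[of i i'] insert.prems(4)
      by (intro less_imp_le[OF few_low_degree_vertices[where B = "A i'"]]) auto
  qed
  have cA: "0 < real (card (A i))" using A[of i] by (simp add: card_gt_0_iff)
  \<comment> \<open>Each of the \<open>?k + 1\<close> other classes excludes at most a fraction
    \<delta> of \<open>A i\<close>; together this is less than the share \<beta> of
    \<open>A i\<close> that the candidates occupy.\<close>
  have "card (\<Union>i'\<in>?J. ?Bad i') \<le> (\<Sum>i'\<in>?J. card (?Bad i'))"
    using insert.hyps by (intro card_UN_le) auto
  then have "real (card (\<Union>i'\<in>?J. ?Bad i')) \<le> (\<Sum>i'\<in>?J. real (card (?Bad i')))"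
    unfolding of_nat_sum[symmetric] of_nat_le_iff .
  also have "\<dots> \<le> (\<Sum>i'\<in>?J. \<delta> * card (A i))" using bad by (rule sum_mono)
  also have "\<dots> = real (?k + 1) * \<delta> * card (A i)" using insert.hyps insert.prems(1) by simp
  also have "\<dots> < real (?k + 2) * \<delta> * card (A i)"
    using cA insert.prems(4) by (intro mult_strict_right_mono) auto
  also have "\<dots> \<le> \<beta> * card (A i)" using le\<beta> by (intro mult_right_mono) auto
  also have "\<dots> \<le> card (C i)" using A(4)[of i] by simp
  finally have "card (\<Union>i'\<in>?J. ?Bad i') < card (C i)" by simp
  moreover have "finite (\<Union>i'\<in>?J. ?Bad i')"
    using insert.hyps A[of i] by (auto intro: finite_subset)
  ultimately have "\<not> C i \<subseteq> (\<Union>i'\<in>?J. ?Bad i')" using card_mono not_less by blast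
  then obtain x where x: "x \<in> C i" "\<And>i'. i' \<in> ?J \<Longrightarrow> \<rho> * card (C i') \<le> card (C i' \<inter> E `` {x})"
    by (force simp: not_less)
  define C' where "C' i' = C i' \<inter> E `` {x}" for i'
  have "\<exists>f. (\<forall>i\<in>I. f i \<in> C' i) \<and> (\<forall>i\<in>I. \<forall>i'\<in>I. i \<noteq> i' \<longrightarrow> (f i, f i') \<in> E \<or> (f i', f i) \<in> E) \<and>
    (\<beta> * \<rho>) * \<rho> ^ card I * card (A j) \<le> card {y \<in> C' j. \<forall>i\<in>I. (f i, y) \<in> E}"
  proof (rule insert.IH)
    fix i' assume i': "i' \<in> ?J"
    have "\<beta> * \<rho> * card (A i') \<le> \<rho> * card (C i')"
      using A(4)[of i'] i' insert.prems(5) mult_left_mono[of "\<beta> * card (A i')" "card (C i')" \<rho>]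
      by (simp add: mult.commute mult.left_commute)
    also have "\<dots> \<le> card (C' i')" using x(2)[OF i'] by (simp add: C'_def)
    finally show "finite (A i') \<and> A i' \<noteq> {} \<and> C' i' \<subseteq> A i' \<and> \<beta> * \<rho> * card (A i') \<le> card (C' i')"
      using A[of i'] i' by (auto simp: C'_def)
  next
    have "real (?k + 1) * \<delta> \<le> real (?k + 2) * \<delta>"
      using insert.prems(4) by (intro mult_right_mono) auto
    then show "(card I + 1) * \<delta> \<le> (\<beta> * \<rho>) * \<rho> ^ card I" using ineq by (simp add: mult.assoc)
  qed (use insert.prems in auto)
  then obtain f where f: "\<And>i. i \<in> I \<Longrightarrow> f i \<in> C' i"
    "\<And>i i'. i \<in> I \<Longrightarrow> i' \<in> I \<Longrightarrow> i \<noteq> i' \<Longrightarrow> (f i, f i') \<in> E \<or> (f i', f i) \<in> E"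
    "(\<beta> * \<rho>) * \<rho> ^ card I * card (A j) \<le> card {y \<in> C' j. \<forall>i\<in>I. (f i, y) \<in> E}" by blast
  let ?f = "f(i := x)"
  have eq: "{y \<in> C j. \<forall>i'\<in>insert i I. (?f i', y) \<in> E} = {y \<in> C' j. \<forall>i\<in>I. (f i, y) \<in> E}"
    using insert.hyps by (auto simp: C'_def split: if_splits)
  have "\<beta> * \<rho> ^ card (insert i I) * card (A j) \<le> card {y \<in> C j. \<forall>i'\<in>insert i I. (?f i', y) \<in> E}"
    using f(3) unfolding eq k by (simp add: mult.assoc)
  moreover have "\<forall>i'\<in>insert i I. ?f i' \<in> C i'" using f(1) x(1) by (auto simp: C'_def)
  moreover have "\<forall>a\<in>insert i I. \<forall>b\<in>insert i I. a \<noteq> b \<longrightarrow> (?f a, ?f b) \<in> E \<or> (?f b, ?f a) \<in> E"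
    using f(1,2) insert.hyps by (auto simp: C'_def)
  ultimately show ?case by blast
qed

text \<open>The vertex pairs between cells of low density form a union of classes, so the edges
  among them number exactly the sum of their cell densities, each of which is below \<rho>.\<close>

lemma card_edges_low_density:
  fixes \<rho> :: real
  assumes V: "finite V" "E \<subseteq> V \<times> V" and \<rho>: "0 \<le> \<rho>"
  shows "card {p \<in> E. density E (cell V \<S> (fst p)) (cell V \<S> (snd p)) < \<rho>} \<le> \<rho> * (card V)\<^sup>2"
proof -
  let ?f = "\<lambda>p. of_bool (p \<in> E) :: real" and ?dn = "\<lambda>p. density E (cell V \<S> (fst p)) (cell V \<S> (snd p))"
  define D where "D = {p \<in> V \<times> V. ?dn p < \<rho>}"
  have D: "finite D" "D \<subseteq> V \<times> V" using V by (auto simp: D_def)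
  have "{p \<in> E. ?dn p < \<rho>} = E \<inter> D" using V by (auto simp: D_def)
  then have "real (card {p \<in> E. ?dn p < \<rho>}) = (\<Sum>p\<in>D. ?f p)"
    by (simp only: sum_of_bool_card[OF D(1)])
  also have "\<dots> = (\<Sum>p\<in>D. cond_avg (V \<times> V) (pair_sig \<S>) ?f p)"
  proof (rule sum_cond_avg_saturated[symmetric])
    fix p q assume "p \<in> D" "q \<in> V \<times> V" "pair_sig \<S> p = pair_sig \<S> q"
    moreover from this(3) have "cell V \<S> (fst p) = cell V \<S> (fst q)" "cell V \<S> (snd p) = cell V \<S> (snd q)"
      by (cases p; cases q; auto intro!: cell_cong)+
    ultimately show "q \<in> D" unfolding D_def by simp
  qed (use V D in auto)
  also have "\<dots> = (\<Sum>p\<in>D. ?dn p)"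
    using cond_avg_density[OF V(1)] by (intro sum.cong) (auto simp: D_def)
  also have "\<dots> \<le> (\<Sum>p\<in>D. \<rho>)" by (intro sum_mono) (simp add: D_def)
  also have "\<dots> = \<rho> * card D" by simp
  also have "\<dots> \<le> \<rho> * card (V \<times> V)"
    using card_mono[OF _ D(2)] V \<rho> by (intro mult_left_mono) (simp_all only: of_nat_le_iff, simp)
  finally show ?thesis by (simp add: card_cartesian_product power2_eq_square)
qed

text \<open>At most \<open>2 ^ card \<S>\<close> signatures occur, and the vertices counted under
  one signature lie in a single cell with fewer than \<open>b\<close> vertices.\<close>

lemma card_small_cells:
  fixes b :: real
  assumes V: "finite V" and S: "finite \<S>" and b: "0 \<le> b"
  shows "card {x \<in> V. card (cell V \<S> x) < b} \<le> 2 ^ card \<S> * b"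
proof -
  let ?Z = "{x \<in> V. card (cell V \<S> x) < b}"
  have fin: "finite ?Z" using V by simp
  have "card (sig \<S> ` ?Z) \<le> card (Pow \<S>)"
    using S by (intro card_mono) (auto simp: sig_def)
  then have "card (sig \<S> ` ?Z) \<le> 2 ^ card \<S>" using S by (simp only: card_Pow)
  then have c: "real (card (sig \<S> ` ?Z)) \<le> 2 ^ card \<S>"
    using of_nat_mono[of "card (sig \<S> ` ?Z)" "2 ^ card \<S>", where 'a = real] by (simp only: of_nat_power of_nat_numeral)
  have "card ?Z = (\<Sum>k\<in>sig \<S> ` ?Z. card {x \<in> ?Z. sig \<S> x = k})"
    using sum.image_gen[OF fin, of "\<lambda>_. 1 :: nat" "sig \<S>"] unfolding card_eq_sum .
  then have "real (card ?Z) = (\<Sum>k\<in>sig \<S> ` ?Z. real (card {x \<in> ?Z. sig \<S> x = k}))"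
    by (simp only: of_nat_sum)
  also have "\<dots> \<le> (\<Sum>k\<in>sig \<S> ` ?Z. b)"
  proof (rule sum_mono)
    fix k assume "k \<in> sig \<S> ` ?Z"
    then obtain x where x: "x \<in> ?Z" "k = sig \<S> x" by blast
    have "card {y \<in> ?Z. sig \<S> y = k} \<le> card (cell V \<S> x)"
      using V by (intro card_mono) (auto simp: cell_def x(2))
    then show "real (card {y \<in> ?Z. sig \<S> y = k}) \<le> b" using x(1) by simp
  qed
  also have "\<dots> = card (sig \<S> ` ?Z) * b" by simp
  also have "\<dots> \<le> 2 ^ card \<S> * b" using c b by (intro mult_right_mono) auto
  finally show ?thesis .
qed

section \<open>Near-cliques forced by a linear family of cliques\<close>

definition is_clique :: "('v \<times> 'v) set \<Rightarrow> 'v set \<Rightarrow> bool" where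
  "is_clique E K \<longleftrightarrow> (\<forall>x\<in>K. \<forall>y\<in>K. x \<noteq> y \<longrightarrow> (x, y) \<in> E)"

text \<open>Each pair in \<open>B\<close> lies in at most one member of \<open>T\<close>.\<close>

lemma linear_family_avoids:
  assumes T: "\<And>t t'. t \<in> T \<Longrightarrow> t' \<in> T \<Longrightarrow> t \<noteq> t' \<Longrightarrow> card (t \<inter> t') \<le> 1"
    and fin: "\<And>t. t \<in> T \<Longrightarrow> finite t" and B: "finite B" "card B < card T"
  shows "\<exists>t\<in>T. \<forall>x\<in>t. \<forall>y\<in>t. x \<noteq> y \<longrightarrow> (x, y) \<notin> B"
proof (rule ccontr)
  assume "\<not> ?thesis"
  then have "\<forall>t\<in>T. \<exists>p. fst p \<in> t \<and> snd p \<in> t \<and> fst p \<noteq> snd p \<and> p \<in> B"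
    by (metis fst_conv snd_conv)
  then obtain h where h: "\<And>t. t \<in> T \<Longrightarrow> fst (h t) \<in> t \<and> snd (h t) \<in> t \<and> fst (h t) \<noteq> snd (h t) \<and> h t \<in> B"
    by metis
  have "inj_on h T"
  proof (rule inj_onI, rule ccontr)
    fix t t' assume t: "t \<in> T" "t' \<in> T" "h t = h t'" "t \<noteq> t'"
    have "card {fst (h t), snd (h t)} \<le> card (t \<inter> t')"
      using h[OF t(1)] h[OF t(2)] t(3) fin[OF t(1)] by (intro card_mono) auto
    then show False using h[OF t(1)] T[OF t(1,2,4)] by simp
  qed
  moreover have "h ` T \<subseteq> B" using h by blast
  ultimately show False using B card_inj_on_le[of h T B] by simp
qed

text \<open>\<open>n\<close> only bounds \<open>card V\<close> from above, because there may be
  fewer supervertices than original vertices. A vertex pair is bad if it is irregular, is an edge of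
  low density, or has an end in a small cell. Some \<open>t\<close> in \<open>T\<close> avoids all
  bad pairs. Embedding \<open>t - {j}\<close> greedily into its cells leaves at least two candidates
  in the cell of \<open>j\<close>, and each of them completes a clique.\<close>

theorem cliques_sharing_all_but_one_vertex:
  fixes \<epsilon> :: real and m :: nat
  assumes "0 < \<epsilon>" and m: "2 \<le> m"
  obtains n\<^sub>0 where "\<And>n V E T. n \<ge> n\<^sub>0 \<Longrightarrow> finite (V :: 'v set) \<Longrightarrow> card V \<le> n \<Longrightarrow> E \<subseteq> V \<times> V \<Longrightarrow>
     sym E \<Longrightarrow> irrefl E \<Longrightarrow> (\<And>t. t \<in> T \<Longrightarrow> t \<subseteq> V \<and> card t = m \<and> is_clique E t) \<Longrightarrow>
     (\<And>t t'. t \<in> T \<Longrightarrow> t' \<in> T \<Longrightarrow> t \<noteq> t' \<Longrightarrow> card (t \<inter> t') \<le> 1) \<Longrightarrow> \<epsilon> * real n ^ 2 < card T \<Longrightarrow>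
     \<exists>K y y'. y \<noteq> y' \<and> y \<notin> K \<and> y' \<notin> K \<and> card K = m - 1 \<and> K \<union> {y, y'} \<subseteq> V \<and>
       is_clique E (insert y K) \<and> is_clique E (insert y' K)"
proof -
  \<comment> \<open>Bad pairs come in four sets of at most \<open>\<eta> * n ^ 2\<close> pairs each.
    The choice \<open>2 * \<rho> = \<eta>\<close> leaves room for
    \<open>\<rho> + \<delta> \<le> \<eta>\<close>, and \<open>m * \<delta> = \<rho> ^ m\<close>
    meets the requirement of \<open>greedy_embedding\<close> with m - 1 filled classes.\<close>
  define \<eta> where "\<eta> = min \<epsilon> 1 / 8"
  define \<rho> where "\<rho> = \<eta> / 2"
  define \<delta> where "\<delta> = \<rho> ^ m / m"
  have \<eta>: "0 < \<eta>" "\<eta> \<le> 1 / 8" "8 * \<eta> \<le> \<epsilon>" using assms by (auto simp: \<eta>_def)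
  have \<rho>: "0 < \<rho>" "\<rho> \<le> 1" "2 * \<rho> = \<eta>" using \<eta> by (auto simp: \<rho>_def)
  have m\<delta>: "m * \<delta> = \<rho> ^ m" using m by (simp add: \<delta>_def)
  have \<delta>0: "0 < \<delta>" using \<rho> m by (simp add: \<delta>_def)
  have "\<rho> ^ m \<le> \<rho> ^ 1" using \<rho> m by (intro power_decreasing) auto
  moreover have "1 * \<delta> \<le> m * \<delta>" using m \<delta>0 by (intro mult_right_mono) auto
  ultimately have \<delta>: "0 < \<delta>" "\<delta> \<le> \<rho>" using \<delta>0 m\<delta> by auto
  obtain k where k: "\<And>(V :: 'v set) E. finite V \<Longrightarrow>
    \<exists>\<S>. finite \<S> \<and> card \<S> \<le> k \<and> card (irregular \<delta> V E \<S>) \<le> \<delta> * (card V)\<^sup>2"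
    using regularity_lemma[OF \<delta>(1)] by blast
  \<comment> \<open>\<open>c * n\<close> bounds from below the number of candidates left in a cell
    of at least \<open>\<eta> * n / 2 ^ k\<close> vertices; more than one is needed.\<close>
  define c where "c = \<rho> ^ (m - 1) * (\<eta> / 2 ^ k)"
  have c: "0 < c" using \<rho> \<eta> by (simp add: c_def)
  obtain n0 :: nat where n0: "1 < real n0 * c" using reals_Archimedean3[OF c] by blast
  show ?thesis
  proof (rule that[of n0])
    fix n :: nat and V :: "'v set" and E T
    assume n: "n \<ge> n0" and V: "finite V" "card V \<le> n" and E: "E \<subseteq> V \<times> V" "sym E" "irrefl E"
      and T: "\<And>t. t \<in> T \<Longrightarrow> t \<subseteq> V \<and> card t = m \<and> is_clique E t"
      and T1: "\<And>t t'. t \<in> T \<Longrightarrow> t' \<in> T \<Longrightarrow> t \<noteq> t' \<Longrightarrow> card (t \<inter> t') \<le> 1"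
      and large: "\<epsilon> * real n ^ 2 < card T"
    obtain \<S> where S: "finite \<S>" "card \<S> \<le> k" "card (irregular \<delta> V E \<S>) \<le> \<delta> * (card V)\<^sup>2"
      using k[OF V(1)] by blast
    have n1: "n \<ge> 1" using n n0 by (cases n) auto
    have Vn: "real ((card V)\<^sup>2) \<le> real n ^ 2" using V(2) by (simp add: power_mono)
    define b where "b = \<eta> * n / 2 ^ k"
    have b: "0 \<le> b" using \<eta> by (simp add: b_def)
    let ?low = "{p \<in> E. density E (cell V \<S> (fst p)) (cell V \<S> (snd p)) < \<eta>}"
    let ?Z = "{x \<in> V. card (cell V \<S> x) < b}"
    define B where "B = irregular \<delta> V E \<S> \<union> (?low \<union> (?Z \<times> V \<union> V \<times> ?Z))"
    have finB: "finite B"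
      by (rule finite_subset[of _ "V \<times> V"]) (use V E in \<open>auto simp: B_def irregular_def\<close>)
    have "real (card (irregular \<delta> V E \<S>)) \<le> \<eta> * real n ^ 2"
    proof -
      have "\<delta> * real ((card V)\<^sup>2) \<le> \<eta> * real n ^ 2"
        using \<delta> \<rho> Vn by (intro mult_mono) auto
      then show ?thesis using S(3) by linarith
    qed
    moreover have "real (card ?low) \<le> \<eta> * real n ^ 2"
    proof -
      have "\<eta> * real ((card V)\<^sup>2) \<le> \<eta> * real n ^ 2"
        using \<eta> Vn by (intro mult_left_mono) auto
      then show ?thesis using card_edges_low_density[OF V(1) E(1), of \<eta> \<S>] \<eta> by linarith
    qed
    moreover have Z: "real (card (?Z \<times> V)) \<le> \<eta> * real n ^ 2"
    proof -
      have "2 ^ card \<S> \<le> (2 ^ k :: real)" using S(2) by (intro power_increasing) auto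
      then have "2 ^ card \<S> * b \<le> 2 ^ k * b" using b by (intro mult_right_mono)
      then have "card ?Z \<le> \<eta> * n"
        using card_small_cells[OF V(1) S(1) b] by (simp add: b_def)
      then have "real (card ?Z) * real (card V) \<le> (\<eta> * n) * n"
        using V \<eta> by (intro mult_mono) auto
      then show ?thesis by (simp add: card_cartesian_product power2_eq_square mult.assoc)
    qed
    moreover have "card (V \<times> ?Z) = card (?Z \<times> V)" by (simp add: card_cartesian_product mult.commute)
    moreover have "card B \<le> card (irregular \<delta> V E \<S>) + (card ?low + (card (?Z \<times> V) + card (V \<times> ?Z)))"
      unfolding B_def by (meson card_Un_le add_left_mono order_trans)
    ultimately have "real (card B) \<le> 4 * \<eta> * real n ^ 2" by linarith
    also have "\<dots> \<le> \<epsilon> * real n ^ 2" using \<eta> by (intro mult_right_mono) auto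
    finally have "card B < card T" using large by linarith
    have finT: "finite t" if "t \<in> T" for t using T[OF that] V(1) by (auto intro: finite_subset)
    obtain t where t: "t \<in> T" and good: "\<And>x y. x \<in> t \<Longrightarrow> y \<in> t \<Longrightarrow> x \<noteq> y \<Longrightarrow> (x, y) \<notin> B"
      using linear_family_avoids[OF T1 finT finB \<open>card B < card T\<close>] by blast
    have tV: "t \<subseteq> V" "card t = m" "is_clique E t" "finite t"
      using T[OF t] finT[OF t] by auto
    have "t \<noteq> {}" using tV(2) m by auto
    then obtain j where j: "j \<in> t" by blast
    define I where "I = t - {j}"
    have I: "finite I" "j \<notin> I" "insert j I = t" "card I = m - 1" using tV j by (auto simp: I_def)
    have "I \<noteq> {}" using I(4) m by auto
    then obtain i where i: "i \<in> I" by blast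
    have dense: "dense_pair \<delta> \<rho> E (cell V \<S> x) (cell V \<S> y)" if "x \<in> t" "y \<in> t" "x \<noteq> y" for x y
    proof (rule regular_pair_imp_dense_pair)
      have xy: "x \<in> V" "y \<in> V" "(x, y) \<in> E" using that tV by (auto simp: is_clique_def)
      then show "regular_pair \<delta> E (cell V \<S> x) (cell V \<S> y)"
        using good[OF that] by (auto simp: B_def irregular_def)
      show "\<rho> + \<delta> \<le> density E (cell V \<S> x) (cell V \<S> y)"
        using good[OF that] xy \<rho> \<delta> by (auto simp: B_def)
    qed
    have "\<exists>f. (\<forall>i\<in>I. f i \<in> cell V \<S> i) \<and>
      (\<forall>i\<in>I. \<forall>i'\<in>I. i \<noteq> i' \<longrightarrow> (f i, f i') \<in> E \<or> (f i', f i) \<in> E) \<and>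
      1 * \<rho> ^ card I * card (cell V \<S> j) \<le> card {y \<in> cell V \<S> j. \<forall>i\<in>I. (f i, y) \<in> E}"
    proof (rule greedy_embedding[where A = "cell V \<S>" and \<delta> = \<delta>])
      show "finite (cell V \<S> i) \<and> cell V \<S> i \<noteq> {} \<and> cell V \<S> i \<subseteq> cell V \<S> i \<and>
          1 * real (card (cell V \<S> i)) \<le> card (cell V \<S> i)" if "i \<in> insert j I" for i
        using that tV(1) I(3) finite_cell[OF V(1)] by (auto simp: cell_def)
      show "real (card I + 1) * \<delta> \<le> 1 * \<rho> ^ card I"
      proof -
        have "\<rho> ^ m \<le> \<rho> ^ (m - 1)" using \<rho> by (intro power_decreasing) auto
        then show ?thesis using m\<delta> m I(4) by simp
      qed
    qed (use dense I \<delta> \<rho> in auto)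
    then obtain f where f: "\<And>i. i \<in> I \<Longrightarrow> f i \<in> cell V \<S> i"
      "\<And>i i'. i \<in> I \<Longrightarrow> i' \<in> I \<Longrightarrow> i \<noteq> i' \<Longrightarrow> (f i, f i') \<in> E \<or> (f i', f i) \<in> E"
      "\<rho> ^ (m - 1) * card (cell V \<S> j) \<le> card {y \<in> cell V \<S> j. \<forall>i\<in>I. (f i, y) \<in> E}"
      unfolding I(4) mult_1 by blast
    let ?Y = "{y \<in> cell V \<S> j. \<forall>i\<in>I. (f i, y) \<in> E}"
    have fE: "(f i, f i') \<in> E" if "i \<in> I" "i' \<in> I" "i \<noteq> i'" for i i'
      using f(2)[OF that] E(2) by (auto dest: symD)
    \<comment> \<open>The second vertex \<open>i\<close>, present because \<open>2 \<le> m\<close>,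
      serves to certify that the cell of \<open>j\<close> is not small.\<close>
    have "i \<in> t" "i \<noteq> j" using i I(2,3) by auto
    then have "(i, j) \<notin> B" using good j by blast
    then have "b \<le> card (cell V \<S> j)" using tV(1) \<open>i \<in> t\<close> j by (auto simp: B_def)
    then have "\<rho> ^ (m - 1) * b \<le> \<rho> ^ (m - 1) * card (cell V \<S> j)"
      using \<rho> by (intro mult_left_mono) auto
    moreover have "\<rho> ^ (m - 1) * b = n * c" by (simp add: b_def c_def)
    moreover have "n0 * c \<le> n * c" using n c by (intro mult_right_mono) auto
    ultimately have "1 < real (card ?Y)" using f(3) n0 by linarith
    then have "\<not> card ?Y \<le> Suc 0" by simp
    moreover have "finite ?Y" using finite_cell[OF V(1)] by auto
    ultimately obtain y y' where y: "y \<in> ?Y" "y' \<in> ?Y" "y \<noteq> y'"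
      by (metis (no_types, lifting) card_le_Suc0_iff_eq)
    \<comment> \<open>Vertices of \<open>t\<close> may share a cell, so injectivity is drawn from
      adjacency and irreflexivity.\<close>
    have inj: "inj_on f I"
    proof (rule inj_onI, rule ccontr)
      fix i i' assume "i \<in> I" "i' \<in> I" "f i = f i'" "i \<noteq> i'"
      then show False using fE[of i i'] E(3) by (auto simp: irrefl_def)
    qed
    have nin: "z \<notin> f ` I" if "z \<in> ?Y" for z
      using that E(3) by (auto simp: irrefl_def)
    have cl: "is_clique E (insert z (f ` I))" if "z \<in> ?Y" for z
      using that fE E(2) by (auto simp: is_clique_def dest: symD)
    have "f ` I \<union> {y, y'} \<subseteq> V" using f(1) y by (auto simp: cell_def)
    moreover have "card (f ` I) = m - 1" using card_image[OF inj] I(4) by simp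
    ultimately show "\<exists>K y y'. y \<noteq> y' \<and> y \<notin> K \<and> y' \<notin> K \<and> card K = m - 1 \<and> K \<union> {y, y'} \<subseteq> V \<and>
       is_clique E (insert y K) \<and> is_clique E (insert y' K)"
      using y nin cl by (intro exI[of _ "f ` I"] exI[of _ y] exI[of _ y']) simp
  qed
qed

section \<open>Homogeneous families\<close>

definition restr :: "('v \<Rightarrow> 'p) \<Rightarrow> 'p set \<Rightarrow> 'v set \<Rightarrow> 'v set" where
  "restr \<chi> J S = {v \<in> S. \<chi> v \<in> J}"

definition partite :: "('v \<Rightarrow> 'p) \<Rightarrow> 'p set \<Rightarrow> 'v set set \<Rightarrow> bool" where
  "partite \<chi> P \<F> \<longleftrightarrow> (\<forall>S\<in>\<F>. bij_betw \<chi> S P)"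

definition sunflower_kernel :: "nat \<Rightarrow> 'v set set \<Rightarrow> 'v set \<Rightarrow> bool" where
  "sunflower_kernel t \<F> A \<longleftrightarrow> (\<exists>\<T>\<subseteq>\<F>. finite \<T> \<and> t \<le> card \<T> \<and> (\<forall>S\<in>\<T>. A \<subseteq> S) \<and>
     (\<forall>S\<in>\<T>. \<forall>S'\<in>\<T>. S \<noteq> S' \<longrightarrow> S \<inter> S' = A))"

definition avoids_trace :: "('v \<Rightarrow> 'p) \<Rightarrow> 'v set set \<Rightarrow> 'p set \<Rightarrow> bool" where
  "avoids_trace \<chi> \<F> J \<longleftrightarrow> (\<forall>S\<in>\<F>. \<forall>S'\<in>\<F>. S \<noteq> S' \<longrightarrow> \<chi> ` (S \<inter> S') \<noteq> J)"

definition traces :: "('v \<Rightarrow> 'p) \<Rightarrow> 'p set \<Rightarrow> 'v set set \<Rightarrow> 'p set set" where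
  "traces \<chi> P \<F> = {J. J \<subseteq> P \<and> \<not> avoids_trace \<chi> \<F> J}"

lemma restr_subset: "restr \<chi> J S \<subseteq> S"
  by (auto simp: restr_def)

lemma restr_eqI:
  assumes "bij_betw \<chi> S P" "bij_betw \<chi> S' P" "restr \<chi> J S \<subseteq> S'"
  shows "restr \<chi> J S' = restr \<chi> J S"
proof
  show "restr \<chi> J S \<subseteq> restr \<chi> J S'" using assms(3) by (auto simp: restr_def)
  show "restr \<chi> J S' \<subseteq> restr \<chi> J S"
  proof
    fix v assume v: "v \<in> restr \<chi> J S'"
    then have "\<chi> v \<in> \<chi> ` S" using assms by (auto simp: restr_def bij_betw_def)
    then obtain u where u: "u \<in> S" "\<chi> u = \<chi> v" by auto
    then have "u \<in> restr \<chi> J S" using v by (simp add: restr_def)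
    moreover from this have "u = v"
      using assms(2,3) u v by (auto simp: restr_def bij_betw_def dest!: inj_onD)
    ultimately show "v \<in> restr \<chi> J S" by simp
  qed
qed

lemma restr_eq_of_trace:
  assumes "bij_betw \<chi> S P" "bij_betw \<chi> S' P" "J \<subseteq> \<chi> ` (S \<inter> S')"
  shows "restr \<chi> J S = restr \<chi> J S'"
proof (rule restr_eqI[OF assms(2,1)])
  show "restr \<chi> J S' \<subseteq> S"
  proof
    fix v assume v: "v \<in> restr \<chi> J S'"
    then obtain u where "u \<in> S \<inter> S'" "\<chi> u = \<chi> v" using assms(3) by (auto simp: restr_def)
    moreover from this have "u = v"
      using assms(2) v by (auto simp: restr_def bij_betw_def dest!: inj_onD)
    ultimately show "v \<in> S" by simp
  qed
qed

lemma image_restr: "bij_betw \<chi> S P \<Longrightarrow> J \<subseteq> P \<Longrightarrow> \<chi> ` restr \<chi> J S = J"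
  by (fastforce simp: restr_def bij_betw_def)

lemma card_restr:
  assumes "bij_betw \<chi> S P" "J \<subseteq> P"
  shows "card (restr \<chi> J S) = card J"
  using card_image[of \<chi> "restr \<chi> J S"] image_restr[OF assms]
    inj_on_subset[OF bij_betw_imp_inj_on[OF assms(1)] restr_subset] by metis

lemma sunflower_kernel_mono: "sunflower_kernel t \<F> A \<Longrightarrow> \<F> \<subseteq> \<F>' \<Longrightarrow> sunflower_kernel t \<F>' A"
  unfolding sunflower_kernel_def by (meson order_trans)

lemma traces_mono: "\<F> \<subseteq> \<F>' \<Longrightarrow> traces \<chi> P \<F> \<subseteq> traces \<chi> P \<F>'"
  unfolding traces_def avoids_trace_def by blast

lemma card_group_le:
  assumes "finite D" and "\<And>a. a \<in> g ` D \<Longrightarrow> card {x \<in> D. g x = a} \<le> c * card {x \<in> D. g x = a \<and> Q a x}"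
  shows "card D \<le> c * card {x \<in> D. Q (g x) x}"
proof -
  let ?D' = "{x \<in> D. Q (g x) x}"
  have "card D = (\<Sum>a\<in>g ` D. card {x \<in> D. g x = a})"
    using sum.group[of D "g ` D" g "\<lambda>_. 1 :: nat"] assms(1) by simp
  also have "\<dots> \<le> (\<Sum>a\<in>g ` D. c * card {x \<in> ?D'. g x = a})"
  proof (rule sum_mono)
    fix a assume "a \<in> g ` D"
    moreover have "{x \<in> ?D'. g x = a} = {x \<in> D. g x = a \<and> Q a x}" by blast
    ultimately show "card {x \<in> D. g x = a} \<le> c * card {x \<in> ?D'. g x = a}"
      using assms(2) by simp
  qed
  also have "\<dots> = c * card ?D'"
    using sum.group[of ?D' "g ` D" g "\<lambda>_. 1 :: nat"] assms(1)
    by (auto simp flip: sum_distrib_left)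
  finally show ?thesis .
qed

text \<open>A largest sunflower with kernel \<open>A\<close> has fewer than \<open>t\<close> petals.
  By maximality every member of \<open>D\<close> meets the at most \<open>r * t\<close> petal
  vertices outside \<open>A\<close>, so one of these lies in at least a fraction 1/(r t) of
  \<open>D\<close>. Since \<open>J\<close> is a proper subset of \<open>P\<close>, the petals
  themselves reach outside \<open>A\<close>.\<close>

lemma popular_vertex:
  assumes fin: "finite D" "D \<noteq> {}" and P: "card P = r" "finite P"
    and part: "partite \<chi> P D" and J: "J \<subset> P"
    and A: "\<And>S. S \<in> D \<Longrightarrow> restr \<chi> J S = A" and no: "\<not> sunflower_kernel t D A"
  shows "\<exists>u. u \<notin> A \<and> card D \<le> r * t * card {S \<in> D. u \<in> S}"
proof -
  have S: "finite S" "card S = r" "A \<subset> S" if "S \<in> D" for S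
  proof -
    have bij: "bij_betw \<chi> S P" using part that by (simp add: partite_def)
    then show "finite S" "card S = r" using P bij_betw_finite[OF bij] bij_betw_same_card[OF bij] by simp_all
    have "\<chi> ` A = J" "\<chi> ` S = P" using image_restr[OF bij, of J] A[OF that] J bij
      by (auto simp: bij_betw_def)
    then show "A \<subset> S" using restr_subset[of \<chi> J S] A[OF that] J by auto
  qed
  define sun where "sun \<T> \<longleftrightarrow> \<T> \<subseteq> D \<and> (\<forall>S\<in>\<T>. \<forall>S'\<in>\<T>. S \<noteq> S' \<longrightarrow> S \<inter> S' = A)" for \<T>
  have "sun {}" by (simp add: sun_def)
  moreover have "\<forall>\<T>. sun \<T> \<longrightarrow> card \<T> \<le> card D"
    using fin by (auto simp: sun_def intro: card_mono)
  ultimately obtain \<T> where T: "sun \<T>" and max: "\<And>\<T>'. sun \<T>' \<Longrightarrow> card \<T>' \<le> card \<T>"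
    using ex_has_greatest_nat[of sun "{}" card "Suc (card D)"] by (auto simp: less_Suc_eq_le)
  have finT: "finite \<T>" "\<T> \<subseteq> D" using T fin by (auto simp: sun_def intro: finite_subset)
  have "card \<T> < t"
  proof (rule ccontr)
    assume "\<not> card \<T> < t"
    then have "sunflower_kernel t D A"
      unfolding sunflower_kernel_def using T finT S(3)
      by (intro exI[of _ \<T>]) (auto simp: sun_def)
    with no show False by simp
  qed
  define U where "U = \<Union>\<T> - A"
  have "finite (\<Union>\<T>)" using finT S(1) by auto
  then have finU: "finite U" "card U \<le> card (\<Union>\<T>)" by (auto simp: U_def intro: card_mono)
  have "card (\<Union>\<T>) \<le> sum card \<T>" by (rule card_Union_le_sum_card)
  also have "\<dots> = r * card \<T>" using S(2) finT by (simp add: subset_iff)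
  also have "\<dots> \<le> r * t" using \<open>card \<T> < t\<close> by simp
  finally have cU: "card U \<le> r * t" using finU by simp
  have hit: "\<exists>u\<in>U. u \<in> S" if SD: "S \<in> D" for S
  proof (cases "S \<in> \<T>")
    case True
    then show ?thesis using S(3)[OF SD] by (auto simp: U_def)
  next
    case False
    then have "\<not> sun (insert S \<T>)" using max[of "insert S \<T>"] finT by auto
    then obtain S' where "S' \<in> \<T>" "S \<inter> S' \<noteq> A" using T SD by (auto simp: sun_def Int_commute)
    moreover have "A \<subseteq> S \<inter> S'" using S(3) SD calculation finT by blast
    ultimately show ?thesis by (auto simp: U_def)
  qed
  have "\<exists>u\<in>U. card D \<le> r * t * card {S \<in> D. u \<in> S}"
  proof (rule ccontr)
    assume "\<not> ?thesis"
    then have less: "\<And>u. u \<in> U \<Longrightarrow> r * t * card {S \<in> D. u \<in> S} < card D" by auto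
    have "U \<noteq> {}" using fin hit by blast
    have "card D \<le> card (\<Union>u\<in>U. {S \<in> D. u \<in> S})"
      using hit finU fin by (intro card_mono) auto
    also have "\<dots> \<le> (\<Sum>u\<in>U. card {S \<in> D. u \<in> S})" using finU by (intro card_UN_le) auto
    finally have "r * t * card D \<le> (\<Sum>u\<in>U. r * t * card {S \<in> D. u \<in> S})"
      by (simp flip: sum_distrib_left)
    also have "\<dots> < (\<Sum>u\<in>U. card D)" using less finU \<open>U \<noteq> {}\<close> by (intro sum_strict_mono) auto
    also have "\<dots> \<le> r * t * card D" using cU by simp
    finally show False by simp
  qed
  then show ?thesis by (auto simp: U_def)
qed

text \<open>For every restriction \<open>A\<close> a popular vertex \<open>u A\<close> outside
  \<open>A\<close> is fixed, and a member is kept if it contains the vertex belonging to its own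
  restriction. Two kept members with trace \<open>J\<close> have the same restriction, hence share
  \<open>u A\<close>; its colour then lies in \<open>J\<close>, which would put it into
  \<open>A\<close>. For \<open>J = P\<close> nothing is removed, as a trace equal to
  \<open>P\<close> makes two members equal.\<close>

lemma avoid_non_kernel_trace:
  assumes fin: "finite D" and P: "card P = r" "finite P" "1 \<le> r" "1 \<le> t"
    and part: "partite \<chi> P D" and J: "J \<subseteq> P"
    and no: "\<And>S. S \<in> D \<Longrightarrow> \<not> sunflower_kernel t D (restr \<chi> J S)"
  shows "\<exists>D'\<subseteq>D. avoids_trace \<chi> D' J \<and> card D \<le> r * t * card D'"
proof (cases "J = P")
  case True
  have "S = S'" if S: "S \<in> D" "S' \<in> D" "\<chi> ` (S \<inter> S') = P" for S S'
  proof -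
    have "bij_betw \<chi> S P" "bij_betw \<chi> S' P" using S part by (auto simp: partite_def)
    moreover from this have "restr \<chi> P S = S" "restr \<chi> P S' = S'"
      by (auto simp: restr_def bij_betw_def)
    ultimately show ?thesis using restr_eq_of_trace[of \<chi> S P S' P] S(3) by simp
  qed
  then have "avoids_trace \<chi> D J" using True by (auto simp: avoids_trace_def)
  moreover have "1 * 1 \<le> r * t" using P by (intro mult_le_mono)
  then have "card D \<le> r * t * card D" by simp
  ultimately show ?thesis by blast
next
  case False
  have "\<exists>u. u \<notin> A \<and> card {S \<in> D. restr \<chi> J S = A} \<le> r * t * card {S \<in> D. restr \<chi> J S = A \<and> u \<in> S}"
    if A: "A \<in> restr \<chi> J ` D" for A
  proof -
    let ?D = "{S \<in> D. restr \<chi> J S = A}"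
    have "\<exists>u. u \<notin> A \<and> card ?D \<le> r * t * card {S \<in> ?D. u \<in> S}"
    proof (rule popular_vertex[where P = P and \<chi> = \<chi> and J = J])
      show "partite \<chi> P ?D" using part by (simp add: partite_def)
      obtain S where "S \<in> D" "A = restr \<chi> J S" using A by blast
      then have "\<not> sunflower_kernel t D A" using no by blast
      then show "\<not> sunflower_kernel t ?D A" using sunflower_kernel_mono[of t ?D A D] by auto
    qed (use fin A P J False in auto)
    moreover have "{S \<in> ?D. u \<in> S} = {S \<in> D. restr \<chi> J S = A \<and> u \<in> S}" for u by blast
    ultimately show ?thesis by simp
  qed
  then have "\<forall>A\<in>restr \<chi> J ` D. \<exists>u. u \<notin> A \<and>
      card {S \<in> D. restr \<chi> J S = A} \<le> r * t * card {S \<in> D. restr \<chi> J S = A \<and> u \<in> S}"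
    by (rule ballI)
  from bchoice[OF this] obtain u where u: "\<forall>A\<in>restr \<chi> J ` D. u A \<notin> A \<and>
      card {S \<in> D. restr \<chi> J S = A} \<le> r * t * card {S \<in> D. restr \<chi> J S = A \<and> u A \<in> S}" ..
  let ?D' = "{S \<in> D. u (restr \<chi> J S) \<in> S}"
  have "card D \<le> r * t * card ?D'"
    using card_group_le[OF fin, of "restr \<chi> J" "r * t" "\<lambda>A S. u A \<in> S"] u by simp
  moreover have "avoids_trace \<chi> ?D' J"
    unfolding avoids_trace_def
  proof (intro ballI impI notI)
    fix S S' assume S: "S \<in> ?D'" "S' \<in> ?D'" "\<chi> ` (S \<inter> S') = J"
    have "restr \<chi> J S = restr \<chi> J S'"
      using S part by (intro restr_eq_of_trace[where P = P]) (auto simp: partite_def)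
    then have "u (restr \<chi> J S) \<in> S \<inter> S'" using S by auto
    then have "u (restr \<chi> J S) \<in> restr \<chi> J S" using S(3) by (auto simp: restr_def)
    moreover have "u (restr \<chi> J S) \<notin> restr \<chi> J S" using u S(1) by simp
    ultimately show False by simp
  qed
  moreover have "?D' \<subseteq> D" by blast
  ultimately show ?thesis by (intro exI[of _ ?D'] conjI)
qed

text \<open>Members with a non-kernel restriction are deleted one at a time, and each deleted member is put
  into the bucket of an offending \<open>J\<close>. A sunflower inside a bucket would already have been present when
  the first of its petals was deleted.\<close>

lemma bucket_decomposition:
  assumes "finite \<F>" "partite \<chi> P \<F>"
  shows "\<exists>\<F>\<^sub>0 D. \<F>\<^sub>0 \<subseteq> \<F> \<and> (\<forall>J\<in>\<J>. D J \<subseteq> \<F>) \<and> \<F> \<subseteq> \<F>\<^sub>0 \<union> (\<Union>J\<in>\<J>. D J) \<and>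
    (\<forall>S\<in>\<F>\<^sub>0. \<forall>J\<in>\<J>. sunflower_kernel t \<F>\<^sub>0 (restr \<chi> J S)) \<and>
    (\<forall>J\<in>\<J>. \<forall>S\<in>D J. \<not> sunflower_kernel t (D J) (restr \<chi> J S))"
  using assms
proof (induction rule: finite_psubset_induct)
  case (psubset \<F>)
  show ?case
  proof (cases "\<forall>S\<in>\<F>. \<forall>J\<in>\<J>. sunflower_kernel t \<F> (restr \<chi> J S)")
    case True
    then show ?thesis by (intro exI[of _ \<F>] exI[of _ "\<lambda>_. {}"]) simp
  next
    case False
    then obtain S J where S: "S \<in> \<F>" "J \<in> \<J>" "\<not> sunflower_kernel t \<F> (restr \<chi> J S)" by blast
    have "\<F> - {S} \<subset> \<F>" "partite \<chi> P (\<F> - {S})" using S psubset.prems by (auto simp: partite_def)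
    from psubset.IH[OF this] obtain \<F>\<^sub>0 D where IH: "\<F>\<^sub>0 \<subseteq> \<F> - {S}" "\<And>J. J \<in> \<J> \<Longrightarrow> D J \<subseteq> \<F> - {S}"
      "\<F> - {S} \<subseteq> \<F>\<^sub>0 \<union> (\<Union>J\<in>\<J>. D J)"
      "\<forall>S\<in>\<F>\<^sub>0. \<forall>J\<in>\<J>. sunflower_kernel t \<F>\<^sub>0 (restr \<chi> J S)"
      "\<And>J S. J \<in> \<J> \<Longrightarrow> S \<in> D J \<Longrightarrow> \<not> sunflower_kernel t (D J) (restr \<chi> J S)" by metis
    let ?D = "D(J := insert S (D J))"
    have sub: "insert S (D J) \<subseteq> \<F>" using IH(2) S by blast
    have "\<not> sunflower_kernel t (insert S (D J)) (restr \<chi> J S')" if S': "S' \<in> insert S (D J)" for S'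
    proof
      assume k: "sunflower_kernel t (insert S (D J)) (restr \<chi> J S')"
      have S'_ne: "S' \<in> D J" using k sub S' S(3) sunflower_kernel_mono by blast
      obtain \<T> where T: "\<T> \<subseteq> insert S (D J)" "finite \<T>" "t \<le> card \<T>" "\<forall>X\<in>\<T>. restr \<chi> J S' \<subseteq> X"
        "\<forall>X\<in>\<T>. \<forall>Y\<in>\<T>. X \<noteq> Y \<longrightarrow> X \<inter> Y = restr \<chi> J S'"
        using k unfolding sunflower_kernel_def by blast
      show False
      proof (cases "S \<in> \<T>")
        case True
        have "restr \<chi> J S = restr \<chi> J S'"
          using psubset.prems S(1) S' sub T(4) True
          by (intro restr_eqI[where P = P]) (auto simp: partite_def)
        then show False using k sub S(3) sunflower_kernel_mono by metis
      next
        case False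
        then have "sunflower_kernel t (D J) (restr \<chi> J S')"
          unfolding sunflower_kernel_def using T by blast
        then show False using IH(5) S(2) S'_ne by blast
      qed
    qed
    then have "\<forall>J'\<in>\<J>. \<forall>S'\<in>?D J'. \<not> sunflower_kernel t (?D J') (restr \<chi> J' S')"
      using IH(5) by auto
    moreover have "\<F> \<subseteq> \<F>\<^sub>0 \<union> (\<Union>J\<in>\<J>. ?D J)" using IH(3) S(2) by (auto split: if_splits)
    moreover have "\<forall>J'\<in>\<J>. ?D J' \<subseteq> \<F>" using IH(2) sub by auto
    ultimately show ?thesis using IH(1,4) by (intro exI[of _ \<F>\<^sub>0] exI[of _ ?D]) blast
  qed
qed

text \<open>Induction on the number of traces. Either \<open>\<F>\<^sub>0\<close> or one of the at
  most 2^r buckets has a share of 1/(2^r + 1). In \<open>\<F>\<^sub>0\<close> every trace already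
  gives kernels. A bucket is thinned by a factor \<open>r * t\<close> so that it loses the trace
  \<open>J\<close>. Each round costs a factor \<open>B\<close>, and the extra 1 in the exponent pays
  for the last one.\<close>

theorem homogeneous_subfamily:
  assumes fin: "finite \<F>" and P: "finite P" "card P = r" "1 \<le> r" "1 \<le> t" and part: "partite \<chi> P \<F>"
  shows "\<exists>\<G>\<subseteq>\<F>. card \<F> \<le> ((2 ^ r + 1) * (r * t)) ^ (2 ^ r + 1) * card \<G> \<and>
    (\<forall>J\<in>traces \<chi> P \<G>. \<forall>S\<in>\<G>. sunflower_kernel t \<G> (restr \<chi> J S))"
proof -
  define B where "B = (2 ^ r + 1) * (r * t)"
  have "1 * 1 \<le> r * t" using P by (intro mult_le_mono)
  then have rt: "1 \<le> r * t" by simp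
  have hB: "2 ^ r + 1 \<le> B" using mult_le_mono2[OF rt, of "2 ^ r + 1"] by (simp only: mult_1_right B_def)
  have finTr: "finite (traces \<chi> P \<F>)" "card (traces \<chi> P \<F>) \<le> 2 ^ r" for \<F>
  proof -
    have sub: "traces \<chi> P \<F> \<subseteq> Pow P" by (auto simp: traces_def)
    show "finite (traces \<chi> P \<F>)" using sub P finite_subset by blast
    show "card (traces \<chi> P \<F>) \<le> 2 ^ r" using card_mono[OF _ sub] P by (simp add: card_Pow)
  qed
  have "\<exists>\<G>\<subseteq>\<F>. card \<F> \<le> B ^ (card (traces \<chi> P \<F>) + 1) * card \<G> \<and>
    (\<forall>J\<in>traces \<chi> P \<G>. \<forall>S\<in>\<G>. sunflower_kernel t \<G> (restr \<chi> J S))"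
    using fin part
  proof (induction "card (traces \<chi> P \<F>)" arbitrary: \<F> rule: less_induct)
    case less
    let ?T = "traces \<chi> P \<F>"
    obtain \<F>\<^sub>0 D where D: "\<F>\<^sub>0 \<subseteq> \<F>" "\<And>J. J \<in> ?T \<Longrightarrow> D J \<subseteq> \<F>" "\<F> \<subseteq> \<F>\<^sub>0 \<union> (\<Union>J\<in>?T. D J)"
      "\<forall>S\<in>\<F>\<^sub>0. \<forall>J\<in>?T. sunflower_kernel t \<F>\<^sub>0 (restr \<chi> J S)"
      "\<And>J S. J \<in> ?T \<Longrightarrow> S \<in> D J \<Longrightarrow> \<not> sunflower_kernel t (D J) (restr \<chi> J S)"
      using bucket_decomposition[OF less.prems, of ?T t] by metis
    show ?case
    proof (cases "card \<F> \<le> (2 ^ r + 1) * card \<F>\<^sub>0")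
      case True
      have "(2 ^ r + 1) * card \<F>\<^sub>0 \<le> B ^ (card ?T + 1) * card \<F>\<^sub>0"
      proof (rule mult_le_mono1)
        have "B ^ 1 \<le> B ^ (card ?T + 1)" using hB by (intro power_increasing) auto
        then show "2 ^ r + 1 \<le> B ^ (card ?T + 1)"
          using hB unfolding power_one_right by (rule le_trans[rotated])
      qed
      then have "card \<F> \<le> B ^ (card ?T + 1) * card \<F>\<^sub>0" using True by linarith
      moreover have "\<forall>J\<in>traces \<chi> P \<F>\<^sub>0. \<forall>S\<in>\<F>\<^sub>0. sunflower_kernel t \<F>\<^sub>0 (restr \<chi> J S)"
        using traces_mono[OF D(1), of \<chi> P] D(4) by blast
      ultimately show ?thesis using D(1) by (intro exI[of _ \<F>\<^sub>0] conjI)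
    next
      case False
      have "\<exists>J\<in>?T. card \<F> \<le> (2 ^ r + 1) * card (D J)"
      proof (rule ccontr)
        assume "\<not> ?thesis"
        then have less': "\<And>J. J \<in> ?T \<Longrightarrow> (2 ^ r + 1) * card (D J) \<le> card \<F>" by fastforce
        have "card \<F> \<le> card (\<F>\<^sub>0 \<union> (\<Union>J\<in>?T. D J))"
          using D less.prems(1) finTr by (intro card_mono) (auto intro: finite_subset)
        also have "\<dots> \<le> card \<F>\<^sub>0 + card (\<Union>J\<in>?T. D J)" by (rule card_Un_le)
        also have "\<dots> \<le> card \<F>\<^sub>0 + (\<Sum>J\<in>?T. card (D J))" using finTr by (simp add: card_UN_le)
        finally have "(2 ^ r + 1) * card \<F> \<le> (2 ^ r + 1) * (card \<F>\<^sub>0 + (\<Sum>J\<in>?T. card (D J)))"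
          by (rule mult_le_mono2)
        also have "\<dots> = (2 ^ r + 1) * card \<F>\<^sub>0 + (\<Sum>J\<in>?T. (2 ^ r + 1) * card (D J))"
          by (simp only: distrib_left sum_distrib_left)
        also have "\<dots> < card \<F> + (\<Sum>J\<in>?T. card \<F>)"
          using False less' by (intro add_less_le_mono sum_mono) auto
        also have "\<dots> \<le> (2 ^ r + 1) * card \<F>" using finTr(2)[of \<F>] by simp
        finally show False by simp
      qed
      then obtain J where J: "J \<in> ?T" "card \<F> \<le> (2 ^ r + 1) * card (D J)" by blast
      have "\<exists>D'\<subseteq>D J. avoids_trace \<chi> D' J \<and> card (D J) \<le> r * t * card D'"
      proof (rule avoid_non_kernel_trace)
        show "finite (D J)" using D(2)[OF J(1)] less.prems(1) finite_subset by blast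
        show "partite \<chi> P (D J)" using D(2)[OF J(1)] less.prems(2) by (auto simp: partite_def)
        show "J \<subseteq> P" using J(1) by (simp add: traces_def)
      qed (use P D(5) J in auto)
      then obtain D' where D': "D' \<subseteq> D J" "avoids_trace \<chi> D' J" "card (D J) \<le> r * t * card D'" by blast
      have sub: "D' \<subseteq> \<F>" using D'(1) D(2)[OF J(1)] by blast
      have "J \<notin> traces \<chi> P D'" using D'(2) by (simp add: traces_def)
      then have "traces \<chi> P D' \<subset> ?T" using traces_mono[OF sub, of \<chi> P] J(1) by blast
      then have less_card: "card (traces \<chi> P D') < card ?T" using finTr(1) by (simp add: psubset_card_mono)
      have "finite D'" "partite \<chi> P D'"
        using sub less.prems finite_subset by (auto simp: partite_def)
      from less.hyps[OF less_card this] obtain \<G> where G: "\<G> \<subseteq> D'"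
        "card D' \<le> B ^ (card (traces \<chi> P D') + 1) * card \<G>"
        "\<forall>J\<in>traces \<chi> P \<G>. \<forall>S\<in>\<G>. sunflower_kernel t \<G> (restr \<chi> J S)" by blast
      have "card \<F> \<le> (2 ^ r + 1) * (r * t * card D')"
        using J(2) mult_le_mono2[OF D'(3), of "2 ^ r + 1"] by linarith
      also have "\<dots> = B * card D'" by (simp only: B_def mult.assoc)
      also have "\<dots> \<le> B * (B ^ (card (traces \<chi> P D') + 1) * card \<G>)"
        using G(2) by (rule mult_le_mono2)
      also have "\<dots> \<le> B * (B ^ card ?T * card \<G>)"
        using hB less_card by (intro mult_le_mono2 mult_le_mono1 power_increasing) auto
      also have "\<dots> = B ^ (card ?T + 1) * card \<G>" by (simp only: power_add power_one_right mult.assoc mult.commute mult.left_commute)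
      finally show ?thesis using G(3) order_trans[OF G(1) sub] by (intro exI[of _ \<G>] conjI)
    qed
  qed
  then obtain \<G> where G: "\<G> \<subseteq> \<F>" "card \<F> \<le> B ^ (card (traces \<chi> P \<F>) + 1) * card \<G>"
    "\<forall>J\<in>traces \<chi> P \<G>. \<forall>S\<in>\<G>. sunflower_kernel t \<G> (restr \<chi> J S)" by blast
  have "B ^ (card (traces \<chi> P \<F>) + 1) * card \<G> \<le> B ^ (2 ^ r + 1) * card \<G>"
    using finTr(2) hB by (intro mult_le_mono1 power_increasing) auto
  then have "card \<F> \<le> B ^ (2 ^ r + 1) * card \<G>" using G(2) by linarith
  then show ?thesis using G(1,3) unfolding B_def by (intro exI[of _ \<G>] conjI)
qed

text \<open>Petals are disjoint outside the kernel, so a set with fewer elements than there are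
  petals misses one of them there.\<close>

lemma sunflower_member_avoiding:
  assumes "sunflower_kernel t \<F> A" "finite X" "card X < t"
  obtains S where "S \<in> \<F>" "A \<subseteq> S" "S \<inter> X \<subseteq> A"
proof -
  obtain \<T> where T: "\<T> \<subseteq> \<F>" "finite \<T>" "t \<le> card \<T>" "\<forall>S\<in>\<T>. A \<subseteq> S"
    "\<forall>S\<in>\<T>. \<forall>S'\<in>\<T>. S \<noteq> S' \<longrightarrow> S \<inter> S' = A"
    using assms(1) unfolding sunflower_kernel_def by blast
  have "\<exists>S\<in>\<T>. S \<inter> X \<subseteq> A"
  proof (rule ccontr)
    assume "\<not> ?thesis"
    then have "\<forall>S\<in>\<T>. \<exists>x. x \<in> S \<inter> X - A" by blast
    then obtain h where h: "\<And>S. S \<in> \<T> \<Longrightarrow> h S \<in> S \<inter> X - A" by metis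
    then have "inj_on h \<T>" using T(5) unfolding inj_on_def by (metis DiffD1 DiffD2 IntD1 IntI)
    then have "card \<T> \<le> card X" using h assms(2) by (intro card_inj_on_le[of h]) auto
    then show False using T(3) assms(3) by simp
  qed
  then show ?thesis using that T by blast
qed

text \<open>Within one member \<open>S\<close>, the part coloured by \<open>J\<^sub>1\<close>
  extends to a member \<open>S\<^sub>1\<close> that avoids the rest of \<open>?A\<^sub>2\<close>,
  and then \<open>?A\<^sub>2\<close> extends to a member \<open>S\<^sub>2\<close> that avoids the
  rest of \<open>S\<^sub>1\<close>; the two meet exactly in the part of \<open>S\<close> coloured by
  both patterns. More than \<open>r\<close> petals suffice because the sets to be avoided have at
  most \<open>r\<close> elements.\<close>

lemma traces_Int_closed:
  assumes P: "finite P" "card P = r" and part: "partite \<chi> P \<G>" and t: "r < t"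
    and ker: "\<And>J S. J \<in> traces \<chi> P \<G> \<Longrightarrow> S \<in> \<G> \<Longrightarrow> sunflower_kernel t \<G> (restr \<chi> J S)"
    and J: "J\<^sub>1 \<in> traces \<chi> P \<G>" "J\<^sub>2 \<in> traces \<chi> P \<G>" "J\<^sub>1 \<noteq> P"
  shows "J\<^sub>1 \<inter> J\<^sub>2 \<in> traces \<chi> P \<G>"
proof -
  have bij: "bij_betw \<chi> S P" if "S \<in> \<G>" for S using part that by (simp add: partite_def)
  have S_fin: "finite S" "card S = r" if "S \<in> \<G>" for S
    using P bij_betw_finite[OF bij[OF that]] bij_betw_same_card[OF bij[OF that]] by simp_all
  have JP: "J\<^sub>1 \<subseteq> P" "J\<^sub>2 \<subseteq> P" using J by (auto simp: traces_def)
  obtain S where S: "S \<in> \<G>" using J(1) by (auto simp: traces_def avoids_trace_def)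
  let ?A\<^sub>1 = "restr \<chi> J\<^sub>1 S" and ?A\<^sub>2 = "restr \<chi> J\<^sub>2 S"
  have "card ?A\<^sub>2 < t" using card_restr[OF bij[OF S] JP(2)] card_mono[OF P(1) JP(2)] P t by simp
  moreover have "finite ?A\<^sub>2" using S_fin(1)[OF S] by (simp add: restr_def)
  ultimately obtain S\<^sub>1 where S1: "S\<^sub>1 \<in> \<G>" "?A\<^sub>1 \<subseteq> S\<^sub>1" "S\<^sub>1 \<inter> ?A\<^sub>2 \<subseteq> ?A\<^sub>1"
    using sunflower_member_avoiding[OF ker[OF J(1) S]] by metis
  obtain S\<^sub>2 where S2: "S\<^sub>2 \<in> \<G>" "?A\<^sub>2 \<subseteq> S\<^sub>2" "S\<^sub>2 \<inter> S\<^sub>1 \<subseteq> ?A\<^sub>2"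
    using sunflower_member_avoiding[OF ker[OF J(2) S]] S_fin[OF S1(1)] t by metis
  have "S\<^sub>1 \<inter> S\<^sub>2 = restr \<chi> (J\<^sub>1 \<inter> J\<^sub>2) S"
    using S1 S2 by (auto simp: restr_def)
  then have tr: "\<chi> ` (S\<^sub>1 \<inter> S\<^sub>2) = J\<^sub>1 \<inter> J\<^sub>2" using image_restr[OF bij[OF S], of "J\<^sub>1 \<inter> J\<^sub>2"] JP by auto
  moreover have "S\<^sub>1 \<noteq> S\<^sub>2"
  proof
    assume "S\<^sub>1 = S\<^sub>2"
    then have "P = J\<^sub>1 \<inter> J\<^sub>2" using tr bij[OF S1(1)] by (simp add: bij_betw_def)
    then show False using J(3) JP by blast
  qed
  ultimately show ?thesis using S1(1) S2(1) JP by (auto simp: traces_def avoids_trace_def)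
qed

text \<open>Averaging over all maps from \<open>V\<close> to \<open>P\<close>: a fixed member is
  coloured as prescribed by a fraction r^(-r) of them, so some map is right for at least that
  fraction of \<open>\<F>\<close>.\<close>

lemma exists_common_colouring:
  assumes V: "finite V" "\<And>S. S \<in> \<F> \<Longrightarrow> S \<subseteq> V" and P: "finite P" "card P = r" "1 \<le> r"
    and f: "\<And>S. S \<in> \<F> \<Longrightarrow> bij_betw (f S) S P"
  shows "\<exists>\<chi>. card \<F> \<le> r ^ r * card {S \<in> \<F>. \<forall>v\<in>S. \<chi> v = f S v}"
proof (rule ccontr)
  assume "\<not> ?thesis"
  then have less: "\<And>\<chi>. r ^ r * card {S \<in> \<F>. \<forall>v\<in>S. \<chi> v = f S v} < card \<F>" by (simp add: not_le)
  define \<Omega> where "\<Omega> = V \<rightarrow>\<^sub>E P"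
  have \<Omega>: "finite \<Omega>" "card \<Omega> = r ^ card V" using V P by (auto simp: \<Omega>_def card_PiE intro: finite_PiE)
  then have "\<Omega> \<noteq> {}" using P by (metis card.empty not_one_le_zero power_eq_0_iff)
  have finF: "finite \<F>" using V by (intro finite_subset[of \<F> "Pow V"]) auto
  have ext: "r ^ (card V - r) \<le> card {\<chi> \<in> \<Omega>. \<forall>v\<in>S. \<chi> v = f S v}" if S: "S \<in> \<F>" for S
  proof -
    have SV: "S \<subseteq> V" "finite S" "card S = r"
      using V(2)[OF S] V(1) finite_subset bij_betw_same_card[OF f[OF S]] P by auto
    have "(\<Pi>\<^sub>E v\<in>V. if v \<in> S then {f S v} else P) \<subseteq> {\<chi> \<in> \<Omega>. \<forall>v\<in>S. \<chi> v = f S v}"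
    proof
      fix \<chi> assume \<chi>: "\<chi> \<in> (\<Pi>\<^sub>E v\<in>V. if v \<in> S then {f S v} else P)"
      have v: "\<chi> v \<in> (if v \<in> S then {f S v} else P)" if "v \<in> V" for v
        using PiE_mem[OF \<chi> that] .
      have "\<chi> v \<in> P" if "v \<in> V" for v
        using v[OF that] f[OF S] by (auto simp: bij_betw_def split: if_splits)
      moreover have "\<chi> v = f S v" if "v \<in> S" for v using v[of v] that SV by auto
      ultimately show "\<chi> \<in> {\<chi> \<in> \<Omega>. \<forall>v\<in>S. \<chi> v = f S v}"
        using \<chi> by (auto simp: \<Omega>_def PiE_iff)
    qed
    moreover have "finite {\<chi> \<in> \<Omega>. \<forall>v\<in>S. \<chi> v = f S v}" using \<Omega> by simp
    ultimately have "card (\<Pi>\<^sub>E v\<in>V. if v \<in> S then {f S v} else P) \<le> card {\<chi> \<in> \<Omega>. \<forall>v\<in>S. \<chi> v = f S v}"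
      by (intro card_mono)
    moreover have "card (\<Pi>\<^sub>E v\<in>V. if v \<in> S then {f S v} else P) = (\<Prod>v\<in>V. if v \<in> S then 1 else r)"
      using V(1) P by (subst card_PiE) (auto intro: prod.cong)
    moreover have "(\<Prod>v\<in>V. if v \<in> S then 1 else r) = r ^ card (V - S)"
      using V(1) by (simp add: prod.If_cases Diff_eq)
    ultimately show ?thesis using SV by (simp add: card_Diff_subset)
  qed
  have "r ^ r * (r ^ (card V - r) * card \<F>) \<le> r ^ r * (\<Sum>S\<in>\<F>. card {\<chi> \<in> \<Omega>. \<forall>v\<in>S. \<chi> v = f S v})"
    using sum_mono[OF ext, of \<F>] by (simp add: mult.commute)
  also have "(\<Sum>S\<in>\<F>. card {\<chi> \<in> \<Omega>. \<forall>v\<in>S. \<chi> v = f S v}) = (\<Sum>\<chi>\<in>\<Omega>. card {S \<in> \<F>. \<forall>v\<in>S. \<chi> v = f S v})"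
    using sum.swap_restrict[OF finF \<Omega>(1), of "\<lambda>_ _. 1 :: nat"] by simp
  also have "r ^ r * \<dots> = (\<Sum>\<chi>\<in>\<Omega>. r ^ r * card {S \<in> \<F>. \<forall>v\<in>S. \<chi> v = f S v})"
    by (rule sum_distrib_left)
  also have "\<dots> < (\<Sum>\<chi>\<in>\<Omega>. card \<F>)" using \<Omega>(1) \<open>\<Omega> \<noteq> {}\<close> less by (intro sum_strict_mono)
  also have "\<dots> = r ^ card V * card \<F>" using \<Omega> by simp
  finally have 1: "r ^ r * (r ^ (card V - r) * card \<F>) < r ^ card V * card \<F>" .
  then have "\<F> \<noteq> {}" by auto
  then obtain S where "S \<in> \<F>" by blast
  then have "r \<le> card V" using V card_mono[OF V(1), of S] bij_betw_same_card[OF f] P by metis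
  then have "r ^ r * r ^ (card V - r) = r ^ card V" by (simp flip: power_add)
  then show False using 1 by (simp flip: mult.assoc)
qed

section \<open>Closure designs\<close>

text \<open>The proper flats of a perfect matroid design of rank \<open>s\<close>; level i is rank i
  - 1, and level s + 1 is the ground set. In place of exchange, \<open>M_cover\<close> says that
  fewer than \<open>s\<close> elements never span.\<close>

locale closure_design =
  fixes P :: "'p set" and M :: "'p set set" and k :: "nat \<Rightarrow> nat" and s :: nat
  assumes finite_P: "finite P"
    and M_subset: "J \<in> M \<Longrightarrow> J \<subseteq> P"
    and M_Int: "J \<in> M \<Longrightarrow> J' \<in> M \<Longrightarrow> J \<inter> J' \<in> M"
    and M_card: "J \<in> M \<Longrightarrow> \<exists>i\<in>{1..s}. card J = k i"
    and k_mono: "strict_mono_on {1..Suc s} k" and k_top: "k (Suc s) = card P"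
    and M_cover: "B \<subseteq> P \<Longrightarrow> card B < s \<Longrightarrow> \<exists>J\<in>M. B \<subseteq> J"
begin

definition flats :: "'p set set" where
  "flats = insert P M"

definition cl :: "'p set \<Rightarrow> 'p set" where
  "cl B = \<Inter> {X \<in> flats. B \<subseteq> X}"

lemma flats_subset: "X \<in> flats \<Longrightarrow> X \<subseteq> P"
  using M_subset by (auto simp: flats_def)

lemma finite_flat: "X \<in> flats \<Longrightarrow> finite X"
  using flats_subset finite_P finite_subset by blast

lemma flats_Int: "X \<in> flats \<Longrightarrow> Y \<in> flats \<Longrightarrow> X \<inter> Y \<in> flats"
  using M_subset M_Int by (auto simp: flats_def Int_absorb1 Int_absorb2)

lemma flat_level:
  assumes "X \<in> flats"
  obtains i where "1 \<le> i" "i \<le> Suc s" "card X = k i"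
  using assms M_card[of X] k_top by (force simp: flats_def)

lemma k_less_iff: "1 \<le> i \<Longrightarrow> i \<le> Suc s \<Longrightarrow> 1 \<le> j \<Longrightarrow> j \<le> Suc s \<Longrightarrow> k i < k j \<longleftrightarrow> i < j"
  using strict_mono_on_less[OF k_mono, of i j] by simp

lemma k_le_iff: "1 \<le> i \<Longrightarrow> i \<le> Suc s \<Longrightarrow> 1 \<le> j \<Longrightarrow> j \<le> Suc s \<Longrightarrow> k i \<le> k j \<longleftrightarrow> i \<le> j"
  using k_less_iff[of j i] by (simp add: not_less[symmetric])

lemma Inter_flats: "finite \<X> \<Longrightarrow> \<X> \<noteq> {} \<Longrightarrow> \<X> \<subseteq> flats \<Longrightarrow> \<Inter>\<X> \<in> flats"
  by (induction \<X> rule: finite_ne_induct) (simp_all add: flats_Int)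

lemma cl_flat: "B \<subseteq> P \<Longrightarrow> cl B \<in> flats"
proof -
  assume "B \<subseteq> P"
  moreover have "finite flats" using flats_subset finite_P by (intro finite_subset[of flats "Pow P"]) auto
  ultimately show ?thesis unfolding cl_def by (intro Inter_flats) (auto simp: flats_def)
qed

lemma cl_superset: "B \<subseteq> cl B"
  by (auto simp: cl_def)

lemma cl_least: "X \<in> flats \<Longrightarrow> B \<subseteq> X \<Longrightarrow> cl B \<subseteq> X"
  by (auto simp: cl_def)

lemma cl_eq_flat: "X \<in> flats \<Longrightarrow> cl X = X"
  using cl_least[of X X] cl_superset[of X] by blast

lemma cl_mono: "A \<subseteq> B \<Longrightarrow> cl A \<subseteq> cl B"
  by (auto simp: cl_def)

lemma cl_cl_Un:
  assumes "A \<subseteq> P" "D \<subseteq> P"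
  shows "cl (cl A \<union> D) = cl (A \<union> D)"
proof
  show "cl (A \<union> D) \<subseteq> cl (cl A \<union> D)" using cl_superset by (intro cl_mono) blast
  show "cl (cl A \<union> D) \<subseteq> cl (A \<union> D)"
    using assms cl_mono[of A "A \<union> D"] cl_superset[of "A \<union> D"] by (intro cl_least cl_flat) auto
qed

lemma cl_small_ne: "B \<subseteq> P \<Longrightarrow> card B < s \<Longrightarrow> cl B \<noteq> P"
proof
  assume "B \<subseteq> P" "card B < s" and eq: "cl B = P"
  then obtain J where J: "J \<in> M" "B \<subseteq> J" using M_cover by blast
  then have "P \<subseteq> J" using cl_least[of J B] eq by (auto simp: flats_def)
  then have "card P \<le> card J" using J M_subset by (metis order.refl subset_antisym)
  moreover obtain i where "1 \<le> i" "i \<le> s" "card J = k i" using M_card[OF J(1)] by auto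
  ultimately show False using k_less_iff[of i "Suc s"] k_top by simp
qed

lemma flat_eqI: "X \<in> flats \<Longrightarrow> Y \<in> flats \<Longrightarrow> X \<subseteq> Y \<Longrightarrow> card Y \<le> card X \<Longrightarrow> X = Y"
  using finite_flat card_subset_eq[of Y X] card_mono[of Y X] by fastforce

text \<open>Every element adjoined from outside the current flat raises the level, so climbing from
  level i to level j takes at most j - i elements.\<close>

lemma extend_to_flat:
  assumes "X \<in> flats" "Y \<in> flats" "X \<subseteq> Y" "card X = k i" "card Y = k j"
    and "1 \<le> i" "i \<le> Suc s" "1 \<le> j" "j \<le> Suc s"
  shows "\<exists>D\<subseteq>Y. finite D \<and> card D \<le> j - i \<and> cl (X \<union> D) = Y"
  using assms
proof (induction "j - i" arbitrary: X i rule: less_induct)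
  case less
  show ?case
  proof (cases "X = Y")
    case True
    then show ?thesis using cl_eq_flat less.prems by (intro exI[of _ "{}"]) simp
  next
    case False
    then obtain y where y: "y \<in> Y" "y \<notin> X" using less.prems(3) by blast
    have P: "insert y X \<subseteq> P" using flats_subset less.prems(1,2) y by blast
    let ?X = "cl (insert y X)"
    have X': "?X \<in> flats" "?X \<subseteq> Y" "insert y X \<subseteq> ?X"
      using cl_flat[OF P] cl_least[OF less.prems(2), of "insert y X"] y less.prems(3) cl_superset by auto
    obtain i' where i': "1 \<le> i'" "i' \<le> Suc s" "card ?X = k i'" using flat_level[OF X'(1)] .
    have "card X < card ?X" using finite_flat[OF X'(1)] X'(3) y by (intro psubset_card_mono) auto
    then have "i < i'" using k_less_iff less.prems i' by simp
    moreover have "card ?X \<le> card Y" using finite_flat[OF less.prems(2)] X'(2) by (rule card_mono)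
    then have "i' \<le> j" using k_le_iff less.prems i' by simp
    ultimately have lt: "j - i' < j - i" by simp
    obtain D where D: "D \<subseteq> Y" "finite D" "card D \<le> j - i'" "cl (?X \<union> D) = Y"
      using less.hyps[OF lt X'(1) less.prems(2) X'(2) i'(3) less.prems(5) i'(1,2) less.prems(8,9)] by blast
    have "D \<subseteq> P" using D(1) flats_subset[OF less.prems(2)] by blast
    then have "cl (X \<union> insert y D) = Y" using D(4) cl_cl_Un[OF P, of D] by simp
    moreover have "card (insert y D) \<le> j - i"
      using D(2,3) \<open>i < i'\<close> \<open>i' \<le> j\<close> card_insert_le_m1[of "Suc (j - i')" D y] by linarith
    ultimately show ?thesis using D(1,2) y(1) by (intro exI[of _ "insert y D"]) simp
  qed
qed

lemma flat_generated:
  assumes X: "X \<in> flats" "card X = k i" "1 \<le> i" "i \<le> Suc s"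
  shows "\<exists>B\<subseteq>X. finite B \<and> card B \<le> i - 1 \<and> cl B = X"
proof -
  have e: "cl {} \<in> flats" by (rule cl_flat) simp
  obtain i' where i': "1 \<le> i'" "i' \<le> Suc s" "card (cl {}) = k i'" using flat_level[OF e] .
  obtain D where D: "D \<subseteq> X" "finite D" "card D \<le> i - i'" "cl (cl {} \<union> D) = X"
    using extend_to_flat[OF e X(1) _ i'(3) X(2) i'(1,2) X(3,4)] cl_least[OF X(1), of "{}"] by auto
  have "cl D = X" using D cl_cl_Un[of "{}" D] flats_subset[OF X(1)] by auto
  then show ?thesis using D i' by (intro exI[of _ D]) auto
qed

text \<open>If \<open>cl B\<close> had level \<open>j \<ge> card B + 2\<close>, the at most
  \<open>Suc s - j\<close> elements needed to climb on to \<open>P\<close> would, together with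
  \<open>B\<close>, span with fewer than \<open>s\<close> elements.\<close>

lemma spanning_bound:
  assumes B: "B \<subseteq> P" "finite B" and X: "card (cl B) = k j" "1 \<le> j" "j \<le> Suc s"
  shows "j \<le> card B + 1"
proof (rule ccontr)
  assume "\<not> ?thesis"
  then have j: "card B + 2 \<le> j" by simp
  have "P \<in> flats" by (simp add: flats_def)
  then obtain D where D: "D \<subseteq> P" "finite D" "card D \<le> Suc s - j" "cl (cl B \<union> D) = P"
    using extend_to_flat[OF cl_flat[OF B(1)] _ flats_subset[OF cl_flat[OF B(1)]] X(1) k_top[symmetric] X(2,3)]
    by auto
  have "card (B \<union> D) \<le> card B + card D" by (rule card_Un_le)
  then have "card (B \<union> D) < s" using D(3) j X(3) by linarith
  then show False using cl_small_ne[of "B \<union> D"] D(1,4) B(1) cl_cl_Un[OF B(1) D(1)] by simp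
qed

lemma card_cl_empty: "card (cl {}) = k 1"
proof -
  obtain j where j: "1 \<le> j" "j \<le> Suc s" "card (cl {}) = k j"
    using flat_level[OF cl_flat[of "{}"]] by blast
  then show ?thesis using spanning_bound[of "{}" j] by simp
qed

text \<open>The substitute for exchange: the level rises because the flat grows, and only by one
  because the new flat is spanned by at most \<open>i\<close> elements.\<close>

lemma card_cl_insert:
  assumes X: "X \<in> flats" "card X = k i" "1 \<le> i" "i \<le> s" and y: "y \<in> P" "y \<notin> X"
  shows "card (cl (insert y X)) = k (Suc i)"
proof -
  have P: "X \<subseteq> P" "insert y X \<subseteq> P" using flats_subset[OF X(1)] y by auto
  have Y: "cl (insert y X) \<in> flats" by (rule cl_flat[OF P(2)])
  obtain j where j: "1 \<le> j" "j \<le> Suc s" "card (cl (insert y X)) = k j" using flat_level[OF Y] .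
  obtain B where B: "B \<subseteq> X" "finite B" "card B \<le> i - 1" "cl B = X"
    using flat_generated[OF X(1-3)] X(4) by auto
  have "cl (insert y B) = cl (insert y X)"
    using cl_cl_Un[of B "{y}"] B P by auto
  then have "j \<le> card (insert y B) + 1"
    using spanning_bound[of "insert y B" j] B P j by auto
  moreover have "card (insert y B) \<le> Suc (card B)" by (rule card_insert_le_m1) simp_all
  ultimately have "j \<le> Suc i" using B(3) X(3) by linarith
  moreover have "card X < card (cl (insert y X))"
    using finite_flat[OF Y] cl_superset[of "insert y X"] y by (intro psubset_card_mono) auto
  then have "i < j" using k_less_iff X j by simp
  ultimately have "j = Suc i" by simp
  then show ?thesis using j by simp
qed

lemma flat_of_level:
  assumes "1 \<le> i" "i \<le> Suc s"
  shows "\<exists>X\<in>flats. card X = k i"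
  using assms
proof (induction i rule: dec_induct)
  case base
  then show ?case using card_cl_empty cl_flat[of "{}"] by auto
next
  case (step i)
  then obtain X where X: "X \<in> flats" "card X = k i" by auto
  have "k i < k (Suc s)" using k_less_iff[of i "Suc s"] step by simp
  then have "X \<noteq> P" using X k_top by auto
  then obtain y where y: "y \<in> P" "y \<notin> X" using flats_subset[OF X(1)] by blast
  then have "cl (insert y X) \<in> flats" using flats_subset[OF X(1)] by (intro cl_flat) auto
  then show ?case using card_cl_insert[OF X _ _ y] step by auto
qed

lemma cl_insert_eq:
  assumes X: "X \<in> flats" "card X = k i" "1 \<le> i" "i \<le> s"
    and Y: "Y \<in> flats" "card Y = k (Suc i)" "X \<subseteq> Y" and y: "y \<in> Y" "y \<notin> X"
  shows "cl (insert y X) = Y"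
proof (rule flat_eqI)
  have yP: "y \<in> P" using y Y flats_subset by blast
  show "cl (insert y X) \<in> flats" using yP flats_subset[OF X(1)] by (intro cl_flat) auto
  show "cl (insert y X) \<subseteq> Y" using Y y by (intro cl_least) auto
  show "card Y \<le> card (cl (insert y X))" using card_cl_insert[OF X yP y(2)] Y(2) by simp
qed (rule Y(1))

lemma flats_above_Int:
  assumes X: "X \<in> flats" "card X = k i" "1 \<le> i" "i \<le> s"
    and Y: "Y \<in> flats" "card Y = k (Suc i)" "X \<subseteq> Y"
    and Z: "Z \<in> flats" "card Z = k (Suc i)" "X \<subseteq> Z" and "Y \<noteq> Z"
  shows "Y \<inter> Z = X"
  using cl_insert_eq[OF X Y] cl_insert_eq[OF X Z] assms by blast

section \<open>Blocks: the parallel classes in the contraction by a flat\<close>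

definition blocks :: "'p set \<Rightarrow> 'p set set" where
  "blocks X = (\<lambda>y. cl (insert y X) - X) ` (P - X)"

context
  fixes X :: "'p set" and i :: nat
  assumes X: "X \<in> flats" "card X = k i" "1 \<le> i" "i \<le> s"
begin

lemma block_flat:
  assumes "C \<in> blocks X"
  shows "X \<union> C \<in> flats" "card (X \<union> C) = k (Suc i)" "X \<inter> C = {}" "C \<subseteq> P"
proof -
  obtain y where y: "y \<in> P" "y \<notin> X" "C = cl (insert y X) - X" using assms by (auto simp: blocks_def)
  then have eq: "X \<union> C = cl (insert y X)" using cl_superset[of "insert y X"] by auto
  have P: "insert y X \<subseteq> P" using flats_subset[OF X(1)] y by auto
  show "X \<union> C \<in> flats" "card (X \<union> C) = k (Suc i)"
    unfolding eq using cl_flat[OF P] card_cl_insert[OF X y(1,2)] by auto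
  show "X \<inter> C = {}" using y(3) by auto
  show "C \<subseteq> P" using flats_subset[OF cl_flat[OF P]] y(3) by auto
qed

lemma card_block: "C \<in> blocks X \<Longrightarrow> card C = k (Suc i) - k i"
  using card_Un_disjoint[of X C] block_flat[of C] finite_flat[OF X(1)] X(2)
    finite_flat[of "X \<union> C"] by simp

lemma blocks_disjoint: "C \<in> blocks X \<Longrightarrow> C' \<in> blocks X \<Longrightarrow> C \<noteq> C' \<Longrightarrow> C \<inter> C' = {}"
  using flats_above_Int[OF X block_flat(1,2) _ block_flat(1,2), of C C'] block_flat(3)[of C]
    block_flat(3)[of C'] by blast

lemma Union_blocks: "\<Union> (blocks X) = P - X"
proof
  show "\<Union> (blocks X) \<subseteq> P - X" using block_flat by blast
  show "P - X \<subseteq> \<Union> (blocks X)"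
  proof
    fix y assume "y \<in> P - X"
    moreover from this have "y \<in> cl (insert y X) - X" using cl_superset[of "insert y X"] by blast
    ultimately show "y \<in> \<Union> (blocks X)" by (auto simp: blocks_def)
  qed
qed

lemma card_blocks: "(k (Suc i) - k i) * card (blocks X) = card P - k i"
proof -
  have "(k (Suc i) - k i) * card (blocks X) = card (\<Union> (blocks X))"
    using finite_P card_block blocks_disjoint Union_blocks
    by (intro card_partition) (auto simp: blocks_def)
  then show ?thesis
    using card_Diff_subset[OF finite_flat[OF X(1)] flats_subset[OF X(1)]] X(2) Union_blocks by simp
qed

lemma flat_within_block:
  assumes "Y \<in> flats" "X \<subseteq> Y" "C \<in> blocks X" "c \<in> C" "c \<in> Y"
  shows "C \<subseteq> Y"
proof -
  have "cl (insert c X) = X \<union> C"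
    using assms(3,4) block_flat[OF assms(3)] by (intro cl_insert_eq[OF X]) auto
  moreover have "cl (insert c X) \<subseteq> Y" using assms by (intro cl_least) auto
  ultimately show ?thesis by blast
qed

end

lemma step_dvd:
  assumes "1 \<le> i" "i \<le> s"
  shows "(k (Suc i) - k i) dvd (card P - k i)"
proof -
  obtain X where "X \<in> flats" "card X = k i" using flat_of_level[of i] assms by auto
  then show ?thesis using card_blocks[of X i] assms by (metis dvd_triv_left)
qed

text \<open>Over a flat \<open>W\<close> of level \<open>i\<close> consider "points" and "lines", the flats of level \<open>i + 1\<close> and \<open>i + 2\<close>
  inside a "plane". Equality of the two upper gaps says that a point \<open>C\<close> lies on only two lines of the
  plane, so a line \<open>N\<close> avoiding \<open>C\<close>, whose points are all joined to \<open>C\<close> by different lines, has just two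
  points \<open>A\<close> and \<open>B\<close>.\<close>

lemma equal_gaps_step:
  assumes i: "1 \<le> i" "i + 2 \<le> s" and eq: "k (i + 3) - k (i + 2) = k (i + 2) - k (i + 1)"
  shows "k (i + 2) - k (i + 1) = k (i + 1) - k i"
proof -
  have lt: "k i < k (i + 1)" "k (i + 1) < k (i + 2)" "k (i + 2) < k (i + 3)" "k (i + 2) < card P"
    using k_less_iff[of i "i + 1"] k_less_iff[of "i + 1" "i + 2"] k_less_iff[of "i + 2" "i + 3"]
      k_less_iff[of "i + 2" "Suc s"] k_top i by auto
  have ex: "\<exists>y. y \<in> P \<and> y \<notin> X" if "X \<in> flats" "card X < card P" for X
    using that flats_subset by (metis less_irrefl subsetI subset_antisym)
  obtain W where W: "W \<in> flats" "card W = k i" using flat_of_level[of i] i by auto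
  have up: "cl (insert y X) \<in> flats \<and> card (cl (insert y X)) = k (Suc j) \<and> insert y X \<subseteq> cl (insert y X)"
    if "X \<in> flats" "card X = k j" "1 \<le> j" "j \<le> s" "y \<in> P" "y \<notin> X" for X y j
    using card_cl_insert[OF that] cl_flat[of "insert y X"] flats_subset[OF that(1)] that(5)
      cl_superset[of "insert y X"] by blast
  obtain a where a: "a \<in> P" "a \<notin> W" using ex[OF W(1)] W(2) lt by auto
  define A where "A = cl (insert a W)"
  have A: "A \<in> flats" "card A = k (i + 1)" "W \<subseteq> A" using up[OF W i(1) _ a] i by (auto simp: A_def)
  obtain b where b: "b \<in> P" "b \<notin> A" using ex[OF A(1)] A(2) lt by auto
  define N where "N = cl (insert b A)"
  have N: "N \<in> flats" "card N = k (i + 2)" "A \<subseteq> N" "b \<in> N" using up[OF A(1,2) _ _ b] i by (auto simp: N_def)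
  obtain c where c: "c \<in> P" "c \<notin> N" using ex[OF N(1)] N(2) lt by auto
  define Z where "Z = cl (insert c N)"
  have Z: "Z \<in> flats" "card Z = k (i + 3)" "N \<subseteq> Z" "c \<in> Z"
    using up[OF N(1,2) _ _ c] i by (auto simp: Z_def eval_nat_numeral)
  define point where "point Q \<longleftrightarrow> Q \<in> flats \<and> card Q = k (i + 1) \<and> W \<subseteq> Q \<and> Q \<subseteq> N" for Q
  have point: "point (cl (insert y W))" if "y \<in> N" "y \<notin> W" for y
  proof -
    have "y \<in> P" using that N(1) flats_subset by blast
    moreover have "cl (insert y W) \<subseteq> N" using that A(3) N(1,3) by (intro cl_least) auto
    ultimately show ?thesis using up[OF W i(1) _ _ that(2)] i by (auto simp: point_def)
  qed
  define C where "C = cl (insert c W)"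
  have "c \<notin> W" using c A N by blast
  then have C: "C \<in> flats" "card C = k (i + 1)" "W \<subseteq> C"
    using up[OF W i(1) _ c(1)] i by (auto simp: C_def)
  define join where "join Q = cl (insert c Q)" for Q
  have join: "join Q \<in> flats" "card (join Q) = k (Suc (i + 1))" "Q \<subseteq> join Q" "c \<in> join Q" "C \<subseteq> join Q" "join Q \<subseteq> Z"
    if "point Q" for Q
  proof -
    have Q: "Q \<in> flats" "card Q = k (i + 1)" "W \<subseteq> Q" "Q \<subseteq> N" "c \<notin> Q" using that c by (auto simp: point_def)
    show 1: "join Q \<in> flats" "card (join Q) = k (Suc (i + 1))" "Q \<subseteq> join Q" "c \<in> join Q"
      using up[OF Q(1,2) _ _ c(1) Q(5)] i by (auto simp: join_def)
    show "C \<subseteq> join Q" unfolding C_def using 1 Q(3) by (intro cl_least) auto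
    show "join Q \<subseteq> Z" unfolding join_def using Z Q(4) by (intro cl_least) auto
  qed
  \<comment> \<open>Two points of \<open>N\<close> span \<open>N\<close>, so a common join would
    contain \<open>N\<close> and, by its size, equal it, although \<open>c\<close> lies outside
    \<open>N\<close>.\<close>
  have join_inj: "join Q \<noteq> join Q'" if Q: "point Q" "point Q'" "Q \<noteq> Q'" for Q Q'
  proof
    assume e: "join Q = join Q'"
    have "\<not> Q' \<subseteq> Q" using flat_eqI[of Q' Q] Q by (auto simp: point_def)
    then obtain q where q: "q \<in> Q'" "q \<notin> Q" by blast
    have "cl (insert q Q) = N"
      using Q q N i by (intro cl_insert_eq[of _ "i + 1"]) (auto simp: point_def)
    moreover have "cl (insert q Q) \<subseteq> join Q"
      using join(1,3)[OF Q(1)] join(3)[OF Q(2)] q e by (intro cl_least) auto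
    ultimately have "N = join Q" using flat_eqI[of N "join Q"] N join[OF Q(1)] by auto
    then show False using join(4)[OF Q(1)] c by simp
  qed
  have join_Int: "join Q \<inter> join Q' = C" if "point Q" "point Q'" "Q \<noteq> Q'" for Q Q'
    using join[OF that(1)] join[OF that(2)] join_inj[OF that] C i
    by (intro flats_above_Int[of _ "i + 1"]) auto
  define B where "B = cl (insert b W)"
  have "b \<notin> W" using b A by blast
  then have B: "point B" "b \<in> B" using point N(4) cl_superset[of "insert b W"] by (auto simp: B_def)
  have pA: "point A" using A N by (simp add: point_def)
  have AB: "A \<noteq> B" using B b by auto
  have "N = A \<union> B"
  proof (rule ccontr)
    assume "N \<noteq> A \<union> B"
    then obtain e where e: "e \<in> N" "e \<notin> A" "e \<notin> B" using N(3) B by (auto simp: point_def)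
    define E where "E = cl (insert e W)"
    have E: "point E" "e \<in> E" using point[of e] e A(3) cl_superset[of "insert e W"] by (auto simp: E_def)
    have ne: "E \<noteq> A" "E \<noteq> B" using E e by auto
    have card_line: "card (join Q - C) = k (i + 2) - k (i + 1)" if "point Q" for Q
      using join[OF that] C finite_flat[OF C(1)] by (simp add: card_Diff_subset)
    have fin: "finite (join Q - C)" if "point Q" for Q using join(1)[OF that] finite_flat by simp
    have disj: "(join Q - C) \<inter> (join Q' - C) = {}" if "point Q" "point Q'" "Q \<noteq> Q'" for Q Q'
      using join_Int[OF that] by blast
    have 1: "card ((join A - C) \<union> (join B - C)) = card (join A - C) + card (join B - C)"
      using fin pA B(1) disj[OF pA B(1) AB] by (intro card_Un_disjoint)
    have 2: "card (((join A - C) \<union> (join B - C)) \<union> (join E - C))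
        = card ((join A - C) \<union> (join B - C)) + card (join E - C)"
      using fin[OF pA] fin[OF B(1)] fin[OF E(1)] disj[OF E(1) pA ne(1)] disj[OF E(1) B(1) ne(2)]
      by (intro card_Un_disjoint) auto
    have 3: "card ((((join A - C) \<union> (join B - C)) \<union> (join E - C)) \<union> C)
        = card (((join A - C) \<union> (join B - C)) \<union> (join E - C)) + card C"
      using fin[OF pA] fin[OF B(1)] fin[OF E(1)] finite_flat[OF C(1)] by (intro card_Un_disjoint) auto
    have "card ((((join A - C) \<union> (join B - C)) \<union> (join E - C)) \<union> C) \<le> card Z"
      using join[OF pA] join[OF B(1)] join[OF E(1)] finite_flat[OF Z(1)] by (intro card_mono) auto
    \<comment> \<open>Three lines through \<open>C\<close> need three gaps above
      \<open>k (i + 1)\<close>, while equality of the upper gaps leaves room for exactly two in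
      \<open>Z\<close>.\<close>
    then have "k (i + 1) + 3 * (k (i + 2) - k (i + 1)) \<le> k (i + 3)"
      using 1 2 3 card_line[OF pA] card_line[OF B(1)] card_line[OF E(1)] C(2) Z(2) by linarith
    then show False using eq lt by linarith
  qed
  moreover have "A \<inter> B = W"
    using B(1) A W i AB by (intro flats_above_Int[of W i]) (auto simp: point_def)
  ultimately have "k (i + 2) + k i = k (i + 1) + k (i + 1)"
    using card_Un_Int[of A B] finite_flat A(1,2) B(1) N(2) W(2) by (simp add: point_def)
  then show ?thesis using lt by linarith
qed

text \<open>The induction runs downwards and carries all gaps above the current level, because
  \<open>equal_gaps_step\<close> transfers the equality of two consecutive gaps to the gap below
  them. The hypothesis \<open>eq\<close> supplies the gap just under the top one.\<close>

lemma equal_gaps: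
  assumes s: "2 \<le> s" and eq: "k (Suc s) - k s = k s - k (s - 1)" and i: "1 \<le> i" "i \<le> s"
  shows "k (Suc i) - k i = k (Suc s) - k s"
proof -
  have "\<forall>j\<in>{i..s}. k (Suc j) - k j = k (Suc s) - k s"
    using i(2,1)
  proof (induction i rule: inc_induct)
    case base
    then show ?case by simp
  next
    case (step i)
    have gap: "k (Suc j) - k j = k (Suc s) - k s" if "Suc i \<le> j" "j \<le> s" for j
      using bspec[OF step.IH[OF le_SucI[OF step.prems]], of j] that unfolding atLeastAtMost_iff by blast
    have gap_i: "k (Suc i) - k i = k (Suc s) - k s"
    proof (cases "Suc i = s")
      case True
      then show ?thesis using eq by auto
    next
      case False
      then have i: "i + 2 \<le> s" using step.hyps by simp
      then have "k (i + 3) - k (i + 2) = k (i + 2) - k (i + 1)"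
        using gap[of "i + 2"] gap[of "i + 1"] by (simp add: eval_nat_numeral)
      from equal_gaps_step[OF step.prems i this] show ?thesis using gap[of "i + 1"] i by simp
    qed
    show ?case
    proof (rule ballI)
      fix j assume "j \<in> {i..s}"
      then show "k (Suc j) - k j = k (Suc s) - k s" using gap[of j] gap_i by (cases "j = i") auto
    qed
  qed
  from bspec[OF this, of i] show ?thesis using i by auto
qed

end

section \<open>Supervertices\<close>

lemma card_subsets_le_power:
  assumes "finite V" "1 \<le> card V" "b \<le> e"
  shows "card {A. A \<subseteq> V \<and> card A = b} \<le> card V ^ e"
proof -
  have "card {A. A \<subseteq> V \<and> card A = b} = card V choose b" using assms(1) by (rule n_subsets)
  also have "\<dots> \<le> card V ^ b"
  proof (cases "b \<le> card V")
    case True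
    then show ?thesis by (rule binomial_le_pow)
  next
    case False
    then show ?thesis by (simp add: binomial_eq_0)
  qed
  also have "\<dots> \<le> card V ^ e" using assms by (intro power_increasing) auto
  finally show ?thesis .
qed

lemma restr_in_subsets:
  assumes "bij_betw \<chi> S P" "B \<subseteq> P" "S \<subseteq> V"
  shows "restr \<chi> B S \<in> {A. A \<subseteq> V \<and> card A = card B}"
  using restr_subset[of \<chi> B S] card_restr[OF assms(1,2)] assms(3) by auto

text \<open>The factor \<open>r ^ r\<close> is the loss from the common colouring; the rest is the
  loss from passing to a homogeneous subfamily with sunflowers of \<open>Suc r\<close>
  petals.\<close>

definition hom_const :: "nat \<Rightarrow> nat" where
  "hom_const r = r ^ r * ((2 ^ r + 1) * (r * Suc r)) ^ (2 ^ r + 1)"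

lemma hom_const_pos: "1 \<le> r \<Longrightarrow> 0 < hom_const r"
  by (simp add: hom_const_def)

text \<open>Closure under intersection comes from the kernels with \<open>Suc r\<close> petals and
  the flat sizes from the permitted intersections; the size of \<open>\<F>\<close> enters through
  \<open>M_cover\<close>.\<close>

lemma large_family_design:
  fixes k :: "nat \<Rightarrow> nat"
  assumes P: "finite P" "card P = r" "1 \<le> r"
    and k: "strict_mono_on {1..Suc s} k" "k (Suc s) = r" and s: "1 \<le> s"
    and V: "finite V" "1 \<le> card V" "\<F> \<subseteq> Pow V"
    and f: "\<And>S. S \<in> \<F> \<Longrightarrow> bij_betw (f S) S P"
    and inter: "\<And>S S'. S \<in> \<F> \<Longrightarrow> S' \<in> \<F> \<Longrightarrow> S \<noteq> S' \<Longrightarrow> card (S \<inter> S') \<in> k ` {1..s}"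
    and large: "hom_const r * card V ^ (s - 1) < card \<F>"
  shows "\<exists>\<chi> \<G>. \<G> \<subseteq> \<F> \<and> (\<forall>S\<in>\<G>. \<forall>v\<in>S. \<chi> v = f S v) \<and> partite \<chi> P \<G> \<and>
    card \<F> \<le> hom_const r * card \<G> \<and> closure_design P (traces \<chi> P \<G>) k s"
proof -
  obtain \<chi> where \<chi>: "card \<F> \<le> r ^ r * card {S \<in> \<F>. \<forall>v\<in>S. \<chi> v = f S v}"
    using exists_common_colouring[OF V(1) _ P f] V(3) by blast
  let ?\<F>' = "{S \<in> \<F>. \<forall>v\<in>S. \<chi> v = f S v}"
  have finF: "finite \<F>" using V finite_subset by auto
  have bij: "bij_betw \<chi> S P" if "S \<in> ?\<F>'" for S
    using f[of S] bij_betw_cong[of S \<chi> "f S" P] that by simp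
  then have "partite \<chi> P ?\<F>'" by (simp add: partite_def)
  then have "\<exists>\<G>\<subseteq>?\<F>'. card ?\<F>' \<le> ((2 ^ r + 1) * (r * Suc r)) ^ (2 ^ r + 1) * card \<G> \<and>
    (\<forall>J\<in>traces \<chi> P \<G>. \<forall>S\<in>\<G>. sunflower_kernel (Suc r) \<G> (restr \<chi> J S))"
    using finF P by (intro homogeneous_subfamily) auto
  then obtain \<G> where G: "\<G> \<subseteq> ?\<F>'"
    "card ?\<F>' \<le> ((2 ^ r + 1) * (r * Suc r)) ^ (2 ^ r + 1) * card \<G>"
    "\<And>J S. J \<in> traces \<chi> P \<G> \<Longrightarrow> S \<in> \<G> \<Longrightarrow> sunflower_kernel (Suc r) \<G> (restr \<chi> J S)"
    by (elim exE conjE) (rule that, blast+)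
  have GF: "\<G> \<subseteq> \<F>" "\<forall>S\<in>\<G>. \<forall>v\<in>S. \<chi> v = f S v" using G(1) by auto
  have part: "partite \<chi> P \<G>" using bij G(1) by (auto simp: partite_def)
  have cG: "card \<F> \<le> hom_const r * card \<G>"
    using order_trans[OF \<chi> mult_le_mono2[OF G(2), of "r ^ r"]] by (simp only: hom_const_def mult.assoc)
  have card_tr: "\<exists>i\<in>{1..s}. card J = k i" if J: "J \<in> traces \<chi> P \<G>" for J
  proof -
    obtain S S' where S: "S \<in> \<G>" "S' \<in> \<G>" "S \<noteq> S'" "\<chi> ` (S \<inter> S') = J"
      using J by (auto simp: traces_def avoids_trace_def)
    have "inj_on \<chi> S" using part S(1) by (auto simp: partite_def bij_betw_def)
    then have "card J = card (S \<inter> S')" using S(4) card_image inj_on_subset by (metis Int_lower1)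
    then show ?thesis using inter[of S S'] S GF(1) by auto
  qed
  have "closure_design P (traces \<chi> P \<G>) k s"
  proof
    show "J \<subseteq> P" if "J \<in> traces \<chi> P \<G>" for J using that by (simp add: traces_def)
    show "J \<inter> J' \<in> traces \<chi> P \<G>" if J: "J \<in> traces \<chi> P \<G>" "J' \<in> traces \<chi> P \<G>" for J J'
    proof (rule traces_Int_closed[OF P(1,2) part _ G(3) J])
      obtain i where "i \<in> {1..s}" "card J = k i" using card_tr[OF J(1)] by blast
      then show "J \<noteq> P" using strict_mono_on_less[OF k(1), of i "Suc s"] k(2) P by auto
    qed auto
    show "\<exists>J\<in>traces \<chi> P \<G>. B \<subseteq> J" if B: "B \<subseteq> P" "card B < s" for B
    proof (rule ccontr)
      assume no: "\<not> ?thesis"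
      \<comment> \<open>Two members with equal restrictions to \<open>B\<close> would have a trace
        containing \<open>B\<close>.\<close>
      have "inj_on (restr \<chi> B) \<G>"
      proof (rule inj_onI, rule ccontr)
        fix S S' assume S: "S \<in> \<G>" "S' \<in> \<G>" "restr \<chi> B S = restr \<chi> B S'" "S \<noteq> S'"
        have bS: "bij_betw \<chi> S P" using part S(1) by (simp add: partite_def)
        have "restr \<chi> B S \<subseteq> S \<inter> S'" using S(3) restr_subset[of \<chi> B] by blast
        then have "B \<subseteq> \<chi> ` (S \<inter> S')" using image_restr[OF bS B(1)] by blast
        moreover have "\<chi> ` (S \<inter> S') \<in> traces \<chi> P \<G>"
          using S bS by (auto simp: traces_def avoids_trace_def bij_betw_def)
        ultimately show False using no by blast
      qed
      moreover have "restr \<chi> B ` \<G> \<subseteq> {A. A \<subseteq> V \<and> card A = card B}"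
        using restr_in_subsets[of \<chi> _ P B V] part B(1) GF(1) V(3) by (fastforce simp: partite_def)
      moreover have "finite {A. A \<subseteq> V \<and> card A = card B}" using V(1) by simp
      ultimately have "card \<G> \<le> card {A. A \<subseteq> V \<and> card A = card B}" by (rule card_inj_on_le)
      also have "\<dots> \<le> card V ^ (s - 1)" using V B by (intro card_subsets_le_power) auto
      finally have "hom_const r * card \<G> \<le> hom_const r * card V ^ (s - 1)" by (rule mult_le_mono2)
      then show False using cG large by linarith
    qed
  qed (use P k card_tr in auto)
  then show ?thesis using GF part cG by blast
qed

text \<open>\<open>X\<close> lies two levels below \<open>P\<close>, so the contraction by
  \<open>X\<close> has rank 2: its blocks are points, any two of which span \<open>P\<close>. The
  members of \<open>\<H>\<close> pairwise agree on the colours in \<open>X\<close>.\<close>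

locale supervertices = closure_design P M k s
  for P :: "'p set" and M :: "'p set set" and k :: "nat \<Rightarrow> nat" and s :: nat +
  fixes \<chi> :: "'v \<Rightarrow> 'p" and V :: "'v set" and \<H> :: "'v set set" and X :: "'p set"
  assumes s2: "2 \<le> s" and X: "X \<in> flats" "card X = k (s - 1)"
    and finite_V: "finite V" and \<H>_V: "\<H> \<subseteq> Pow V" and partite: "partite \<chi> P \<H>" and \<H>_ne: "\<H> \<noteq> {}"
    and trace: "S \<in> \<H> \<Longrightarrow> S' \<in> \<H> \<Longrightarrow> S \<noteq> S' \<Longrightarrow> \<chi> ` (S \<inter> S') \<in> M"
    and trace_X: "S \<in> \<H> \<Longrightarrow> S' \<in> \<H> \<Longrightarrow> S \<noteq> S' \<Longrightarrow> X \<subseteq> \<chi> ` (S \<inter> S')"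
begin

lemma s1: "1 \<le> s - 1" "s - 1 \<le> s" "Suc (s - 1) = s"
  using s2 by auto

lemmas block_flat_X = block_flat[OF X s1(1,2), unfolded s1(3)]
lemmas card_block_X = card_block[OF X s1(1,2), unfolded s1(3)]
lemmas blocks_disjoint_X = blocks_disjoint[OF X s1(1,2)]
lemmas Union_blocks_X = Union_blocks[OF X s1(1,2)]
lemmas card_blocks_X = card_blocks[OF X s1(1,2), unfolded s1(3)]

lemma gap_pos: "k (s - 1) < k s"
  using k_less_iff[of "s - 1" s] s2 by auto

lemma bij: "S \<in> \<H> \<Longrightarrow> bij_betw \<chi> S P"
  using partite by (simp add: partite_def)

lemma card_restr_block: "S \<in> \<H> \<Longrightarrow> C \<in> blocks X \<Longrightarrow> card (restr \<chi> C S) = k s - k (s - 1)"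
  using card_restr[OF bij, of S C] block_flat_X(4) card_block_X by simp

lemma restr_block_ne: "S \<in> \<H> \<Longrightarrow> C \<in> blocks X \<Longrightarrow> restr \<chi> C S \<noteq> {}"
  using card_restr_block[of S C] gap_pos by auto

lemma restr_X_eq: "S \<in> \<H> \<Longrightarrow> S' \<in> \<H> \<Longrightarrow> restr \<chi> X S = restr \<chi> X S'"
  by (cases "S = S'") (simp, rule restr_eq_of_trace[OF bij bij trace_X])

text \<open>The colour of \<open>v\<close> decides the block. The trace of two distinct members is a
  flat above \<open>X\<close>; containing one colour of the block, it contains all of it, so the two
  parts coincide. This is why distinct supervertices are disjoint.\<close>

lemma overlap:
  assumes S: "S \<in> \<H>" "S' \<in> \<H>" and C: "C \<in> blocks X" "C' \<in> blocks X"
    and v: "v \<in> restr \<chi> C S" "v \<in> restr \<chi> C' S'"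
  shows "C = C'" "restr \<chi> C S = restr \<chi> C S'"
proof -
  have c: "\<chi> v \<in> C" "\<chi> v \<in> C'" "v \<in> S" "v \<in> S'" using v by (auto simp: restr_def)
  then show "C = C'" using blocks_disjoint_X[OF C] by blast
  show "restr \<chi> C S = restr \<chi> C S'"
  proof (cases "S = S'")
    case False
    have "C \<subseteq> \<chi> ` (S \<inter> S')"
    proof (rule flat_within_block[OF X s1(1,2)])
      show "\<chi> ` (S \<inter> S') \<in> flats" using trace[OF S False] by (simp add: flats_def)
    qed (use trace_X[OF S False] C c in auto)
    then show ?thesis by (rule restr_eq_of_trace[OF bij[OF S(1)] bij[OF S(2)]])
  qed simp
qed

text \<open>Distinct members meet in at most \<open>k s\<close> vertices, the size of
  \<open>X \<union> C\<close>, so their trace has no room for a second block.\<close>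

lemma two_blocks_determine:
  assumes S: "S \<in> \<H>" "S' \<in> \<H>" and C: "C \<in> blocks X" "C' \<in> blocks X" "C \<noteq> C'"
    and eq: "restr \<chi> C S = restr \<chi> C S'" "restr \<chi> C' S = restr \<chi> C' S'"
  shows "S = S'"
proof (rule ccontr)
  assume ne: "S \<noteq> S'"
  let ?J = "\<chi> ` (S \<inter> S')"
  have J: "?J \<in> M" "X \<subseteq> ?J" using trace[OF S ne] trace_X[OF S ne] by auto
  have sub: "D \<subseteq> ?J" if "D \<in> blocks X" "restr \<chi> D S = restr \<chi> D S'" for D
  proof -
    have "restr \<chi> D S \<subseteq> S \<inter> S'" using that(2) restr_subset[of \<chi> D] by blast
    then show ?thesis using image_restr[OF bij[OF S(1)] block_flat_X(4)[OF that(1)]] by blast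
  qed
  have JF: "?J \<in> flats" using J by (simp add: flats_def)
  obtain i where i: "i \<in> {1..s}" "card ?J = k i" using M_card[OF J(1)] by blast
  then have "card ?J \<le> k s" using k_le_iff[of i s] s2 by auto
  then have "X \<union> C = ?J"
    using block_flat_X[OF C(1)] JF J(2) sub[OF C(1) eq(1)] by (intro flat_eqI) auto
  then have "C' \<subseteq> X \<union> C" using sub[OF C(2) eq(2)] by simp
  then have "C' = {}" using blocks_disjoint_X[OF C] block_flat_X(3)[OF C(2)] by blast
  then show False using card_block_X[OF C(2)] gap_pos by simp
qed

definition SV :: "'v set set" where
  "SV = {restr \<chi> C S |C S. C \<in> blocks X \<and> S \<in> \<H>}"

text \<open>Supervertices of different blocks are joined only if one member of \<open>\<H>\<close>
  contains both, so an edge certifies every vertex pair that it covers.\<close>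

definition SE :: "('v set \<times> 'v set) set" where
  "SE = {(restr \<chi> C S, restr \<chi> C' S) |C C' S. C \<in> blocks X \<and> C' \<in> blocks X \<and> C \<noteq> C' \<and> S \<in> \<H>}"

definition strands :: "'v set \<Rightarrow> 'v set set" where
  "strands S = (\<lambda>C. restr \<chi> C S) ` blocks X"

lemma SV_disjoint:
  assumes "p \<in> SV" "q \<in> SV" "v \<in> p" "v \<in> q"
  shows "p = q"
proof -
  obtain C S C' S' where "p = restr \<chi> C S" "q = restr \<chi> C' S'"
    "C \<in> blocks X" "C' \<in> blocks X" "S \<in> \<H>" "S' \<in> \<H>" using assms(1,2) by (auto simp: SV_def)
  then show ?thesis using overlap[of S S' C C' v] assms(3,4) by auto
qed

lemma SV_ne: "p \<in> SV \<Longrightarrow> p \<noteq> {}"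
  using restr_block_ne by (auto simp: SV_def)

lemma SV_subset: "p \<in> SV \<Longrightarrow> p \<subseteq> V"
  using \<H>_V by (auto simp: SV_def restr_def)

lemma card_SV: "p \<in> SV \<Longrightarrow> card p = k s - k (s - 1)"
  using card_restr_block by (auto simp: SV_def)

lemma finite_SV: "finite SV"
  using SV_subset finite_V by (intro finite_subset[of SV "Pow V"]) auto

lemma card_SV_le: "card SV \<le> card V"
proof (rule card_inj_on_le[of "\<lambda>p. SOME v. v \<in> p"])
  have some: "(SOME v. v \<in> p) \<in> p" if "p \<in> SV" for p using SV_ne[OF that] some_in_eq by blast
  show "inj_on (\<lambda>p. SOME v. v \<in> p) SV"
    by (rule inj_onI) (metis SV_disjoint some)
  show "(\<lambda>p. SOME v. v \<in> p) ` SV \<subseteq> V" using some SV_subset by blast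
qed (rule finite_V)

lemma SE_facts: "SE \<subseteq> SV \<times> SV" "sym SE" "irrefl SE"
proof -
  show "SE \<subseteq> SV \<times> SV" by (auto simp: SE_def SV_def)
  show "sym SE" unfolding sym_def SE_def by blast
  show "irrefl SE"
  proof (rule irreflI, rule notI)
    fix p assume "(p, p) \<in> SE"
    then obtain C C' S where C: "C \<in> blocks X" "C' \<in> blocks X" "C \<noteq> C'" "S \<in> \<H>"
      "p = restr \<chi> C S" "p = restr \<chi> C' S" by (auto simp: SE_def)
    obtain v where "v \<in> p" using restr_block_ne C by blast
    then show False using overlap(1)[of S S C C' v] C by auto
  qed
qed

lemma restr_block_inj: "S \<in> \<H> \<Longrightarrow> inj_on (\<lambda>C. restr \<chi> C S) (blocks X)"
proof (rule inj_onI)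
  fix C C' assume S: "S \<in> \<H>" and C: "C \<in> blocks X" "C' \<in> blocks X" "restr \<chi> C S = restr \<chi> C' S"
  obtain v where "v \<in> restr \<chi> C S" using restr_block_ne[OF S C(1)] by blast
  then show "C = C'" using overlap(1)[OF S S C(1,2), of v] C(3) by simp
qed

lemma strands_facts:
  assumes "S \<in> \<H>"
  shows "strands S \<subseteq> SV" "card (strands S) = card (blocks X)" "is_clique SE (strands S)"
proof -
  show "strands S \<subseteq> SV" using assms by (auto simp: strands_def SV_def)
  show "card (strands S) = card (blocks X)"
    unfolding strands_def by (rule card_image[OF restr_block_inj[OF assms]])
  show "is_clique SE (strands S)"
    using assms unfolding is_clique_def strands_def SE_def by blast
qed

lemma strands_common:
  assumes S: "S \<in> \<H>" "S' \<in> \<H>" "S \<noteq> S'"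
  shows "card (strands S \<inter> strands S') \<le> 1"
proof -
  have common: "\<exists>C\<in>blocks X. p = restr \<chi> C S \<and> restr \<chi> C S = restr \<chi> C S'"
    if p: "p \<in> strands S \<inter> strands S'" for p
  proof -
    obtain C C' where C: "C \<in> blocks X" "C' \<in> blocks X" "p = restr \<chi> C S" "p = restr \<chi> C' S'"
      using p by (auto simp: strands_def)
    obtain v where "v \<in> p" using restr_block_ne C S by blast
    then show ?thesis using overlap[of S S' C C' v] C S by auto
  qed
  have eq: "p = q" if "p \<in> strands S \<inter> strands S'" "q \<in> strands S \<inter> strands S'" for p q
    using common[OF that(1)] common[OF that(2)] two_blocks_determine[OF S(1,2)] S(3) by blast
  have fin: "finite (strands S \<inter> strands S')"
    using strands_facts(1)[OF S(1)] finite_SV finite_subset by blast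
  show ?thesis unfolding One_nat_def card_le_Suc0_iff_eq[OF fin] by (intro ballI eq)
qed

lemma strands_inj: "2 \<le> card (blocks X) \<Longrightarrow> inj_on strands \<H>"
proof (rule inj_onI, rule ccontr)
  fix S S' assume m: "2 \<le> card (blocks X)" and S: "S \<in> \<H>" "S' \<in> \<H>" "strands S = strands S'" "S \<noteq> S'"
  then show False using strands_common[OF S(1,2,4)] strands_facts(2)[OF S(1)] by simp
qed

text \<open>The members of \<open>\<H>\<close> agree on \<open>X\<close>, so the choice of the
  member is immaterial.\<close>

definition core :: "'v set" where
  "core = restr \<chi> X (SOME S. S \<in> \<H>)"

lemma core_eq: "S \<in> \<H> \<Longrightarrow> core = restr \<chi> X S"
  unfolding core_def using \<H>_ne by (intro restr_X_eq) (auto simp: some_in_eq)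

lemma core_disjoint: "p \<in> SV \<Longrightarrow> core \<inter> p = {}"
  using block_flat_X(3) core_eq by (auto simp: SV_def restr_def)

text \<open>The clique may mix parts of several members. Joined supervertices have different blocks,
  and there are as many of them as blocks, so every colour outside \<open>X\<close> occurs exactly
  once. The third conclusion is the pairwise condition that makes the union a copy again.\<close>

lemma clique_colouring:
  assumes Q: "Q \<subseteq> SV" "is_clique SE Q" "card Q = card (blocks X)"
  shows "bij_betw \<chi> (core \<union> \<Union>Q) P" "core \<union> \<Union>Q \<subseteq> V"
    "\<And>u v. u \<in> core \<union> \<Union>Q \<Longrightarrow> v \<in> core \<union> \<Union>Q \<Longrightarrow> \<exists>S\<in>\<H>. u \<in> S \<and> v \<in> S"
proof -
  have core_sub: "core \<subseteq> S" if "S \<in> \<H>" for S using core_eq[OF that] restr_subset by metis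
  show pair: "\<exists>S\<in>\<H>. u \<in> S \<and> v \<in> S" if uv: "u \<in> core \<union> \<Union>Q" "v \<in> core \<union> \<Union>Q" for u v
  proof -
    obtain S\<^sub>0 where S0: "S\<^sub>0 \<in> \<H>" using \<H>_ne by blast
    have mem: "\<exists>S\<in>\<H>. p \<subseteq> S" if "p \<in> Q" for p
      using subsetD[OF Q(1) that] restr_subset[of \<chi>] unfolding SV_def by blast
    have edge: "\<exists>S\<in>\<H>. p \<subseteq> S \<and> q \<subseteq> S" if pq: "p \<in> Q" "q \<in> Q" for p q
    proof (cases "p = q")
      case True
      then show ?thesis using mem[OF pq(1)] by blast
    next
      case False
      then have "(p, q) \<in> SE" using Q(2) pq by (simp add: is_clique_def)
      then show ?thesis using restr_subset[of \<chi>] unfolding SE_def by blast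
    qed
    have in_core: "\<exists>S\<in>\<H>. w \<in> S \<and> z \<in> S" if wz: "w \<in> core" "z \<in> core \<union> \<Union>Q" for w z
    proof (cases "z \<in> core")
      case True
      then show ?thesis using core_sub[OF S0] wz S0 by (intro bexI[of _ S\<^sub>0]) auto
    next
      case False
      then obtain p where p: "p \<in> Q" "z \<in> p" using wz by auto
      obtain S where "S \<in> \<H>" "p \<subseteq> S" using mem[OF p(1)] by (rule bexE)
      then show ?thesis using core_sub wz(1) p(2) by (intro bexI[of _ S]) auto
    qed
    show ?thesis
    proof (cases "u \<in> core \<or> v \<in> core")
      case True
      then show ?thesis using in_core[of u v] in_core[of v u] uv by auto
    next
      case False
      then obtain p q where pq: "p \<in> Q" "u \<in> p" "q \<in> Q" "v \<in> q" using uv by auto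
      obtain S where "S \<in> \<H>" "p \<subseteq> S \<and> q \<subseteq> S" using edge[OF pq(1,3)] by (rule bexE)
      then show ?thesis using pq(2,4) by (intro bexI[of _ S]) auto
    qed
  qed
  show "core \<union> \<Union>Q \<subseteq> V"
  proof
    fix u assume "u \<in> core \<union> \<Union>Q"
    then obtain S where "S \<in> \<H>" "u \<in> S \<and> u \<in> S" using pair[of u u] by blast
    then show "u \<in> V" using \<H>_V by auto
  qed
  have "inj_on \<chi> (core \<union> \<Union>Q)"
  proof (rule inj_onI)
    fix u v assume uv: "u \<in> core \<union> \<Union>Q" "v \<in> core \<union> \<Union>Q" "\<chi> u = \<chi> v"
    obtain S where S: "S \<in> \<H>" "u \<in> S \<and> v \<in> S" using pair[OF uv(1,2)] by (rule bexE)
    then show "u = v" using inj_onD[OF bij_betw_imp_inj_on[OF bij[OF S(1)]] uv(3)] by simp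
  qed
  moreover have "\<chi> ` (core \<union> \<Union>Q) = P"
  proof
    show "\<chi> ` (core \<union> \<Union>Q) \<subseteq> P"
    proof (rule image_subsetI)
      fix u assume u: "u \<in> core \<union> \<Union>Q"
      obtain S where S: "S \<in> \<H>" "u \<in> S \<and> u \<in> S" using pair[OF u u] by (rule bexE)
      then show "\<chi> u \<in> P" using bij_betw_apply[OF bij[OF S(1)]] by simp
    qed
    have imgQ: "\<chi> ` p \<in> blocks X" if "p \<in> Q" for p
      using that Q(1) image_restr[OF bij block_flat_X(4)] by (auto simp: SV_def)
    have "inj_on ((`) \<chi>) Q"
    proof (rule inj_onI, rule ccontr)
      fix p q assume pq: "p \<in> Q" "q \<in> Q" "\<chi> ` p = \<chi> ` q" "p \<noteq> q"
      then have "(p, q) \<in> SE" using Q(2) by (simp add: is_clique_def)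
      then obtain C C' S where C: "C \<in> blocks X" "C' \<in> blocks X" "C \<noteq> C'" "S \<in> \<H>"
        "p = restr \<chi> C S" "q = restr \<chi> C' S" by (auto simp: SE_def)
      then show False using pq(3) image_restr[OF bij[OF C(4)] block_flat_X(4)] by simp
    qed
    then have "card ((`) \<chi> ` Q) = card (blocks X)" using card_image Q(3) by metis
    moreover have "finite (blocks X)" using finite_P by (simp add: blocks_def)
    moreover have "(`) \<chi> ` Q \<subseteq> blocks X" using imgQ by blast
    ultimately have "(`) \<chi> ` Q = blocks X" by (intro card_subset_eq)
    then have "\<Union> ((`) \<chi> ` Q) = P - X" using Union_blocks_X by simp
    moreover have "\<chi> ` core = X"
      using core_eq \<H>_ne image_restr[OF bij flats_subset[OF X(1)]] by (metis ex_in_conv)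
    ultimately show "P \<subseteq> \<chi> ` (core \<union> \<Union>Q)" by blast
  qed
  ultimately show "bij_betw \<chi> (core \<union> \<Union>Q) P" by (simp add: bij_betw_def)
qed

text \<open>Two cliques sharing all but one supervertex give two copies meeting in \<open>r - d\<close> vertices, where
  \<open>d\<close> is the block size, and \<open>r - d\<close> exceeds every permitted intersection size.\<close>

lemma near_cliques_contradiction:
  assumes y: "y \<noteq> y'" "y \<notin> K" "y' \<notin> K" "card K = card (blocks X) - 1" "K \<union> {y, y'} \<subseteq> SV"
    "is_clique SE (insert y K)" "is_clique SE (insert y' K)" and m: "3 \<le> card (blocks X)"
    and mem: "\<And>U. U \<subseteq> V \<Longrightarrow> bij_betw \<chi> U P \<Longrightarrow> \<forall>u\<in>U. \<forall>v\<in>U. \<exists>S\<in>\<H>. u \<in> S \<and> v \<in> S \<Longrightarrow> U \<in> \<F>"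
    and inter: "\<And>S S'. S \<in> \<F> \<Longrightarrow> S' \<in> \<F> \<Longrightarrow> S \<noteq> S' \<Longrightarrow> card (S \<inter> S') \<in> k ` {1..s}"
  shows False
proof -
  let ?U = "core \<union> \<Union>(insert y K)" and ?U' = "core \<union> \<Union>(insert y' K)" and ?Z = "core \<union> \<Union>K"
  have finK: "finite K" using y(5) finite_SV finite_subset by blast
  have cQ: "card (insert z K) = card (blocks X)" if "z \<notin> K" for z
    using that finK y(4) m by simp
  have Q: "insert y K \<subseteq> SV" "insert y' K \<subseteq> SV" using y(5) by auto
  note U = clique_colouring[OF Q(1) y(6) cQ[OF y(2)]] and U' = clique_colouring[OF Q(2) y(7) cQ[OF y(3)]]
  have UF: "?U \<in> \<F>" "?U' \<in> \<F>" using U U' by (intro mem; simp)+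
  have disj: "p \<inter> q = {}" if "p \<in> insert y (insert y' K)" "q \<in> insert y (insert y' K)" "p \<noteq> q" for p q
    using SV_disjoint[of p q] that y(5) by blast
  have y_Z: "z \<inter> ?Z = {}" if "z \<in> {y, y'}" for z
  proof -
    have "z \<in> SV" "z \<notin> K" using that y by auto
    then show ?thesis using core_disjoint[of z] disj[of z] that by auto
  qed
  have "?U \<inter> ?U' = ?Z" using y_Z disj[of y y'] y(1) by auto
  moreover have "?U \<noteq> ?U'"
  proof
    assume "?U = ?U'"
    then have "y \<subseteq> ?Z \<union> y'" by blast
    then have "y = {}" using y_Z[of y] disj[of y y'] y(1) by blast
    then show False using SV_ne[of y] Q(1) by simp
  qed
  ultimately have "card ?Z \<in> k ` {1..s}" using inter[OF UF] by simp
  then obtain i where i: "1 \<le> i" "i \<le> s" "card ?Z = k i" by auto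
  then have "card ?Z \<le> k s" using k_le_iff[of i s] s2 by simp
  moreover have "card ?U = card P" using bij_betw_same_card[OF U(1)] .
  moreover have "finite ?U" using U(2) finite_V finite_subset by blast
  then have fin: "finite ?Z" "finite y" by (auto intro: finite_subset)
  have "card ?U = card ?Z + card y"
    using card_Un_disjoint[OF fin] y_Z[of y] by (simp add: Un_ac Int_commute)
  moreover have "card y = k s - k (s - 1)" using card_SV[of y] Q(1) by simp
  \<comment> \<open>With d the block size, three blocks give r - d \<ge> k (s - 1) + 2 d = k s + d,
    which exceeds \<open>k s\<close>.\<close>
  moreover have "(k s - k (s - 1)) * 3 \<le> card P - k (s - 1)"
    using mult_le_mono2[OF m, of "k s - k (s - 1)"] unfolding card_blocks_X .
  moreover have "k s < card P" using k_less_iff[of s "Suc s"] k_top s2 by simp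
  ultimately show False using gap_pos by linarith
qed

end

section \<open>Induced copies\<close>

lemma large_fibre:
  assumes "finite \<G>" "g ` \<G> \<subseteq> Y" "finite Y" "card Y \<le> N"
  shows "\<exists>a. card \<G> \<le> N * card {S \<in> \<G>. g S = a}"
proof (rule ccontr)
  assume "\<not> ?thesis"
  then have less: "\<And>a. N * card {S \<in> \<G>. g S = a} < card \<G>" by (simp add: not_le)
  then have ne: "g ` \<G> \<noteq> {}" by fastforce
  have "card (g ` \<G>) \<le> N" using card_mono[OF assms(3,2)] assms(4) by simp
  have "N * card \<G> = (\<Sum>a\<in>g ` \<G>. N * card {S \<in> \<G>. g S = a})"
    using sum.group[of \<G> "g ` \<G>" g "\<lambda>_. 1 :: nat"] assms(1) by (simp flip: sum_distrib_left)
  also have "\<dots> < (\<Sum>a\<in>g ` \<G>. card \<G>)" using less ne assms(1) by (intro sum_strict_mono) auto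
  also have "\<dots> \<le> N * card \<G>" using \<open>card (g ` \<G>) \<le> N\<close> by simp
  finally show False by simp
qed

text \<open>The last conjunct is what the family of induced copies of a graph satisfies because being an induced
  copy is a condition on pairs of vertices.\<close>

definition copy_system :: "'v set \<Rightarrow> 'p set \<Rightarrow> nat set \<Rightarrow> 'v set set \<Rightarrow> ('v set \<Rightarrow> 'v \<Rightarrow> 'p) \<Rightarrow> bool" where
  "copy_system V P L \<F> f \<longleftrightarrow> \<F> \<subseteq> Pow V \<and> (\<forall>S\<in>\<F>. bij_betw (f S) S P) \<and>
    (\<forall>S\<in>\<F>. \<forall>S'\<in>\<F>. S \<noteq> S' \<longrightarrow> card (S \<inter> S') \<in> L) \<and>
    (\<forall>\<chi> U. U \<subseteq> V \<longrightarrow> bij_betw \<chi> U P \<longrightarrow>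
      (\<forall>u\<in>U. \<forall>v\<in>U. \<exists>S\<in>\<F>. u \<in> S \<and> v \<in> S \<and> (\<forall>w\<in>S. \<chi> w = f S w)) \<longrightarrow> U \<in> \<F>)"

lemmas copy_systemD =
  copy_system_def[THEN iffD1, THEN conjunct1]
  copy_system_def[THEN iffD1, THEN conjunct2, THEN conjunct1]
  copy_system_def[THEN iffD1, THEN conjunct2, THEN conjunct2, THEN conjunct1]
  copy_system_def[THEN iffD1, THEN conjunct2, THEN conjunct2, THEN conjunct2]

text \<open>The threshold must be fixed before the family is known, so the clique size
  \<open>m\<close> is computed from \<open>k\<close> alone. A flat \<open>X\<close> of level s - 1
  is spanned by a set \<open>B\<close> of at most s - 2 colours; fixing the restriction to
  \<open>B\<close> costs a factor n^(s-2) and leaves more than (\<epsilon> / C) n^2 members.\<close>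

lemma few_copies:
  fixes k :: "nat \<Rightarrow> nat" and \<epsilon> :: real
  assumes P: "finite P" "card P = r" "1 \<le> r"
    and k: "strict_mono_on {1..Suc s} k" "k (Suc s) = r" and s: "2 \<le> s"
    and gap: "\<exists>i\<in>{1..s}. k (Suc i) - k i \<noteq> k (Suc s) - k s" and \<epsilon>: "0 < \<epsilon>"
  shows "\<exists>N. \<forall>(V :: 'v set) \<F> f. N \<le> card V \<longrightarrow> finite V \<longrightarrow>
    copy_system V P (k ` {1..s}) \<F> f \<longrightarrow> card \<F> \<le> \<epsilon> * real (card V) ^ s"
proof -
  define C where "C = hom_const r"
  have "0 < C" using hom_const_pos[OF P(3)] by (simp add: C_def)
  then have C: "0 < real C" by simp
  \<comment> \<open>The maximum secures \<open>2 \<le> m\<close> in advance; later it equals the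
    number of blocks, which is at least 3.\<close>
  define m where "m = max 2 ((r - k (s - 1)) div (k s - k (s - 1)))"
  obtain n\<^sub>0 where n0: "\<And>n V E T. n \<ge> n\<^sub>0 \<Longrightarrow> finite (V :: 'v set set) \<Longrightarrow> card V \<le> n \<Longrightarrow> E \<subseteq> V \<times> V \<Longrightarrow>
     sym E \<Longrightarrow> irrefl E \<Longrightarrow> (\<And>t. t \<in> T \<Longrightarrow> t \<subseteq> V \<and> card t = m \<and> is_clique E t) \<Longrightarrow>
     (\<And>t t'. t \<in> T \<Longrightarrow> t' \<in> T \<Longrightarrow> t \<noteq> t' \<Longrightarrow> card (t \<inter> t') \<le> 1) \<Longrightarrow> \<epsilon> / C * real n ^ 2 < card T \<Longrightarrow>
     \<exists>K y y'. y \<noteq> y' \<and> y \<notin> K \<and> y' \<notin> K \<and> card K = m - 1 \<and> K \<union> {y, y'} \<subseteq> V \<and>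
       is_clique E (insert y K) \<and> is_clique E (insert y' K)"
    using cliques_sharing_all_but_one_vertex[of "\<epsilon> / C" m, where 'v = "'v set"] \<epsilon> C
    by (force simp: m_def)
  \<comment> \<open>For at least \<open>n\<^sub>1\<close> vertices, \<epsilon> n^s exceeds C
    n^(s-1), the size at which a design appears.\<close>
  obtain n\<^sub>1 :: nat where n1: "C < n\<^sub>1 * \<epsilon>" using reals_Archimedean3[OF \<epsilon>] by blast
  show ?thesis
  proof (intro exI[of _ "max 1 (max n\<^sub>0 n\<^sub>1)"] allI impI)
    fix V :: "'v set" and \<F> f
    assume n: "max 1 (max n\<^sub>0 n\<^sub>1) \<le> card V" and finV: "finite V"
      and sys: "copy_system V P (k ` {1..s}) \<F> f"
    note f = copy_systemD(2)[OF sys] and inter = copy_systemD(3)[OF sys]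
      and glue = copy_systemD(4)[OF sys]
    have V: "finite V" "\<F> \<subseteq> Pow V" using finV copy_systemD(1)[OF sys] by auto
    let ?n = "card V"
    have pos: "0 < real ?n" using n by simp
    show "card \<F> \<le> \<epsilon> * real ?n ^ s"
    proof (rule ccontr)
      assume "\<not> card \<F> \<le> \<epsilon> * real ?n ^ s"
      then have large: "\<epsilon> * real ?n ^ s < card \<F>" by simp
      have "real n\<^sub>1 * \<epsilon> \<le> ?n * \<epsilon>" using n \<epsilon> by (intro mult_right_mono) auto
      then have "real C * real ?n ^ (s - 1) \<le> (?n * \<epsilon>) * real ?n ^ (s - 1)"
        using n1 by (intro mult_right_mono) auto
      also have "\<dots> = \<epsilon> * real ?n ^ s" using s power_Suc[of "real ?n" "s - 1"] by simp
      finally have "real (C * ?n ^ (s - 1)) < real (card \<F>)" using large by simp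
      then have "hom_const r * ?n ^ (s - 1) < card \<F>" unfolding of_nat_less_iff C_def .
      then have "\<exists>\<chi> \<G>. \<G> \<subseteq> \<F> \<and> (\<forall>S\<in>\<G>. \<forall>v\<in>S. \<chi> v = f S v) \<and> partite \<chi> P \<G> \<and>
          card \<F> \<le> hom_const r * card \<G> \<and> closure_design P (traces \<chi> P \<G>) k s"
        using n V f inter s by (intro large_family_design[OF P k]) auto
      then obtain \<chi> \<G> where G: "\<G> \<subseteq> \<F>" "\<forall>S\<in>\<G>. \<forall>v\<in>S. \<chi> v = f S v" "partite \<chi> P \<G>"
        "card \<F> \<le> C * card \<G>" and des: "closure_design P (traces \<chi> P \<G>) k s"
        unfolding C_def by blast
      interpret closure_design P "traces \<chi> P \<G>" k s by (rule des)
      have si: "1 \<le> s - 1" "s - 1 \<le> Suc s" using s by auto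
      obtain X where X: "X \<in> flats" "card X = k (s - 1)" using flat_of_level[OF si] by blast
      obtain B where B: "B \<subseteq> X" "card B \<le> s - 1 - 1" "cl B = X"
        using flat_generated[OF X si] by blast
      have BP: "B \<subseteq> P" using B flats_subset[OF X(1)] by blast
      have "\<exists>a. card \<G> \<le> ?n ^ (s - 2) * card {S \<in> \<G>. restr \<chi> B S = a}"
      proof (rule large_fibre)
        show "finite \<G>" using G(1) V finite_subset by (metis finite_Pow_iff)
        show "restr \<chi> B ` \<G> \<subseteq> {A. A \<subseteq> V \<and> card A = card B}"
        proof (rule image_subsetI)
          fix S assume "S \<in> \<G>"
          then show "restr \<chi> B S \<in> {A. A \<subseteq> V \<and> card A = card B}"
            using G(1,3) V(2) BP by (intro restr_in_subsets[where P = P]) (auto simp: partite_def)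
        qed
        show "card {A. A \<subseteq> V \<and> card A = card B} \<le> ?n ^ (s - 2)"
          using V n B by (intro card_subsets_le_power) auto
      qed (use V in simp)
      then obtain a where a: "card \<G> \<le> ?n ^ (s - 2) * card {S \<in> \<G>. restr \<chi> B S = a}" ..
      define \<H> where "\<H> = {S \<in> \<G>. restr \<chi> B S = a}"
      have "card \<F> \<le> C * (?n ^ (s - 2) * card \<H>)"
        using order_trans[OF G(4) mult_le_mono2[OF a]] unfolding \<H>_def .
      then have "real (card \<F>) \<le> real (C * (?n ^ (s - 2) * card \<H>))" unfolding of_nat_le_iff .
      then have "\<epsilon> * real ?n ^ s < real ?n ^ (s - 2) * (C * card \<H>)"
        using large by (simp add: mult.commute mult.left_commute)
      moreover have "real ?n ^ s = real ?n ^ (s - 2) * real ?n ^ 2"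
        using power_add[of "real ?n" "s - 2" 2] le_add_diff_inverse2[OF s] by (simp only:)
      ultimately have "real ?n ^ (s - 2) * (\<epsilon> * real ?n ^ 2) < real ?n ^ (s - 2) * (C * card \<H>)"
        by (simp only: mult.commute mult.left_commute)
      then have "\<epsilon> * real ?n ^ 2 < C * card \<H>"
        using pos by (simp only: mult_less_cancel_left_pos zero_less_power)
      then have cH: "\<epsilon> / C * real ?n ^ 2 < card \<H>" using C by (simp add: field_simps)
      have HG: "\<H> \<subseteq> \<G>" by (auto simp: \<H>_def)
      interpret supervertices P "traces \<chi> P \<G>" k s \<chi> V \<H> X
      proof
        show "2 \<le> s" "X \<in> flats" "card X = k (s - 1)" "finite V" by (fact s X V)+
        show "\<H> \<subseteq> Pow V" using HG G(1) V(2) by blast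
        show "partite \<chi> P \<H>" using G(3) HG by (auto simp: partite_def)
        have "0 \<le> \<epsilon> / C * real ?n ^ 2" using \<epsilon> by simp
        then show "\<H> \<noteq> {}" using cH by auto
        fix S S' assume S: "S \<in> \<H>" "S' \<in> \<H>" "S \<noteq> S'"
        have bS: "bij_betw \<chi> S P" using G(3) HG S(1) by (auto simp: partite_def)
        show tr: "\<chi> ` (S \<inter> S') \<in> traces \<chi> P \<G>"
          using S HG bS by (auto simp: traces_def avoids_trace_def bij_betw_def)
        \<comment> \<open>Agreement on \<open>B\<close> spreads to its closure \<open>X\<close>,
          because the trace is a flat containing \<open>B\<close>.\<close>
        have "restr \<chi> B S = restr \<chi> B S'" using S by (simp add: \<H>_def)
        then have "restr \<chi> B S \<subseteq> S \<inter> S'" using restr_subset[of \<chi> B] by blast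
        then have "B \<subseteq> \<chi> ` (S \<inter> S')" using image_restr[OF bS BP] by blast
        then show "X \<subseteq> \<chi> ` (S \<inter> S')" using cl_least[of _ B] tr B(3) by (auto simp: flats_def)
      qed
      let ?d = "k s - k (s - 1)" and ?b = "card (blocks X)"
      have db: "?d * ?b = r - k (s - 1)" using card_blocks_X P(2) by simp
      have ks: "k s < r" using k_less_iff[of s "Suc s"] k(2) s by simp
      \<comment> \<open>Fewer than two blocks contradict \<open>k (s - 1) < k s\<close> and
        \<open>k s < r\<close>. Two blocks make the top two gaps equal, and then all gaps are
        equal.\<close>
      have b3: "3 \<le> ?b"
      proof (rule ccontr)
        assume "\<not> 3 \<le> ?b"
        then consider "?b = 0" | "?b = 1" | "?b = 2" by linarith
        then show False
        proof cases
          case 3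
          then have "k (Suc s) - k s = k s - k (s - 1)" using db ks gap_pos k(2) by simp
          then show False using equal_gaps[OF s] gap by auto
        qed (use db ks gap_pos in auto)
      qed
      have "(r - k (s - 1)) div ?d = ?b"
        using gap_pos unfolding db[symmetric] by (intro nonzero_mult_div_cancel_left) simp
      then have m: "m = ?b" using b3 by (simp add: m_def)
      have "\<exists>K y y'. y \<noteq> y' \<and> y \<notin> K \<and> y' \<notin> K \<and> card K = m - 1 \<and> K \<union> {y, y'} \<subseteq> SV \<and>
        is_clique SE (insert y K) \<and> is_clique SE (insert y' K)"
      proof (rule n0[of ?n SV SE "strands ` \<H>"])
        show "t \<subseteq> SV \<and> card t = m \<and> is_clique SE t" if "t \<in> strands ` \<H>" for t
          using that strands_facts m by auto
        show "card (t \<inter> t') \<le> 1" if "t \<in> strands ` \<H>" "t' \<in> strands ` \<H>" "t \<noteq> t'" for t t'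
          using that strands_common by auto
        show "\<epsilon> / C * real ?n ^ 2 < card (strands ` \<H>)"
          using cH card_image[OF strands_inj] b3 by simp
      qed (use n finite_SV card_SV_le SE_facts in auto)
      then obtain K y y' where K: "y \<noteq> y'" "y \<notin> K" "y' \<notin> K" "card K = ?b - 1" "K \<union> {y, y'} \<subseteq> SV"
        "is_clique SE (insert y K)" "is_clique SE (insert y' K)"
        unfolding m by (elim exE conjE) (rule that)
      show False
      proof (rule near_cliques_contradiction[OF K b3])
        fix U assume U: "U \<subseteq> V" "bij_betw \<chi> U P" "\<forall>u\<in>U. \<forall>v\<in>U. \<exists>S\<in>\<H>. u \<in> S \<and> v \<in> S"
        have "\<exists>S\<in>\<F>. u \<in> S \<and> v \<in> S \<and> (\<forall>w\<in>S. \<chi> w = f S w)" if uv: "u \<in> U" "v \<in> U" for u v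
        proof -
          obtain S where "S \<in> \<H>" "u \<in> S \<and> v \<in> S" using U(3) uv by blast
          then show ?thesis using G(1,2) HG by (intro bexI[of _ S]) auto
        qed
        then show "U \<in> \<F>" by (intro glue[rule_format, OF U(1,2)])
      next
        fix S S' assume "S \<in> \<F>" "S' \<in> \<F>" "S \<noteq> S'"
        then show "card (S \<inter> S') \<in> k ` {1..s}" by (rule inter[rule_format])
      qed
    qed
  qed
qed

text \<open>\<open>f\<close> picks an isomorphism for each copy. Adjacency involves two vertices at
  a time, so one common copy per pair suffices for gluing.\<close>

lemma copy_system_induced_copies:
  fixes G :: "'v pair_pre_digraph" and F :: "'a pair_pre_digraph"
  assumes G: "pair_graph G" and F: "pair_graph F" and FL: "FL_intersecting F L G"
  shows "\<exists>f. copy_system (pverts G) (pverts F) L {S. induced_copy G F S} f"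
proof -
  define \<F> where "\<F> = {S. induced_copy G F S}"
  have "\<forall>S\<in>\<F>. \<exists>f. bij_betw f S (pverts F) \<and>
      (\<forall>u\<in>S. \<forall>v\<in>S. (u, v) \<in> parcs G \<longleftrightarrow> (f u, f v) \<in> parcs F)"
    unfolding \<F>_def using induced_copy_iff[OF G F] by simp
  from bchoice[OF this] obtain f where f: "\<forall>S\<in>\<F>. bij_betw (f S) S (pverts F) \<and>
      (\<forall>u\<in>S. \<forall>v\<in>S. (u, v) \<in> parcs G \<longleftrightarrow> (f S u, f S v) \<in> parcs F)" ..
  have "U \<in> \<F>" if U: "U \<subseteq> pverts G" "bij_betw \<chi> U (pverts F)"
    "\<forall>u\<in>U. \<forall>v\<in>U. \<exists>S\<in>\<F>. u \<in> S \<and> v \<in> S \<and> (\<forall>w\<in>S. \<chi> w = f S w)" for \<chi> U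
  proof -
    have "(u, v) \<in> parcs G \<longleftrightarrow> (\<chi> u, \<chi> v) \<in> parcs F" if uv: "u \<in> U" "v \<in> U" for u v
    proof -
      obtain S where "S \<in> \<F>" "u \<in> S" "v \<in> S" "\<forall>w\<in>S. \<chi> w = f S w" using U(3) uv by blast
      then show ?thesis using f by simp
    qed
    then have "induced_copy G F U" using induced_copy_iff[OF G F] U(1,2) by blast
    then show ?thesis by (simp add: \<F>_def)
  qed
  moreover have "\<F> \<subseteq> Pow (pverts G)" by (auto simp: \<F>_def induced_copy_def)
  moreover have "\<forall>S\<in>\<F>. \<forall>S'\<in>\<F>. S \<noteq> S' \<longrightarrow> card (S \<inter> S') \<in> L"
    using FL by (simp add: FL_intersecting_def \<F>_def)
  ultimately have "copy_system (pverts G) (pverts F) L \<F> f"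
    unfolding copy_system_def using f by (intro conjI allI impI) simp_all
  then show ?thesis by (auto simp: \<F>_def)
qed

lemma finite_pverts: "pair_graph G \<Longrightarrow> finite (pverts G)"
proof -
  assume "pair_graph G"
  then interpret pair_graph G .
  show ?thesis by (rule pair_finite_verts)
qed

lemma Psi_le:
  fixes b :: real
  assumes "pair_graph F" "2 \<le> card (pverts F)"
    and "\<And>G :: nat pair_pre_digraph. pair_graph G \<Longrightarrow> card (pverts G) = n \<Longrightarrow> FL_intersecting F L G \<Longrightarrow>
      N_ind G F \<le> b"
  shows "Psi n F L \<le> b"
  using Max_in[OF finite_Psi_set Psi_set_nonempty[OF assms(1,2)], of n L] assms(3)
  unfolding Psi_def by fastforce

theorem theorem1p5:
  fixes r s :: nat and F :: "'a pair_pre_digraph" and L :: "nat set" and l :: "nat \<Rightarrow> nat"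
  assumes "r \<ge> 3"
    and "pair_graph F" and "card (pverts F) = r"
    and "L \<subseteq> {0..r - 1}" and "L = l ` {1..s}" and "strict_mono_on {1..s} l"
    and "s \<noteq> 1" and "s \<noteq> r"
    and "\<not> arithmetic_progression (map l [1..<Suc s] @ [r])"
  shows "(\<lambda>n. real (Psi n F L)) \<in> o(\<lambda>n. real n ^ s) \<and>
    ((r - l s = l s - l (s - 1)) \<or>
     (r - l s \<noteq> l s - l (s - 1) \<and> \<not> (l s - l (s - 1)) dvd (r - l s))
     \<longrightarrow> (\<lambda>n. real (Psi n F L)) \<in> O(\<lambda>n. real n ^ (s - 1)))"
proof -
  interpret F: pair_graph F by fact
  have P: "finite (pverts F)" "card (pverts F) = r" "1 \<le> r" and r2: "2 \<le> card (pverts F)"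
    using assms(1,3) F.pair_finite_verts by auto
  \<comment> \<open>For \<open>s = 0\<close> the list is just \<open>[r]\<close>, which is trivially
    an arithmetic progression.\<close>
  have "s \<noteq> 0"
  proof
    assume "s = 0"
    then show False using assms(9) by (simp add: arithmetic_progression_def)
  qed
  then have s: "2 \<le> s" "1 \<le> s" using assms(7) by auto
  define k where "k = l(Suc s := r)"
  have k_l: "k i = l i" if "i \<le> s" for i using that by (simp add: k_def)
  have l_less: "l i < r" if "i \<in> {1..s}" for i
  proof -
    have "l i \<in> {0..r - 1}" using that assms(4,5) by blast
    then show ?thesis using assms(1) by auto
  qed
  have k: "strict_mono_on {1..Suc s} k" "k (Suc s) = r"
  proof (rule strict_mono_onI)
    fix i j :: nat assume ij: "i \<in> {1..Suc s}" "j \<in> {1..Suc s}" "i < j"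
    show "k i < k j"
    proof (cases "j = Suc s")
      case True
      then show ?thesis using ij l_less[of i] by (simp add: k_def)
    next
      case False
      then show ?thesis using ij strict_mono_onD[OF assms(6), of i j] by (simp add: k_def)
    qed
  qed (simp add: k_def)
  have L: "L = k ` {1..s}" using assms(5) by (auto simp: k_def)
  have gap: "\<exists>i\<in>{1..s}. k (Suc i) - k i \<noteq> k (Suc s) - k s"
  proof (rule ccontr)
    assume "\<not> ?thesis"
    then have all: "\<forall>i\<in>{1..s}. k (Suc i) - k i = k (Suc s) - k s" by blast
    have nth: "(map l [1..<Suc s] @ [r]) ! i = k (Suc i)" if "i \<le> s" for i
      using that by (cases "i = s") (auto simp: nth_append k_def simp del: upt_Suc)
    \<comment> \<open>The definition of a progression uses integer differences; strict monotonicity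
      identifies them with the truncated ones.\<close>
    have "int ((map l [1..<Suc s] @ [r]) ! Suc i) - int ((map l [1..<Suc s] @ [r]) ! i)
        = int (k (Suc s) - k s)" if "Suc i < length (map l [1..<Suc s] @ [r])" for i
    proof -
      have i: "Suc i \<le> s" using that by (simp del: upt_Suc)
      then have "k (Suc i) < k (Suc (Suc i))" by (intro strict_mono_onD[OF k(1)]) auto
      moreover have "k (Suc (Suc i)) - k (Suc i) = k (Suc s) - k s" using bspec[OF all, of "Suc i"] i by simp
      ultimately show ?thesis using nth[of i] nth[of "Suc i"] i by (simp del: upt_Suc)
    qed
    then show False using assms(9) unfolding arithmetic_progression_def by blast
  qed
  have "(\<lambda>n. real (Psi n F L)) \<in> o(\<lambda>n. real n ^ s)"
  proof (rule landau_o.smallI)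
    fix \<epsilon> :: real assume "0 < \<epsilon>"
    from few_copies[OF P k s(1) gap this, where 'v = nat] obtain N where
      N: "\<forall>(V :: nat set) \<F> f. N \<le> card V \<longrightarrow> finite V \<longrightarrow>
        copy_system V (pverts F) (k ` {1..s}) \<F> f \<longrightarrow> card \<F> \<le> \<epsilon> * real (card V) ^ s" ..
    have "Psi n F L \<le> \<epsilon> * real n ^ s" if "N \<le> n" for n
    proof (rule Psi_le[OF assms(2) r2])
      fix G :: "nat pair_pre_digraph"
      assume G: "pair_graph G" "card (pverts G) = n" "FL_intersecting F L G"
      have fin: "finite (pverts G)" using G(1) by (rule finite_pverts)
      obtain f where "copy_system (pverts G) (pverts F) (k ` {1..s}) {S. induced_copy G F S} f"
        using copy_system_induced_copies[OF G(1) assms(2) G(3)] unfolding L ..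
      then show "N_ind G F \<le> \<epsilon> * real n ^ s"
        using N[rule_format, OF _ fin] that G(2) by (simp add: N_ind_def)
    qed
    then show "\<forall>\<^sub>F n in at_top. norm (real (Psi n F L)) \<le> \<epsilon> * norm (real n ^ s)"
      by (intro eventually_sequentiallyI[of N]) simp
  qed
  moreover have "(\<lambda>n. real (Psi n F L)) \<in> O(\<lambda>n. real n ^ (s - 1))"
    if cond: "(r - l s = l s - l (s - 1)) \<or>
     (r - l s \<noteq> l s - l (s - 1) \<and> \<not> (l s - l (s - 1)) dvd (r - l s))"
  proof (rule landau_o.bigI)
    \<comment> \<open>Either case of the hypothesis excludes a design: equal top gaps would
      propagate to all gaps, and otherwise the block count over a flat of level s - 1 enforces the
      divisibility.\<close>
    have no_design: "\<not> closure_design (pverts F) M k s" for M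
    proof
      assume "closure_design (pverts F) M k s"
      then interpret closure_design "pverts F" M k s .
      show False
      proof (cases "r - l s = l s - l (s - 1)")
        case True
        then have "k (Suc s) - k s = k s - k (s - 1)" using s by (simp add: k_def)
        then show False using equal_gaps[OF s(1)] gap by auto
      next
        case False
        have lt: "k (s - 1) < k s" "k s < r" using strict_mono_onD[OF k(1)] s k(2) by auto
        have "(k (Suc (s - 1)) - k (s - 1)) dvd (card (pverts F) - k (s - 1))"
          using s by (intro step_dvd) auto
        \<comment> \<open>The number r - k (s - 1) differs from r - k s by the divisor
          itself.\<close>
        then have "(k s - k (s - 1)) dvd ((r - k s) + (k s - k (s - 1)))" using s lt P by simp
        then have "(k s - k (s - 1)) dvd (r - k s)" by (simp only: dvd_add_left_iff dvd_refl)
        then show False using cond False by (simp add: k_l)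
      qed
    qed
    show "\<forall>\<^sub>F n in at_top. norm (real (Psi n F L)) \<le> real (hom_const r) * norm (real n ^ (s - 1))"
    proof (rule eventually_sequentiallyI[of 1])
      fix n :: nat assume n: "1 \<le> n"
      have "Psi n F L \<le> real (hom_const r * n ^ (s - 1))"
      proof (rule Psi_le[OF assms(2) r2])
        fix G :: "nat pair_pre_digraph"
        assume G: "pair_graph G" "card (pverts G) = n" "FL_intersecting F L G"
        have fin: "finite (pverts G)" using G(1) by (rule finite_pverts)
        obtain f where f: "copy_system (pverts G) (pverts F) L {S. induced_copy G F S} f"
          using copy_system_induced_copies[OF G(1) assms(2) G(3)] ..
        have "\<not> hom_const r * card (pverts G) ^ (s - 1) < card {S. induced_copy G F S}"
        proof
          assume large: "hom_const r * card (pverts G) ^ (s - 1) < card {S. induced_copy G F S}"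
          have "\<exists>\<chi> \<G>. \<G> \<subseteq> {S. induced_copy G F S} \<and> (\<forall>S\<in>\<G>. \<forall>v\<in>S. \<chi> v = f S v) \<and>
              partite \<chi> (pverts F) \<G> \<and> card {S. induced_copy G F S} \<le> hom_const r * card \<G> \<and>
              closure_design (pverts F) (traces \<chi> (pverts F) \<G>) k s"
            using f[unfolded copy_system_def L] fin n G(2) by (intro large_family_design[OF P k s(2) _ _ _ _ _ large]) auto
          then show False using no_design by blast
        qed
        then show "N_ind G F \<le> real (hom_const r * n ^ (s - 1))"
          unfolding N_ind_def of_nat_le_iff G(2) by simp
      qed
      then show "norm (real (Psi n F L)) \<le> real (hom_const r) * norm (real n ^ (s - 1))" by simp
    qed
    show "0 < real (hom_const r)" using hom_const_pos[OF P(3)] by simp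
  qed
  ultimately show ?thesis by blast
qed

end
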